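(* Let $\alpha\in(-2,2)$, let $\{\Phi_n\}_{n\ge1}$ be i.i.d. random variables uniformly distributed on $\mathbb{T}=\mathbb{R}/2\pi\mathbb{Z}$, and let $\mu_{\omega,\alpha}$ be the random measure on $\mathbb{T}$ and $\mathcal{Q}_\alpha$ the Peyri\`ere measure on $\mathbb{T}\times\Omega$ defined in the context. Then almost surely, for $\mu_{\omega,\alpha}$-almost every $t\in\mathbb{T}$, $$\lim_{N\to\infty}\frac{1}{\log N}\sum_{n=1}^N\frac{\cos(nt+\Phi_n)}{\sqrt n}=\frac{\alpha}{2}.$$ Moreover, for any $\eta>0$, $$\lim_{N\to\infty}\frac{1}{\log N}\log\mathcal{Q}_\alpha\left\{(t,\omega):\ \frac{1}{\log N}\sum_{n=1}^N\frac{\cos(nt+\Phi_n)}{\sqrt n}\notin\frac{\alpha}{2}+[-\eta,\eta]\right\}=-\eta^2.$$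
   Context: $\{\Phi_n\}$ is defined on a probability space $(\Omega,\mathcal{A},P)$ with expectation $\mathbb{E}$. $I_0(x)=\int_0^{2\pi}e^{x\cos u}\frac{du}{2\pi}$ is the modified Bessel function. For real $\alpha$ put $$Q_{N}(t)=\prod_{n=1}^N\frac{\exp\left(\frac{\alpha}{\sqrt n}\cos(nt+\Phi_n)\right)}{I_0(\alpha/\sqrt n)}.$$ For each $t$ this is a nonnegative martingale of mean $1$, and almost surely the random measures $Q_N(t)\frac{dt}{2\pi}$ on $\mathbb{T}$ converge weakly as $N\to\infty$ to a random measure, denoted $\mu_{\omega,\alpha}$. The Peyri\`ere measure $\mathcal{Q}_\alpha$ is the measure on $\mathbb{T}\times\Omega$ defined by $\int h\,d\mathcal{Q}_\alpha=\mathbb{E}\int_{\mathbb{T}}h(t,\omega)\,d\mu_{\omega,\alpha}(t)$ for all bounded measurable $h$. *)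

theory Defs
  imports "HOL-Probability.Probability"
begin

text \<open>
  The group \<open>\<T> = \<real>/2\<pi>\<int>\<close> is represented by its fundamental domain \<open>[0, 2\<pi>)\<close>: the quotient map
  restricts to a Borel isomorphism of \<open>[0, 2\<pi>)\<close> onto \<open>\<T>\<close>, so measures on \<open>\<T>\<close> are measures on this
  interval.  The topologies differ, which matters for weak convergence; continuous functions
  on \<open>\<T>\<close> are the continuous \<open>2\<pi>\<close>-periodic functions on the line.

  \<open>torus\<close> is the probability measure \<open>dt/2\<pi>\<close>; it also serves as the measurable space \<open>\<T>\<close>.
\<close>

definition torus :: "real measure" where
  "torus = uniform_measure (restrict_space lborel {0..<2 * pi}) {0..<2 * pi}"

definition torus_weak_conv :: "(nat \<Rightarrow> real measure) \<Rightarrow> real measure \<Rightarrow> bool" where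
  "torus_weak_conv \<nu> \<mu> \<longleftrightarrow>
     (\<forall>f :: real \<Rightarrow> real. continuous_on UNIV f \<longrightarrow> (\<forall>t. f (t + 2 * pi) = f t) \<longrightarrow>
        (\<lambda>N. \<integral>t. f t \<partial>\<nu> N) \<longlonglongrightarrow> (\<integral>t. f t \<partial>\<mu>))"

definition bessel_I0 :: "real \<Rightarrow> real" where
  "bessel_I0 x = (LBINT u:{0..2 * pi}. exp (x * cos u) / (2 * pi))"

definition chaos_density :: "(nat \<Rightarrow> 'a \<Rightarrow> real) \<Rightarrow> real \<Rightarrow> nat \<Rightarrow> 'a \<Rightarrow> real \<Rightarrow> real" where
  "chaos_density \<Phi> \<alpha> N \<omega> t =
     (\<Prod>n=1..N. exp (\<alpha> / sqrt (real n) * cos (real n * t + \<Phi> n \<omega>)) / bessel_I0 (\<alpha> / sqrt (real n)))"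

definition is_chaos_limit :: "(nat \<Rightarrow> 'a \<Rightarrow> real) \<Rightarrow> real \<Rightarrow> 'a \<Rightarrow> real measure \<Rightarrow> bool" where
  "is_chaos_limit \<Phi> \<alpha> \<omega> \<mu> \<longleftrightarrow>
     finite_measure \<mu> \<and> sets \<mu> = sets torus \<and>
     torus_weak_conv (\<lambda>N. density torus (\<lambda>t. ennreal (chaos_density \<Phi> \<alpha> N \<omega> t))) \<mu>"

text \<open>
  The weak limit is unique where it exists, and it exists almost surely; on the exceptional
  null event the value is the zero measure.
\<close>

definition chaos_measure :: "(nat \<Rightarrow> 'a \<Rightarrow> real) \<Rightarrow> real \<Rightarrow> 'a \<Rightarrow> real measure" where
  "chaos_measure \<Phi> \<alpha> \<omega> =
     (if \<exists>\<mu>. is_chaos_limit \<Phi> \<alpha> \<omega> \<mu> then (THE \<mu>. is_chaos_limit \<Phi> \<alpha> \<omega> \<mu>) else null_measure torus)"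

text \<open>
  The identity \<open>\<integral> h d\<Q>\<^sub>\<alpha> = \<E> \<integral> h(t, \<omega>) d\<mu>\<^sub>\<omega>(t)\<close> for indicator functions \<open>h\<close> of measurable sets.
\<close>

definition peyriere_measure ::
    "'a measure \<Rightarrow> (nat \<Rightarrow> 'a \<Rightarrow> real) \<Rightarrow> real \<Rightarrow> (real \<times> 'a) measure" where
  "peyriere_measure M \<Phi> \<alpha> =
     measure_of (space torus \<times> space M) (sets (torus \<Otimes>\<^sub>M M))
       (\<lambda>A. \<integral>\<^sup>+ \<omega>. (\<integral>\<^sup>+ t. indicator A (t, \<omega>) \<partial>chaos_measure \<Phi> \<alpha> \<omega>) \<partial>M)"

definition log_average :: "(nat \<Rightarrow> 'a \<Rightarrow> real) \<Rightarrow> nat \<Rightarrow> 'a \<Rightarrow> real \<Rightarrow> real" where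
  "log_average \<Phi> N \<omega> t =
     1 / ln (real N) * (\<Sum>n=1..N. cos (real n * t + \<Phi> n \<omega>) / sqrt (real n))"

end

theory Submission
  imports Defs
begin

text \<open>
  Write \<open>T\<^sub>n(t) = \<Sum>\<^sub>i\<^sub>\<le>\<^sub>n cos (i t + \<Phi>\<^sub>i) / \<surd>i\<close> and \<open>Z\<^sub>n(\<beta>) = \<Prod>\<^sub>i\<^sub>\<le>\<^sub>n I\<^sub>0(\<beta> / \<surd>i)\<close>, so that the density at level \<open>n\<close> with
  parameter \<open>\<beta>\<close> is \<open>Q\<^sub>n(t) = exp (\<beta> T\<^sub>n(t)) / Z\<^sub>n(\<beta>)\<close>.  Since \<open>ln I\<^sub>0(x) = x\<^sup>2/4 + O(x\<^sup>3)\<close>, one has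
  \<open>ln Z\<^sub>n(\<beta>) = (\<beta>\<^sup>2/4) ln n + O(1)\<close>.

  Weighting the phases by \<open>Q\<^sub>N(t)\<close> with parameter \<open>\<alpha>\<close> makes \<open>T\<^sub>N(t)\<close> look like a Gaussian variable of mean
  \<open>(\<alpha>/2) ln N\<close> and variance \<open>(1/2) ln N\<close>, because its moment generating function is \<open>Z\<^sub>N(\<alpha>+\<lambda>) / Z\<^sub>N(\<alpha>)\<close>.
  Comparing the densities with parameters \<open>\<alpha>\<close> and \<open>\<alpha> \<plusminus> 2\<epsilon>\<close> at the first time the field leaves its
  typical range gives one estimate, \<open>expectation_deviation\<close>: the weight of
  \<open>{\<exists>n \<ge> K. \<bar>T\<^sub>n(t) - (\<alpha>/2) ln n\<bar> > \<epsilon> ln n}\<close> is \<open>O(exp (-\<epsilon>\<^sup>2 ln K))\<close>.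
  It gives the almost sure limit as \<open>K \<rightarrow> \<infinity>\<close>, the upper large deviation bound with \<open>K = N\<close>
  and, applied to the shifted parameter \<open>\<alpha> + 2(\<eta> + \<delta>)\<close>, the lower bound as well (\<open>deviation_prob_lower\<close>).

  What makes these computations statements about the Peyriere measure is that on events depending on
  the first \<open>n\<close> phases this measure has density \<open>Q\<^sub>n\<close> (\<open>peyriere_history\<close>).  No mass may get lost in the
  weak limit, so the total mass \<open>\<integral> Q\<^sub>N dt\<close> must be uniformly integrable; this is where \<open>\<bar>\<alpha>\<bar> < 2\<close> enters
  (\<open>total_mass_uniformly_integrable\<close>).  By the same estimate the points whose field leaves the typical
  range carry little mass.  At the other points \<open>Q\<^sub>K = O(K\<^sup>\<gamma>)\<close> with \<open>\<gamma> = \<alpha>\<^sup>2/4 + \<bar>\<alpha>\<bar>\<epsilon> < 1\<close>, while the phases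
  beyond \<open>K \<approx> 1 / \<bar>t - s\<bar>\<close> change \<open>\<E> Q\<^sub>N(t) Q\<^sub>N(s)\<close> only by a bounded factor; so the mass of these points has
  second moment at most a constant times \<open>\<integral>\<integral> \<bar>sin ((t - s)/2)\<bar>\<^sup>-\<^sup>\<gamma> ds dt\<close>, which is finite.

  A uniformly integrable nonnegative martingale converges almost surely and in mean
  (\<open>nonneg_ui_martingale_converges\<close>).  Applied to \<open>\<integral> f Q\<^sub>N dt\<close> for the countably many Bernstein polynomials
  \<open>f\<close>, this makes all integrals of continuous periodic functions converge; Helly's selection theorem
  provides the limit measure, and convergence in mean identifies its expectation.
\<close>

section \<open>Integrals over the circle and the Bessel function\<close>

lemma sets_torus: "sets torus = sets (restrict_space borel {0..<2*pi})"
  by (simp add: torus_def sets_restrict_space)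

lemma space_torus [simp]: "space torus = {0..<2*pi}"
  by (simp add: torus_def space_restrict_space)

lemma sets_torus_top [simp]: "{0..<2*pi} \<in> sets torus"
  using sets.top[of torus] by simp

lemma measurable_torus_imp_borel [measurable_dest]: "f \<in> measurable M torus \<Longrightarrow> f \<in> borel_measurable M"
  using measurable_cong_sets[OF refl sets_torus, of M]
  by (metis measurable_restrict_space2_iff)

lemma borel_imp_measurable_torus: "f \<in> measurable borel M \<Longrightarrow> f \<in> measurable torus M"
  by (metis measurable_restrict_space1 measurable_cong_sets sets_torus)

lemma measurable_ident_torus [measurable]: "(\<lambda>x. x) \<in> borel_measurable torus"
  by (rule borel_imp_measurable_torus) simp

lemma nn_integral_torus:
  fixes f :: "real \<Rightarrow> ennreal"
  assumes [measurable]: "f \<in> borel_measurable borel"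
  shows "(\<integral>\<^sup>+x. f x \<partial>torus) = (\<integral>\<^sup>+x. f x * indicator {0..<2*pi} x \<partial>lborel) / ennreal (2*pi)"
proof -
  have e: "emeasure (restrict_space lborel {0..<2*pi}) {0..<2*pi} = ennreal (2*pi)"
    by (simp add: emeasure_restrict_space)
  have m: "f \<in> borel_measurable (restrict_space lborel {0..<2*pi})"
    by (rule measurable_restrict_space1) simp
  have s: "{0..<2*pi} \<in> sets (restrict_space lborel {0..<2*pi})"
    by (simp add: sets_restrict_space_iff)
  show ?thesis unfolding torus_def
    by (simp add: nn_integral_uniform_measure[OF m s] e nn_integral_restrict_space
        mult.assoc indicator_inter_arith[symmetric])
qed

lemma prob_space_torus: "prob_space torus"
proof (rule prob_spaceI)
  have "emeasure torus (space torus) = (\<integral>\<^sup>+x. 1 \<partial>torus)" by simp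
  also have "\<dots> = ennreal (2*pi) / ennreal (2*pi)" by (subst nn_integral_torus) simp_all
  also have "\<dots> = 1" by (simp add: divide_ennreal)
  finally show "emeasure torus (space torus) = 1" .
qed

interpretation torus: prob_space torus by (rule prob_space_torus)

lemma measure_torus_space [simp]: "measure torus {0..<2*pi} = 1"
  using torus.prob_space by simp

lemma periodic_int:
  assumes "\<And>x. f (x + p) = f (x::real)" shows "f (x + of_int k * p) = f x"
proof (induct k rule: int_induct[where k=0])
  case (step1 i)
  then show ?case using assms[of "x + of_int i * p"] by (simp add: algebra_simps)
next
  case (step2 i)
  then show ?case using assms[of "x + of_int (i-1) * p"] by (simp add: algebra_simps)
qed simp

text \<open>
  Reduce the shift modulo \<open>2\<pi>\<close> to \<open>d \<in> [0, 2\<pi>)\<close>; the part of the translated window that sticks out beyond \<open>2\<pi>\<close>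
  is moved back by periodicity.
\<close>

lemma nn_integral_torus_shift:
  fixes f :: "real \<Rightarrow> ennreal"
  assumes [measurable]: "f \<in> borel_measurable borel" and per: "\<And>x. f (x + 2*pi) = f x"
  shows "(\<integral>\<^sup>+x. f (x + c) \<partial>torus) = (\<integral>\<^sup>+x. f x \<partial>torus)"
proof -
  define k where "k = \<lfloor>c / (2*pi)\<rfloor>"
  define d where "d = c - of_int k * (2*pi)"
  have d: "0 \<le> d" "d < 2*pi"
    unfolding d_def k_def using floor_divide_lower[of "2*pi" c] floor_divide_upper[of "2*pi" c] by (auto simp: algebra_simps)
  have fc: "f (x + c) = f (x + d)" for x
    using periodic_int[of f "2*pi" "x+d" k] per by (simp add: d_def algebra_simps)
  let ?I = "\<lambda>A. \<integral>\<^sup>+x. f x * indicator A x \<partial>lborel"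
  have shift: "?I {a+b..<c+b} = (\<integral>\<^sup>+x. f (x + b) * indicator {a..<c} x \<partial>lborel)" for a b c :: real
    by (subst nn_integral_real_affine[where c=1 and t=b])
      (auto intro!: nn_integral_cong simp: indicator_def add.commute)
  have split: "?I {a..<c} = ?I {a..<b} + ?I {b..<c}" if "a \<le> b" "b \<le> c" for a b c :: real
    using that by (subst nn_integral_add[symmetric]) (auto intro!: nn_integral_cong simp: indicator_def)
  have "(\<integral>\<^sup>+x. f (x + d) * indicator {0..<2*pi} x \<partial>lborel) = ?I {d..<2*pi+d}"
    using shift[of 0 d "2*pi"] by simp
  also have "\<dots> = ?I {d..<2*pi} + ?I {2*pi..<2*pi+d}"
    using d by (intro split) auto
  also have "?I {2*pi..<2*pi+d} = ?I {0..<d}"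
    using shift[of 0 "2*pi" d] by (simp add: per add.commute)
  also have "?I {d..<2*pi} + ?I {0..<d} = ?I {0..<2*pi}"
    using d split[of 0 d "2*pi"] by (simp add: add.commute)
  finally show ?thesis by (simp add: fc nn_integral_torus)
qed

lemma integral_torus_shift:
  fixes f :: "real \<Rightarrow> real"
  assumes [measurable]: "f \<in> borel_measurable borel" and per: "\<And>x. f (x + 2*pi) = f x"
  shows "(\<integral>x. f (x + c) \<partial>torus) = (\<integral>x. f x \<partial>torus)"
proof -
  have e: "(\<integral>\<^sup>+x. ennreal (g (x + c)) \<partial>torus) = (\<integral>\<^sup>+x. ennreal (g x) \<partial>torus)"
    if [measurable]: "g \<in> borel_measurable borel" and "\<And>x. g (x + 2*pi) = g x" for g :: "real \<Rightarrow> real"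
    using nn_integral_torus_shift[of "\<lambda>x. ennreal (g x)" c] that by simp
  have i: "integrable torus (\<lambda>x. f (x + c)) \<longleftrightarrow> integrable torus f"
    using e[of "\<lambda>x. norm (f x)"] per by (simp add: integrable_iff_bounded borel_imp_measurable_torus)
  show ?thesis
  proof (cases "integrable torus f")
    case True
    with i show ?thesis
      using e[of f] e[of "\<lambda>x. - f x"] per by (simp add: real_lebesgue_integral_def)
  qed (simp_all add: i not_integrable_integral_eq)
qed

lemma integrable_torus_bounded:
  fixes f :: "real \<Rightarrow> real"
  assumes "f \<in> borel_measurable borel" "\<And>x. \<bar>f x\<bar> \<le> B"
  shows "integrable torus f"
  by (rule torus.integrable_const_bound[where B=B]) (use assms in \<open>auto intro: borel_imp_measurable_torus\<close>)

text \<open>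
  The first moments of the cosine follow from shift invariance alone: a shift by \<open>\<pi>\<close> changes the sign of
  the cosine, and a shift by \<open>\<pi>/2\<close> turns its square into the square of the sine.
\<close>

lemma integral_torus_cos: "(\<integral>x. cos x \<partial>torus) = 0"
  using integral_torus_shift[of cos pi] by simp

lemma integral_torus_cos_sq: "(\<integral>x. (cos x)\<^sup>2 \<partial>torus) = 1/2"
proof -
  have i: "integrable torus (\<lambda>x. (cos x)\<^sup>2)" "integrable torus (\<lambda>x. (sin x)\<^sup>2)"
    by (rule integrable_torus_bounded[where B=1], measurable, simp add: abs_square_le_1)+
  have "(\<integral>x. (cos (x + pi/2))\<^sup>2 \<partial>torus) = (\<integral>x. (cos x)\<^sup>2 \<partial>torus)"
    by (rule integral_torus_shift) auto
  moreover have "(cos (x + pi/2))\<^sup>2 = (sin x)\<^sup>2" for x :: real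
    by (simp add: cos_add)
  ultimately have "2 * (\<integral>x. (cos x)\<^sup>2 \<partial>torus) = (\<integral>x. (cos x)\<^sup>2 + (sin x)\<^sup>2 \<partial>torus)"
    using i by (subst Bochner_Integration.integral_add) auto
  also have "\<dots> = 1" unfolding sin_cos_squared_add2 by simp
  finally show ?thesis by simp
qed

lemma bessel_I0_eq: "bessel_I0 x = (\<integral>u. exp (x * cos u) \<partial>torus)"
proof -
  have n: "(\<integral>\<^sup>+u. ennreal (exp (x * cos u)) \<partial>torus)
      = (\<integral>\<^sup>+u. ennreal (indicator {0..2*pi} u *\<^sub>R (exp (x * cos u) / (2*pi))) \<partial>lborel)"
  proof -
    have "(\<integral>\<^sup>+u. ennreal (exp (x * cos u)) \<partial>torus)
      = (\<integral>\<^sup>+u. ennreal (exp (x * cos u)) * indicator {0..<2*pi} u / ennreal (2*pi) \<partial>lborel)"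
      by (simp add: nn_integral_torus nn_integral_divide)
    also have "\<dots> = (\<integral>\<^sup>+u. ennreal (indicator {0..2*pi} u *\<^sub>R (exp (x * cos u) / (2*pi))) \<partial>lborel)"
    proof (rule nn_integral_cong_AE)
      have "AE u in lborel. u \<noteq> 2*pi" by (rule AE_lborel_singleton)
      then show "AE u in lborel. ennreal (exp (x * cos u)) * indicator {0..<2*pi} u / ennreal (2*pi)
        = ennreal (indicator {0..2*pi} u *\<^sub>R (exp (x * cos u) / (2*pi)))"
        by eventually_elim (auto simp: indicator_def divide_ennreal)
    qed
    finally show ?thesis .
  qed
  have "(\<integral>u. exp (x * cos u) \<partial>torus) = enn2real (\<integral>\<^sup>+u. ennreal (exp (x * cos u)) \<partial>torus)"
    by (rule integral_eq_nn_integral) (auto intro: borel_imp_measurable_torus)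
  also have "\<dots> = bessel_I0 x"
    unfolding n bessel_I0_def set_lebesgue_integral_def
    by (rule integral_eq_nn_integral[symmetric]) auto
  finally show ?thesis ..
qed

lemma abs_mult_cos_le: "\<bar>x * cos u\<bar> \<le> \<bar>x\<bar>" for x :: real
  using mult_left_mono[OF abs_cos_le_one[of u], of "\<bar>x\<bar>"] by (simp add: abs_mult)

lemma mult_cos_le: "x * cos u \<le> \<bar>x\<bar>" for x :: real
  using abs_mult_cos_le[of x u] by linarith

lemma integrable_exp_cos: "integrable torus (\<lambda>u. exp (x * cos (u + c)))"
  by (rule integrable_torus_bounded[where B="exp \<bar>x\<bar>"]) (auto simp: mult_cos_le)

lemma integral_exp_cos_shift: "(\<integral>u. exp (x * cos (u + c)) \<partial>torus) = bessel_I0 x"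
  unfolding bessel_I0_eq by (rule integral_torus_shift) auto

lemma exp_le_cubic: "\<bar>exp y - (1 + y + y\<^sup>2/2)\<bar> \<le> \<bar>y\<bar>^3 * exp \<bar>y\<bar>" for y :: real
proof -
  obtain t where t: "\<bar>t\<bar> \<le> \<bar>y\<bar>" "exp y = (\<Sum>m<3. y^m / fact m) + exp t / fact 3 * y^3"
    using Maclaurin_exp_le[of y 3] by auto
  have "exp y - (1 + y + y\<^sup>2/2) = exp t / 6 * y^3"
    using t(2) by (simp add: eval_nat_numeral)
  also have "\<bar>\<dots>\<bar> = exp t / 6 * \<bar>y\<bar>^3" by (simp add: abs_mult power_abs)
  also have "\<dots> \<le> exp \<bar>y\<bar> * \<bar>y\<bar>^3"
  proof (intro mult_right_mono)
    have "exp t \<le> exp \<bar>y\<bar>" using t(1) by simp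
    then show "exp t / 6 \<le> exp \<bar>y\<bar>" using exp_ge_zero[of t] by linarith
  qed auto
  finally show ?thesis by (simp add: mult.commute)
qed

lemma bessel_I0_quadratic: "\<bar>bessel_I0 x - (1 + x\<^sup>2/4)\<bar> \<le> \<bar>x\<bar>^3 * exp \<bar>x\<bar>"
proof -
  let ?q = "\<lambda>u. 1 + x * cos u + (x * cos u)\<^sup>2/2"
  have i: "integrable torus cos" "integrable torus (\<lambda>u. (cos u)\<^sup>2)" "integrable torus (\<lambda>u. exp (x * cos u))"
    using integrable_exp_cos[of x 0]
    by (auto intro!: integrable_torus_bounded[where B=1] simp: abs_square_le_1)
  have q: "integrable torus ?q" "(\<integral>u. ?q u \<partial>torus) = 1 + x\<^sup>2/4"
    using i by (simp_all add: power_mult_distrib integral_torus_cos integral_torus_cos_sq)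
  have "bessel_I0 x - (1 + x\<^sup>2/4) = (\<integral>u. exp (x * cos u) - ?q u \<partial>torus)"
    using i q by (simp add: bessel_I0_eq)
  also have "\<bar>\<dots>\<bar> \<le> (\<integral>u. \<bar>x\<bar>^3 * exp \<bar>x\<bar> \<partial>torus)"
  proof (rule order.trans[OF integral_abs_bound], rule integral_mono)
    fix u
    have "\<bar>x * cos u\<bar>^3 * exp \<bar>x * cos u\<bar> \<le> \<bar>x\<bar>^3 * exp \<bar>x\<bar>"
      by (intro mult_mono power_mono) (auto simp: abs_mult_cos_le)
    then show "\<bar>exp (x * cos u) - ?q u\<bar> \<le> \<bar>x\<bar>^3 * exp \<bar>x\<bar>"
      using exp_le_cubic[of "x * cos u"] by linarith
  qed (use i q in auto)
  also have "\<dots> = \<bar>x\<bar>^3 * exp \<bar>x\<bar>" by simp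
  finally show ?thesis .
qed

text \<open>
  Replacing the exponential by the hyperbolic cosine, which has the same integral by symmetry, removes
  the odd Taylor terms, so that the lower bound holds without an error term.
\<close>

lemma bessel_I0_ge: "1 + x\<^sup>2/4 \<le> bessel_I0 x"
proof -
  have i: "integrable torus (\<lambda>u. exp (x * cos u))" "integrable torus (\<lambda>u. exp (- x * cos u))"
    "integrable torus (\<lambda>u. (cos u)\<^sup>2)"
    using integrable_exp_cos[of x 0] integrable_exp_cos[of "-x" 0]
    by (auto intro!: integrable_torus_bounded[where B=1] simp: abs_square_le_1)
  have ch: "1 + y\<^sup>2/2 \<le> (exp y + exp (- y)) / 2" for y :: real
  proof -
    obtain t where t: "exp y = (\<Sum>m<4. y^m / fact m) + exp t / fact 4 * y^4"
      using Maclaurin_exp_le[of y 4] by auto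
    obtain t' where t': "exp (-y) = (\<Sum>m<4. (-y)^m / fact m) + exp t' / fact 4 * (-y)^4"
      using Maclaurin_exp_le[of "-y" 4] by auto
    have "0 \<le> exp t / fact 4 * y^4" "0 \<le> exp t' / fact 4 * y^4" by auto
    then show ?thesis using t t' by (simp add: eval_nat_numeral field_simps)
  qed
  have "1 + x\<^sup>2/4 = (\<integral>u. 1 + (x * cos u)\<^sup>2/2 \<partial>torus)"
    using i by (simp add: power_mult_distrib integral_torus_cos_sq)
  also have "\<dots> \<le> (\<integral>u. (exp (x * cos u) + exp (- x * cos u)) / 2 \<partial>torus)"
  proof (intro integral_mono)
    show "1 + (x * cos u)\<^sup>2/2 \<le> (exp (x * cos u) + exp (- x * cos u)) / 2" for u
      using ch[of "x * cos u"] by simp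
  qed (use i in \<open>auto simp: power_mult_distrib\<close>)
  also have "\<dots> = (bessel_I0 x + bessel_I0 (-x)) / 2"
    using i by (simp add: bessel_I0_eq)
  also have "bessel_I0 (-x) = bessel_I0 x"
    using integral_exp_cos_shift[of x pi] by (simp add: bessel_I0_eq)
  finally show ?thesis by simp
qed

lemma bessel_I0_ge_1: "1 \<le> bessel_I0 x"
  using bessel_I0_ge[of x] zero_le_power2[of x] by linarith

lemma bessel_I0_pos: "0 < bessel_I0 x"
  using bessel_I0_ge_1[of x] by linarith

text \<open>
  A cubic error suffices: at \<open>x = \<beta>/\<surd>i\<close> it is summable over \<open>i\<close>.
\<close>

lemma ln_bessel_I0:
  assumes "\<bar>x\<bar> \<le> R"
  shows "\<bar>ln (bessel_I0 x) - x\<^sup>2/4\<bar> \<le> exp R * \<bar>x\<bar>^3"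
proof -
  have up: "ln (bessel_I0 x) \<le> x\<^sup>2/4 + exp R * \<bar>x\<bar>^3"
  proof -
    have "ln (bessel_I0 x) \<le> bessel_I0 x - 1"
      using bessel_I0_ge_1[of x] by (intro ln_le_minus_one) linarith
    also have "\<dots> \<le> x\<^sup>2/4 + \<bar>x\<bar>^3 * exp \<bar>x\<bar>" using bessel_I0_quadratic[of x] by linarith
    also have "\<bar>x\<bar>^3 * exp \<bar>x\<bar> \<le> \<bar>x\<bar>^3 * exp R" using assms by (intro mult_left_mono) auto
    finally show ?thesis by (simp add: mult.commute)
  qed
  have "x\<^sup>2/4 - (x\<^sup>2/4)\<^sup>2 \<le> ln (1 + x\<^sup>2/4)"
  proof (cases "x\<^sup>2/4 \<le> 1")
    case True then show ?thesis by (intro ln_one_plus_pos_lower_bound) auto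
  next
    case False
    then have "x\<^sup>2/4 - (x\<^sup>2/4)\<^sup>2 \<le> 0"
      using mult_right_mono[of 1 "x\<^sup>2/4" "x\<^sup>2/4"] by (simp add: power2_eq_square[of "x\<^sup>2/4"])
    then show ?thesis by (smt (verit) ln_ge_zero zero_le_power2 divide_nonneg_nonneg)
  qed
  also have "\<dots> \<le> ln (bessel_I0 x)" using bessel_I0_ge[of x] by (subst ln_le_cancel_iff) (auto intro: add_pos_nonneg less_le_trans[OF _ bessel_I0_ge_1])
  finally have lo: "x\<^sup>2/4 - (x\<^sup>2/4)\<^sup>2 \<le> ln (bessel_I0 x)" .
  have "(x\<^sup>2/4)\<^sup>2 \<le> \<bar>x\<bar> * \<bar>x\<bar>^3" 
  proof -
    have "(x\<^sup>2/4)\<^sup>2 = \<bar>x\<bar> * \<bar>x\<bar>^3 / 16" by (simp add: power2_eq_square eval_nat_numeral)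
    moreover have "0 \<le> \<bar>x\<bar> * \<bar>x\<bar>^3" by simp
    ultimately show ?thesis by linarith
  qed
  also have "\<bar>x\<bar> \<le> exp R" using assms exp_ge_add_one_self[of R] by linarith
  then have "\<bar>x\<bar> * \<bar>x\<bar>^3 \<le> exp R * \<bar>x\<bar>^3" by (intro mult_right_mono) auto
  finally show ?thesis using up lo by linarith
qed

section \<open>Uniformly integrable nonnegative martingales\<close>

lemma indicator_Un_Diff: "indicator (A \<union> B) x = indicator A x + (indicator (B - A) x :: real)"
  by (auto simp: indicator_def)

text \<open>
  Two familiar inequalities in one.  For \<open>U = 1\<close> and a submartingale \<open>V\<close> this is Doob's maximal inequality.
  If \<open>U\<close> and \<open>V\<close> are density martingales, it bounds the \<open>U\<close>-weight of the event that \<open>V/U\<close> ever reaches \<open>c\<close>.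
  In both cases the event is split according to the first index \<open>n\<close> with \<open>B n\<close>, where the two processes
  may be compared at time \<open>n\<close> and then carried to time \<open>N\<close>.
\<close>

lemma maximal_inequality_comparison:
  fixes U V :: "nat \<Rightarrow> 'a \<Rightarrow> real"
  assumes sub: "\<And>n. subalgebra M (F n)" and mono: "\<And>n k. n \<le> k \<Longrightarrow> sets (F n) \<subseteq> sets (F k)"
    and iU: "\<And>n. integrable M (U n)" and iV: "\<And>n. integrable M (V n)"
    and U: "\<And>n A. m \<le> n \<Longrightarrow> n \<le> N \<Longrightarrow> A \<in> sets (F n) \<Longrightarrow>
      (\<integral>\<omega>. indicator A \<omega> * U N \<omega> \<partial>M) = (\<integral>\<omega>. indicator A \<omega> * U n \<omega> \<partial>M)"
    and V: "\<And>n A. m \<le> n \<Longrightarrow> n \<le> N \<Longrightarrow> A \<in> sets (F n) \<Longrightarrow>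
      (\<integral>\<omega>. indicator A \<omega> * V n \<omega> \<partial>M) \<le> (\<integral>\<omega>. indicator A \<omega> * V N \<omega> \<partial>M)"
    and B: "\<And>n. m \<le> n \<Longrightarrow> n \<le> N \<Longrightarrow> B n \<in> sets (F n)"
    and le: "\<And>n \<omega>. m \<le> n \<Longrightarrow> n \<le> N \<Longrightarrow> \<omega> \<in> B n \<Longrightarrow> c * U n \<omega> \<le> V n \<omega>"
  shows "c * (\<integral>\<omega>. indicator (\<Union>n\<in>{m..N}. B n) \<omega> * U N \<omega> \<partial>M)
    \<le> (\<integral>\<omega>. indicator (\<Union>n\<in>{m..N}. B n) \<omega> * V N \<omega> \<partial>M)"
proof -
  have FM: "A \<in> sets (F n) \<Longrightarrow> A \<in> sets M" for A n using sub[of n] by (auto simp: subalgebra_def)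
  have iI: "integrable M (\<lambda>\<omega>. indicator A \<omega> * f \<omega>)" if "integrable M f" "A \<in> sets (F n)" for A n and f :: "'a \<Rightarrow> real"
    using integrable_mult_indicator[OF FM[OF that(2)] that(1)] by simp
  let ?E = "\<lambda>k. \<Union>n\<in>{m..<k}. B n"
  have E: "?E k \<in> sets (F (k - 1))" if "m < k" "k \<le> Suc N" for k
  proof (rule sets.finite_UN)
    fix n assume n: "n \<in> {m..<k}"
    have "B n \<in> sets (F n)" using n that by (intro B) auto
    then show "B n \<in> sets (F (k-1))" using mono[of n "k-1"] n by fastforce
  qed simp
  have "c * (\<integral>\<omega>. indicator (?E k) \<omega> * U N \<omega> \<partial>M) \<le> (\<integral>\<omega>. indicator (?E k) \<omega> * V N \<omega> \<partial>M)"
    if "m \<le> k" "k \<le> Suc N" for k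
    using that
  proof (induct k rule: dec_induct)
    case base show ?case by simp
  next
    case (step k)
    have kN: "k \<le> N" using step by simp
    have "?E k \<in> sets (F k)"
    proof (cases "m < k")
      case True
      then show ?thesis using E[of k] kN mono[of "k-1" k] by auto
    next
      case False then show ?thesis by simp
    qed
    moreover have Bk: "B k \<in> sets (F k)" using step kN by (intro B)
    ultimately have F: "?E k \<in> sets (F k)" "B k - ?E k \<in> sets (F k)" by auto
    have un: "?E (Suc k) = ?E k \<union> B k" using step(1) by (auto simp: less_Suc_eq atLeastLessThanSuc)
    have split: "(\<integral>\<omega>. indicator (?E (Suc k)) \<omega> * f \<omega> \<partial>M)
        = (\<integral>\<omega>. indicator (?E k) \<omega> * f \<omega> \<partial>M) + (\<integral>\<omega>. indicator (B k - ?E k) \<omega> * f \<omega> \<partial>M)"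
      if "integrable M f" for f :: "'a \<Rightarrow> real"
      unfolding un indicator_Un_Diff distrib_right
      by (rule Bochner_Integration.integral_add) (use iI[OF that] F in auto)
    have "c * (\<integral>\<omega>. indicator (B k - ?E k) \<omega> * U N \<omega> \<partial>M)
        = (\<integral>\<omega>. indicator (B k - ?E k) \<omega> * (c * U k \<omega>) \<partial>M)"
      using U[OF step(1) kN F(2)] by (simp add: mult.left_commute)
    also have "\<dots> \<le> (\<integral>\<omega>. indicator (B k - ?E k) \<omega> * V k \<omega> \<partial>M)"
      by (intro integral_mono iI[OF _ F(2)] integrable_mult_right iU iV)
        (use le[OF step(1) kN] in \<open>auto simp: indicator_def\<close>)
    also have "\<dots> \<le> (\<integral>\<omega>. indicator (B k - ?E k) \<omega> * V N \<omega> \<partial>M)"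
      by (rule V[OF step(1) kN F(2)])
    finally show ?case using step(3) kN
      by (simp add: split iU iV distrib_left del: UN_simps)
  qed
  from this[of "Suc N"] show ?thesis
    by (cases "m \<le> Suc N") (auto simp: atLeastLessThanSuc_atLeastAtMost)
qed

lemma abs_le_sq_div:
  fixes d :: real assumes "e > 0" shows "\<bar>d\<bar> \<le> d\<^sup>2 / e + e"
proof -
  have "0 \<le> (\<bar>d\<bar> - e)\<^sup>2" by simp
  then have "2 * (\<bar>d\<bar> * e) \<le> d\<^sup>2 + e\<^sup>2" by (simp add: power2_diff)
  moreover have "0 \<le> \<bar>d\<bar> * e" using assms by simp
  ultimately have "\<bar>d\<bar> * e \<le> d\<^sup>2 + e\<^sup>2" by linarith
  then show ?thesis using assms by (simp add: field_simps power2_eq_square)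
qed

text \<open>
  The map \<open>x \<mapsto> exp (-x)\<close> has an inverse with Lipschitz constant \<open>exp K\<close> on the image of \<open>[0, K]\<close>; values above
  \<open>K\<close> are paid for separately.
\<close>

lemma abs_diff_le_exp_neg:
  fixes x y K :: real
  assumes "0 \<le> x" "0 \<le> y"
  shows "\<bar>x - y\<bar> \<le> exp K * \<bar>exp (- x) - exp (- y)\<bar> + (if x > K then x else 0) + (if y > K then y else 0)"
proof -
  have main: "b - a \<le> exp K * \<bar>exp (- b) - exp (- a)\<bar>" if "0 \<le> a" "a \<le> b" "b \<le> K" for a b :: real
  proof -
    have "exp (- a) = exp (- b) * exp (b - a)" by (simp add: exp_add[symmetric])
    moreover have "exp (-b) * (1 + (b - a)) \<le> exp (- b) * exp (b - a)" by simp
    ultimately have "exp (- b) * (b - a) \<le> \<bar>exp (- b) - exp (- a)\<bar>"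
      by (simp add: algebra_simps)
    then have "exp K * (exp (- b) * (b - a)) \<le> exp K * \<bar>exp (- b) - exp (- a)\<bar>"
      by (intro mult_left_mono) auto
    moreover have "1 * (b - a) \<le> exp (K - b) * (b - a)" using that by (intro mult_right_mono) auto
    then have "b - a \<le> exp K * (exp (- b) * (b - a))" by (simp add: exp_diff exp_minus field_simps)
    ultimately show ?thesis by linarith
  qed
  have nn: "0 \<le> exp K * \<bar>exp (- x) - exp (- y)\<bar>" by simp
  show ?thesis
  proof (cases "x \<le> K \<and> y \<le> K")
    case True
    then show ?thesis using main[of x y] main[of y x] assms
      by (cases "x \<le> y") (auto simp: abs_minus_commute)
  next
    case False
    have "\<bar>x - y\<bar> \<le> (if x > K then x else 0) + (if y > K then y else 0)"
      using False assms by (auto simp: abs_le_iff)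
    then show ?thesis using nn by linarith
  qed
qed

lemma convergentI_close:
  fixes X :: "nat \<Rightarrow> real"
  assumes "\<And>k :: nat. \<exists>m. \<forall>n\<ge>m. \<bar>X n - X m\<bar> \<le> 1 / real (Suc k)"
  shows "convergent X"
proof (rule Cauchy_convergent)
  show "Cauchy X"
  proof (rule metric_CauchyI)
    fix e :: real assume "e > 0"
    then obtain k where k: "1 / real (Suc k) < e / 2" using nat_approx_posE[of "e/2"] by (auto simp: field_simps)
    from assms[of k] obtain m where m: "\<forall>n\<ge>m. \<bar>X n - X m\<bar> \<le> 1 / real (Suc k)" by blast
    show "\<exists>M. \<forall>i\<ge>M. \<forall>n\<ge>M. dist (X i) (X n) < e"
    proof (intro exI allI impI)
      fix i n assume "i \<ge> m" "n \<ge> m"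
      then have "\<bar>X i - X m\<bar> < e/2" "\<bar>X n - X m\<bar> < e/2" using m k by (auto intro: le_less_trans)
      then show "dist (X i) (X n) < e" unfolding dist_real_def by linarith
    qed
  qed
qed

text \<open>
  By Jensen's inequality \<open>U\<^sub>n = exp (-X\<^sub>n)\<close> is a bounded submartingale, and
  \<open>\<E> (U\<^sub>N - U\<^sub>n)\<^sup>2 \<le> \<E> U\<^sub>N\<^sup>2 - \<E> U\<^sub>n\<^sup>2\<close>, where the second moments increase to a limit.  So \<open>U\<close> is Cauchy in mean
  square, and uniform integrability turns this into \<open>X\<close> being Cauchy in mean.  The maximal inequality for
  \<open>\<bar>X\<^sub>n - X\<^sub>m\<bar>\<close> then gives convergence almost surely, and Fatou's lemma convergence in mean to the limit.
  The martingale property is phrased by testing against bounded functions of the past, which avoids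
  conditional expectations.
\<close>

theorem (in prob_space) nonneg_ui_martingale_converges:
  fixes X :: "nat \<Rightarrow> 'a \<Rightarrow> real"
  assumes sub: "\<And>n. subalgebra M (F n)" and mono: "\<And>n k. n \<le> k \<Longrightarrow> sets (F n) \<subseteq> sets (F k)"
    and X: "\<And>n. X n \<in> borel_measurable (F n)" and iX: "\<And>n. integrable M (X n)"
    and nonneg: "\<And>n \<omega>. 0 \<le> X n \<omega>"
    and mart: "\<And>n N g. n \<le> N \<Longrightarrow> g \<in> borel_measurable (F n) \<Longrightarrow> (\<And>\<omega>. \<bar>g \<omega>\<bar> \<le> 1) \<Longrightarrow>
      expectation (\<lambda>\<omega>. g \<omega> * X N \<omega>) = expectation (\<lambda>\<omega>. g \<omega> * X n \<omega>)"
    and ui: "\<And>e. e > 0 \<Longrightarrow> \<exists>K. \<forall>n. expectation (\<lambda>\<omega>. if X n \<omega> > K then X n \<omega> else 0) \<le> e"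
  shows "AE \<omega> in M. convergent (\<lambda>n. X n \<omega>)"
    and "integrable M (\<lambda>\<omega>. lim (\<lambda>n. X n \<omega>))"
    and "(\<lambda>n. expectation (\<lambda>\<omega>. \<bar>X n \<omega> - lim (\<lambda>n. X n \<omega>)\<bar>)) \<longlonglongrightarrow> 0"
proof -
  have FM: "f \<in> borel_measurable (F n) \<Longrightarrow> f \<in> borel_measurable M" for f :: "'a \<Rightarrow> real" and n
    using measurable_from_subalg[OF sub[of n]] by auto
  note [measurable] = FM[OF X]
  define U where "U n \<omega> = exp (- X n \<omega>)" for n \<omega>
  have U01: "0 \<le> U n \<omega>" "U n \<omega> \<le> 1" for n \<omega> using nonneg[of n \<omega>] by (auto simp: U_def)
  have UF: "U n \<in> borel_measurable (F n)" for n unfolding U_def using X[of n] by measurable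
  note [measurable] = FM[OF UF]
  have ib: "integrable M f" if "f \<in> borel_measurable M" "\<And>\<omega>. \<bar>f \<omega>\<bar> \<le> 1" for f :: "'a \<Rightarrow> real"
    by (rule integrable_const_bound[where B=1]) (use that in auto)
  have UU: "\<bar>U n \<omega> * U k \<omega>\<bar> \<le> 1" for n k \<omega>
    using U01[of n \<omega>] U01[of k \<omega>] by (simp add: abs_mult mult_le_one)
  have iUU: "integrable M (\<lambda>\<omega>. U n \<omega> * U k \<omega>)" for n k by (rule ib[OF _ UU]) simp
  have iUX: "integrable M (\<lambda>\<omega>. (U n \<omega> * U n \<omega>) * X k \<omega>)" for n k
    by (rule Bochner_Integration.integrable_bound[OF iX[of k]])
      (use UU[of n _ n] nonneg in \<open>auto simp: abs_mult intro!: mult_left_le_one_le\<close>)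
  define a where "a n = expectation (\<lambda>\<omega>. U n \<omega> * U n \<omega>)" for n
  \<comment> \<open>tangent line bound of the exponential at \<open>X n\<close>, multiplied by \<open>U n\<close>; the linear term vanishes by the martingale property\<close>
  have cross: "a n \<le> expectation (\<lambda>\<omega>. U n \<omega> * U N \<omega>)" if "n \<le> N" for n N
  proof -
    have "a n = a n - (expectation (\<lambda>\<omega>. (U n \<omega> * U n \<omega>) * X N \<omega>) - expectation (\<lambda>\<omega>. (U n \<omega> * U n \<omega>) * X n \<omega>))"
      using mart[OF that borel_measurable_times[OF UF[of n] UF[of n]] UU] by simp
    also have "\<dots> = expectation (\<lambda>\<omega>. U n \<omega> * U n \<omega> - ((U n \<omega> * U n \<omega>) * X N \<omega> - (U n \<omega> * U n \<omega>) * X n \<omega>))"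
      unfolding a_def using iUU iUX by simp
    also have "\<dots> \<le> expectation (\<lambda>\<omega>. U n \<omega> * U N \<omega>)"
    proof (rule integral_mono)
      fix \<omega>
      have "1 + (X n \<omega> - X N \<omega>) \<le> exp (X n \<omega> - X N \<omega>)" by (rule exp_ge_add_one_self)
      then have "U n \<omega> * U n \<omega> * (1 + (X n \<omega> - X N \<omega>)) \<le> U n \<omega> * U n \<omega> * exp (X n \<omega> - X N \<omega>)"
        using U01[of n \<omega>] by (intro mult_left_mono) auto
      also have "\<dots> = U n \<omega> * U N \<omega>" by (simp add: U_def exp_add[symmetric])
      finally show "U n \<omega> * U n \<omega> - ((U n \<omega> * U n \<omega>) * X N \<omega> - (U n \<omega> * U n \<omega>) * X n \<omega>) \<le> U n \<omega> * U N \<omega>"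
        by (simp add: algebra_simps)
    qed (use iUU iUX in auto)
    finally show ?thesis .
  qed
  have sq: "expectation (\<lambda>\<omega>. (U N \<omega> - U n \<omega>)\<^sup>2) \<le> a N - a n" if "n \<le> N" for n N
  proof -
    have "expectation (\<lambda>\<omega>. (U N \<omega> - U n \<omega>)\<^sup>2)
        = expectation (\<lambda>\<omega>. U N \<omega> * U N \<omega> + U n \<omega> * U n \<omega> - 2 * (U n \<omega> * U N \<omega>))"
      by (intro Bochner_Integration.integral_cong) (auto simp: power2_eq_square algebra_simps)
    also have "\<dots> = a N + a n - 2 * expectation (\<lambda>\<omega>. U n \<omega> * U N \<omega>)"
      using iUU by (simp add: a_def)
    finally show ?thesis using cross[OF that] by simp
  qed
  have isq: "integrable M (\<lambda>\<omega>. (U N \<omega> - U n \<omega>)\<^sup>2)" for n N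
  proof (rule ib)
    fix \<omega>
    have "\<bar>U N \<omega> - U n \<omega>\<bar> \<le> 1" using U01[of n \<omega>] U01[of N \<omega>] by linarith
    then show "\<bar>(U N \<omega> - U n \<omega>)\<^sup>2\<bar> \<le> 1" by (simp add: abs_square_le_1)
  qed simp
  have "incseq a"
  proof (rule monoI)
    fix n N :: nat assume "n \<le> N"
    have "0 \<le> expectation (\<lambda>\<omega>. (U N \<omega> - U n \<omega>)\<^sup>2)" by simp
    also have "\<dots> \<le> a N - a n" by (rule sq[OF \<open>n \<le> N\<close>])
    finally show "a n \<le> a N" by simp
  qed
  moreover have "a n \<le> 1" for n
  proof -
    have "a n \<le> expectation (\<lambda>_. 1)" unfolding a_def
      by (rule integral_mono) (use iUU UU[of n _ n] in \<open>auto simp: abs_le_iff\<close>)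
    then show ?thesis by (simp add: prob_space)
  qed
  ultimately have "Cauchy a" 
    by (meson incseq_convergent convergent_Cauchy convergentI)
  have L1: "\<exists>n0. \<forall>n\<ge>n0. \<forall>N\<ge>n. expectation (\<lambda>\<omega>. \<bar>X N \<omega> - X n \<omega>\<bar>) \<le> e" if "e > 0" for e
  proof -
    from ui[of "e/4"] that obtain K where
      K: "\<And>n. expectation (\<lambda>\<omega>. if X n \<omega> > K then X n \<omega> else 0) \<le> e/4" by auto
    define h where "h = e / 4 / exp K"
    have h: "h > 0" using that by (simp add: h_def)
    from \<open>Cauchy a\<close> h have "\<exists>n0. \<forall>n\<ge>n0. \<forall>N\<ge>n0. \<bar>a n - a N\<bar> < h * h"
      unfolding Cauchy_def dist_real_def by simp
    then obtain n0 where n0: "\<And>n N. n \<ge> n0 \<Longrightarrow> N \<ge> n0 \<Longrightarrow> \<bar>a n - a N\<bar> < h * h" by blast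
    have iK: "integrable M (\<lambda>\<omega>. if X n \<omega> > K then X n \<omega> else 0)" for n
      by (rule Bochner_Integration.integrable_bound[OF iX[of n]]) (auto simp: nonneg)
    have iU: "integrable M (\<lambda>\<omega>. \<bar>U N \<omega> - U n \<omega>\<bar>)" for n N
    proof (rule ib)
      show "\<bar>\<bar>U N \<omega> - U n \<omega>\<bar>\<bar> \<le> 1" for \<omega>
        using U01[of n \<omega>] U01[of N \<omega>] by linarith
    qed simp
    show ?thesis
    proof (intro exI allI impI)
      fix n N assume n: "n0 \<le> n" "n \<le> N"
      have "expectation (\<lambda>\<omega>. \<bar>U N \<omega> - U n \<omega>\<bar>) \<le> expectation (\<lambda>\<omega>. (U N \<omega> - U n \<omega>)\<^sup>2 / h + h)"
        by (intro integral_mono iU abs_le_sq_div h) (use isq in auto)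
      also have "\<dots> = expectation (\<lambda>\<omega>. (U N \<omega> - U n \<omega>)\<^sup>2) / h + h"
        using isq by (simp add: prob_space)
      also have "\<dots> \<le> h * h / h + h"
        using sq[OF n(2)] n0[of n N] n h by (intro add_right_mono divide_right_mono) auto
      finally have b: "expectation (\<lambda>\<omega>. \<bar>U N \<omega> - U n \<omega>\<bar>) \<le> 2 * h" using h by simp
      have "expectation (\<lambda>\<omega>. \<bar>X N \<omega> - X n \<omega>\<bar>) \<le> expectation (\<lambda>\<omega>. exp K * \<bar>U N \<omega> - U n \<omega>\<bar>
          + (if X N \<omega> > K then X N \<omega> else 0) + (if X n \<omega> > K then X n \<omega> else 0))"
      proof (rule integral_mono)
        show "\<bar>X N \<omega> - X n \<omega>\<bar> \<le> exp K * \<bar>U N \<omega> - U n \<omega>\<bar>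
          + (if X N \<omega> > K then X N \<omega> else 0) + (if X n \<omega> > K then X n \<omega> else 0)" for \<omega>
          unfolding U_def by (rule abs_diff_le_exp_neg) (auto simp: nonneg)
      qed (use iX iU iK in auto)
      also have "\<dots> = exp K * expectation (\<lambda>\<omega>. \<bar>U N \<omega> - U n \<omega>\<bar>)
          + expectation (\<lambda>\<omega>. if X N \<omega> > K then X N \<omega> else 0) + expectation (\<lambda>\<omega>. if X n \<omega> > K then X n \<omega> else 0)"
        using iU iK by simp
      also have "\<dots> \<le> exp K * (2 * h) + e/4 + e/4"
        by (intro add_mono mult_left_mono b K) auto
      also have "\<dots> = e" by (simp add: h_def)
      finally show "expectation (\<lambda>\<omega>. \<bar>X N \<omega> - X n \<omega>\<bar>) \<le> e" .
    qed
  qed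
  have max: "prob {\<omega>\<in>space M. \<exists>n\<ge>m. \<bar>X n \<omega> - X m \<omega>\<bar> > c} \<le> d / c"
    if c: "c > 0" and d: "\<And>N. N \<ge> m \<Longrightarrow> expectation (\<lambda>\<omega>. \<bar>X N \<omega> - X m \<omega>\<bar>) \<le> d" for m c d
  proof -
    define A where "A n = {\<omega>\<in>space M. \<bar>X n \<omega> - X m \<omega>\<bar> > c}" for n
    have AF: "A n \<in> sets (F n)" if "m \<le> n" for n
    proof -
      have [measurable]: "X n \<in> borel_measurable (F n)" "X m \<in> borel_measurable (F n)"
        using X[of n] X[of m] mono[OF that] sub[of n] sub[of m]
        by (auto simp: measurable_def subalgebra_def)
      have "A n = {\<omega>\<in>space (F n). \<bar>X n \<omega> - X m \<omega>\<bar> > c}"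
        using sub[of n] by (simp add: A_def subalgebra_def)
      also have "\<dots> \<in> sets (F n)" by measurable
      finally show ?thesis .
    qed
    have [measurable]: "A n \<in> sets M" for n unfolding A_def by measurable
    have fin: "prob (\<Union>n\<in>{m..N}. A n) \<le> d / c" if "m \<le> N" for N
    proof -
      let ?V = "\<lambda>n \<omega>. \<bar>X n \<omega> - X m \<omega>\<bar>"
      have iV: "integrable M (?V n)" for n using iX by auto
      have "c * (\<integral>\<omega>. indicator (\<Union>n\<in>{m..N}. A n) \<omega> * (1::real) \<partial>M)
          \<le> (\<integral>\<omega>. indicator (\<Union>n\<in>{m..N}. A n) \<omega> * ?V N \<omega> \<partial>M)"
      proof (rule maximal_inequality_comparison[where F=F, OF sub mono])
        fix n B assume n: "m \<le> n" "n \<le> N" and B: "B \<in> sets (F n)"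
        have [measurable]: "X n \<in> borel_measurable (F n)" "X m \<in> borel_measurable (F n)" "B \<in> sets (F n)"
          using X[of n] X[of m] mono[OF n(1)] sub[of n] sub[of m] B
          by (auto simp: measurable_def subalgebra_def)
        \<comment> \<open>testing the martingale against the sign of the increment up to time n\<close>
        define g where "g \<omega> = indicator B \<omega> * sgn (X n \<omega> - X m \<omega>)" for \<omega>
        have g: "g \<in> borel_measurable (F n)" unfolding g_def by measurable
        have g1: "\<bar>g \<omega>\<bar> \<le> 1" for \<omega> by (auto simp: g_def indicator_def abs_sgn_eq)
        note [measurable] = FM[OF g]
        have ig: "integrable M (\<lambda>\<omega>. g \<omega> * X k \<omega>)" for k
          by (rule Bochner_Integration.integrable_bound[OF iX[of k]])
            (use g1 nonneg in \<open>auto simp: abs_mult intro!: mult_left_le_one_le\<close>)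
        have BM: "B \<in> sets M" using B sub[of n] by (auto simp: subalgebra_def)
        have "(\<integral>\<omega>. indicator B \<omega> * ?V n \<omega> \<partial>M) = (\<integral>\<omega>. g \<omega> * X n \<omega> - g \<omega> * X m \<omega> \<partial>M)"
          by (intro Bochner_Integration.integral_cong) (auto simp: g_def indicator_def sgn_if abs_if)
        also have "\<dots> = (\<integral>\<omega>. g \<omega> * X N \<omega> - g \<omega> * X m \<omega> \<partial>M)"
          using ig mart[OF n(2) g g1] by simp
        also have "\<dots> \<le> (\<integral>\<omega>. indicator B \<omega> * ?V N \<omega> \<partial>M)"
          by (rule integral_mono)
            (use ig iX integrable_mult_indicator[OF BM iV[of N]] in \<open>auto simp: g_def indicator_def sgn_if abs_if\<close>)
        finally show "(\<integral>\<omega>. indicator B \<omega> * ?V n \<omega> \<partial>M) \<le> (\<integral>\<omega>. indicator B \<omega> * ?V N \<omega> \<partial>M)" .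
      qed (use iX AF in \<open>auto simp: A_def\<close>)
      also have "\<dots> \<le> (\<integral>\<omega>. ?V N \<omega> \<partial>M)"
        by (rule integral_mono)
          (use iV[of N] integrable_mult_indicator[OF _ iV[of N], of "\<Union>n\<in>{m..N}. A n"] in \<open>auto simp: indicator_def\<close>)
      also have "\<dots> \<le> d" by (rule d[OF that])
      finally show ?thesis using c by (simp add: field_simps)
    qed
    have "(\<lambda>N. prob (\<Union>n\<in>{m..m+N}. A n)) \<longlonglongrightarrow> prob (\<Union>N. \<Union>n\<in>{m..m+N}. A n)"
      by (rule finite_Lim_measure_incseq) (auto simp: incseq_def, force)
    then have "prob (\<Union>N. \<Union>n\<in>{m..m+N}. A n) \<le> d / c"
      by (rule LIMSEQ_le_const2) (use fin in auto)
    also have "(\<Union>N. \<Union>n\<in>{m..m+N}. A n) = {\<omega>\<in>space M. \<exists>n\<ge>m. \<bar>X n \<omega> - X m \<omega>\<bar> > c}"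
    proof safe
      fix \<omega> n assume "\<omega> \<in> space M" "m \<le> n" "c < \<bar>X n \<omega> - X m \<omega>\<bar>"
      then have "\<omega> \<in> A n" "n \<in> {m..m+(n-m)}" by (auto simp: A_def)
      then show "\<omega> \<in> (\<Union>N. \<Union>n\<in>{m..m+N}. A n)" by blast
    qed (auto simp: A_def)
    finally show ?thesis .
  qed
  have "AE \<omega> in M. \<exists>m. \<forall>n\<ge>m. \<bar>X n \<omega> - X m \<omega>\<bar> \<le> 1 / real (Suc k)" for k
  proof -
    let ?c = "1 / real (Suc k)"
    let ?S = "{\<omega>\<in>space M. \<forall>m. \<exists>n\<ge>m. \<bar>X n \<omega> - X m \<omega>\<bar> > ?c}"
    have "prob ?S \<le> 0 + e" if "e > 0" for e
    proof -
      from L1[of "e * ?c"] that obtain m where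
        m: "\<And>N. N \<ge> m \<Longrightarrow> expectation (\<lambda>\<omega>. \<bar>X N \<omega> - X m \<omega>\<bar>) \<le> e * ?c" by auto
      have "prob ?S \<le> prob {\<omega>\<in>space M. \<exists>n\<ge>m. \<bar>X n \<omega> - X m \<omega>\<bar> > ?c}"
        by (rule finite_measure_mono) auto
      also have "\<dots> \<le> e * ?c / ?c" by (rule max) (use m in auto)
      finally show ?thesis by simp
    qed
    then have "prob ?S = 0" using field_le_epsilon[of "prob ?S" 0] by (simp add: measure_le_0_iff)
    then have "emeasure M ?S = 0" by (simp add: emeasure_eq_measure)
    then show ?thesis by (intro AE_I[of _ _ ?S]) (auto simp: not_le)
  qed
  then have "AE \<omega> in M. \<forall>k. \<exists>m. \<forall>n\<ge>m. \<bar>X n \<omega> - X m \<omega>\<bar> \<le> 1 / real (Suc k)"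
    by (simp add: AE_all_countable)
  then show conv: "AE \<omega> in M. convergent (\<lambda>n. X n \<omega>)"
    by eventually_elim (rule convergentI_close, blast)
  let ?L = "\<lambda>\<omega>. lim (\<lambda>n. X n \<omega>)"
  have [measurable]: "?L \<in> borel_measurable M" by (rule borel_measurable_lim_metric) simp
  have fatou: "(\<integral>\<^sup>+\<omega>. ennreal \<bar>X n \<omega> - ?L \<omega>\<bar> \<partial>M) \<le> ennreal d"
    if d: "\<And>N. N \<ge> n \<Longrightarrow> expectation (\<lambda>\<omega>. \<bar>X N \<omega> - X n \<omega>\<bar>) \<le> d" for n d
  proof -
    have "(\<integral>\<^sup>+\<omega>. ennreal \<bar>X n \<omega> - ?L \<omega>\<bar> \<partial>M) = (\<integral>\<^sup>+\<omega>. liminf (\<lambda>N. ennreal \<bar>X N \<omega> - X n \<omega>\<bar>) \<partial>M)"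
    proof (rule nn_integral_cong_AE)
      show "AE \<omega> in M. ennreal \<bar>X n \<omega> - ?L \<omega>\<bar> = liminf (\<lambda>N. ennreal \<bar>X N \<omega> - X n \<omega>\<bar>)"
        using conv
      proof eventually_elim
        case (elim \<omega>)
        then have "(\<lambda>N. X N \<omega>) \<longlonglongrightarrow> ?L \<omega>" by (simp add: convergent_LIMSEQ_iff)
        then have "(\<lambda>N. ennreal \<bar>X N \<omega> - X n \<omega>\<bar>) \<longlonglongrightarrow> ennreal \<bar>?L \<omega> - X n \<omega>\<bar>"
          by (intro tendsto_ennrealI tendsto_intros)
        from lim_imp_Liminf[OF sequentially_bot this] show ?case
          by (simp only: abs_minus_commute[of "X n \<omega>"])
      qed
    qed
    also have "\<dots> \<le> liminf (\<lambda>N. \<integral>\<^sup>+\<omega>. ennreal \<bar>X N \<omega> - X n \<omega>\<bar> \<partial>M)"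
      by (rule nn_integral_liminf) simp
    also have "\<dots> \<le> liminf (\<lambda>N. ennreal d)"
    proof (rule Liminf_mono, rule eventually_sequentiallyI[of n])
      fix N assume "n \<le> N"
      have "(\<integral>\<^sup>+\<omega>. ennreal \<bar>X N \<omega> - X n \<omega>\<bar> \<partial>M) = ennreal (expectation (\<lambda>\<omega>. \<bar>X N \<omega> - X n \<omega>\<bar>))"
        by (rule nn_integral_eq_integral) (use iX in auto)
      then show "(\<integral>\<^sup>+\<omega>. ennreal \<bar>X N \<omega> - X n \<omega>\<bar> \<partial>M) \<le> ennreal d"
        using d[OF \<open>n \<le> N\<close>] by (simp add: ennreal_leI)
    qed
    also have "liminf (\<lambda>N :: nat. ennreal d) = ennreal d" by (rule Liminf_const) simp
    finally show ?thesis .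
  qed
  have iD: "integrable M (\<lambda>\<omega>. X n \<omega> - ?L \<omega>) \<and> expectation (\<lambda>\<omega>. \<bar>X n \<omega> - ?L \<omega>\<bar>) \<le> d"
    if d: "\<And>N. N \<ge> n \<Longrightarrow> expectation (\<lambda>\<omega>. \<bar>X N \<omega> - X n \<omega>\<bar>) \<le> d" for n d
  proof
    have d0: "0 \<le> d" using d[of n] by simp
    show i: "integrable M (\<lambda>\<omega>. X n \<omega> - ?L \<omega>)"
      using fatou[OF d] by (intro integrableI_bounded) (auto intro: le_less_trans)
    have "ennreal (expectation (\<lambda>\<omega>. \<bar>X n \<omega> - ?L \<omega>\<bar>)) = (\<integral>\<^sup>+\<omega>. ennreal \<bar>X n \<omega> - ?L \<omega>\<bar> \<partial>M)"
      using i by (intro nn_integral_eq_integral[symmetric]) auto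
    then show "expectation (\<lambda>\<omega>. \<bar>X n \<omega> - ?L \<omega>\<bar>) \<le> d" using fatou[OF d] d0
      by (metis ennreal_le_iff)
  qed
  from L1[of 1] obtain n where "\<And>N. N \<ge> n \<Longrightarrow> expectation (\<lambda>\<omega>. \<bar>X N \<omega> - X n \<omega>\<bar>) \<le> 1" by auto
  from Bochner_Integration.integrable_diff[OF iX[of n] conjunct1[OF iD[OF this]]]
  show "integrable M ?L" by simp
  show "(\<lambda>n. expectation (\<lambda>\<omega>. \<bar>X n \<omega> - ?L \<omega>\<bar>)) \<longlonglongrightarrow> 0"
  proof (rule LIMSEQ_I)
    fix e :: real assume e: "e > 0"
    with L1[of "e/2"] obtain n0 where
      n0: "\<And>n N. n \<ge> n0 \<Longrightarrow> N \<ge> n \<Longrightarrow> expectation (\<lambda>\<omega>. \<bar>X N \<omega> - X n \<omega>\<bar>) \<le> e/2" by auto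
    have "norm (expectation (\<lambda>\<omega>. \<bar>X n \<omega> - ?L \<omega>\<bar>) - 0) < e" if "n \<ge> n0" for n
      using conjunct2[OF iD[OF n0[OF that]]] e by simp
    then show "\<exists>no. \<forall>n\<ge>no. norm (expectation (\<lambda>\<omega>. \<bar>X n \<omega> - ?L \<omega>\<bar>) - 0) < e" by blast
  qed
qed

section \<open>Growth of the normalising product\<close>

text \<open>
  The induction needs the stronger bound \<open>3 - 2/\<surd>n\<close>, whose increments dominate the summands.
\<close>

lemma sum_inverse_sqrt_cubed_le: "(\<Sum>i=1..n. (1 / sqrt (real i))^3) \<le> 3"
proof -
  have "(\<Sum>i=1..n. (1 / sqrt (real i))^3) \<le> 3 - 2 / sqrt (real n)" if "n \<ge> 1"
    using that
  proof (induct n rule: dec_induct)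
    case (step n)
    let ?a = "sqrt (real n)" and ?b = "sqrt (real (Suc n))"
    have ab: "0 < ?a" "?a \<le> ?b" "?b\<^sup>2 = ?a\<^sup>2 + 1" using step by auto
    have d: "(?b - ?a) * (?b + ?a) = 1" using ab(3) by (simp add: algebra_simps power2_eq_square)
    have b: "0 < ?b" using ab by linarith
    have "?b + ?a \<noteq> 0" using ab b by linarith
    then have "?b - ?a = 1 / (?b + ?a)" by (rule nonzero_eq_divide_eq[THEN iffD2, OF _ d])
    also have "\<dots> \<ge> 1 / (2 * ?b)" by (rule frac_le) (use ab b in linarith)+
    finally have e: "1 / (2 * ?b) \<le> ?b - ?a" .
    have "(1 / ?b)^3 = 1 / (2 * ?b) * (2 / (?b * ?b))" by (simp add: power3_eq_cube)
    also have "\<dots> \<le> (?b - ?a) * (2 / (?a * ?b))"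
      using ab b e by (intro mult_mono e divide_left_mono mult_right_mono) auto
    also have "\<dots> = 2 / ?a - 2 / ?b" using ab b by (simp add: field_simps)
    finally show ?case using step by simp
  qed simp
  then show ?thesis by (cases n) (auto intro: order.trans simp del: sum.cl_ivl_Suc of_nat_Suc)
qed

lemma harm_bounds:
  assumes "n \<ge> 1"
  shows "\<bar>(\<Sum>i=1..n. 1 / real i) - ln (real n)\<bar> \<le> 1"
proof -
  have h: "(\<Sum>i=1..n. 1 / real i) = harm n" by (simp add: harm_def inverse_eq_divide)
  obtain m where m: "n = Suc m" using assms by (cases n) auto
  have "harm n - ln (real n) \<le> harm (Suc 0) - ln (real (Suc 0))"
    using decseq_harm_diff_ln[THEN decseqD, of 0 m] m by simp
  moreover have "ln (real n) \<le> ln (real n + 1)" using assms by simp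
  then have "ln (real n) \<le> harm n" using harm_ge_ln[of n] by linarith
  ultimately show ?thesis unfolding h by (simp add: harm_expand)
qed

definition bessel_prod :: "nat \<Rightarrow> real \<Rightarrow> real" where
  "bessel_prod n \<beta> = (\<Prod>i=1..n. bessel_I0 (\<beta> / sqrt (real i)))"

lemma abs_divide_ge_1_le:
  fixes a c :: real
  assumes "\<bar>a\<bar> \<le> B" "1 \<le> c" shows "\<bar>a / c\<bar> \<le> B"
proof -
  have "\<bar>a / c\<bar> \<le> \<bar>a\<bar> / 1" unfolding abs_divide using assms(2) by (intro divide_mono) auto
  then show ?thesis using assms(1) by simp
qed

lemma bessel_prod_ge_1: "1 \<le> bessel_prod n \<beta>"
  unfolding bessel_prod_def by (rule prod_ge_1) (simp add: bessel_I0_ge_1)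

lemma abs_div_sqrt_le: "i \<ge> 1 \<Longrightarrow> \<bar>\<beta> / sqrt (real i)\<bar> \<le> \<bar>\<beta>\<bar>"
  using mult_left_mono[of "1 / sqrt (real i)" 1 "\<bar>\<beta>\<bar>"] by (simp add: divide_le_eq abs_divide)

text \<open>
  The quadratic terms of \<open>ln I\<^sub>0(\<beta>/\<surd>i)\<close> add up to \<open>\<beta>\<^sup>2/4\<close> times a harmonic number, and the cubic errors are
  summable.
\<close>

lemma ln_bessel_prod: "\<exists>C. \<forall>n\<ge>1. \<bar>ln (bessel_prod n \<beta>) - \<beta>\<^sup>2/4 * ln (real n)\<bar> \<le> C"
proof (intro exI allI impI)
  fix n :: nat assume n: "1 \<le> n"
  have "ln (bessel_prod n \<beta>) = (\<Sum>i=1..n. ln (bessel_I0 (\<beta> / sqrt (real i))))"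
    unfolding bessel_prod_def
    by (intro ln_prod) (auto simp: less_imp_neq[OF bessel_I0_pos, symmetric] bessel_I0_pos)
  moreover have "(\<Sum>i=1..n. (\<beta> / sqrt (real i))\<^sup>2 / 4) = \<beta>\<^sup>2/4 * (\<Sum>i=1..n. 1 / real i)"
    by (simp add: sum_distrib_left power_divide mult.commute)
  ultimately have "\<bar>ln (bessel_prod n \<beta>) - \<beta>\<^sup>2/4 * (\<Sum>i=1..n. 1 / real i)\<bar>
      = \<bar>\<Sum>i=1..n. ln (bessel_I0 (\<beta> / sqrt (real i))) - (\<beta> / sqrt (real i))\<^sup>2 / 4\<bar>"
    by (simp add: sum_subtractf)
  also have "\<dots> \<le> (\<Sum>i=1..n. exp \<bar>\<beta>\<bar> * \<bar>\<beta> / sqrt (real i)\<bar>^3)"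
    by (intro order.trans[OF sum_abs] sum_mono ln_bessel_I0 abs_div_sqrt_le) auto
  also have "\<dots> = exp \<bar>\<beta>\<bar> * \<bar>\<beta>\<bar>^3 * (\<Sum>i=1..n. (1 / sqrt (real i))^3)"
    by (simp add: sum_distrib_left power_divide abs_divide)
  also have "\<dots> \<le> exp \<bar>\<beta>\<bar> * \<bar>\<beta>\<bar>^3 * 3"
    by (intro mult_left_mono sum_inverse_sqrt_cubed_le) auto
  finally have "\<bar>ln (bessel_prod n \<beta>) - \<beta>\<^sup>2/4 * (\<Sum>i=1..n. 1 / real i)\<bar> \<le> exp \<bar>\<beta>\<bar> * \<bar>\<beta>\<bar>^3 * 3" .
  moreover have "\<bar>\<beta>\<^sup>2/4 * (\<Sum>i=1..n. 1 / real i) - \<beta>\<^sup>2/4 * ln (real n)\<bar> \<le> \<beta>\<^sup>2/4 * 1"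
    unfolding right_diff_distrib[symmetric] abs_mult using harm_bounds[OF n]
    by (intro mult_mono) auto
  ultimately show "\<bar>ln (bessel_prod n \<beta>) - \<beta>\<^sup>2/4 * ln (real n)\<bar> \<le> exp \<bar>\<beta>\<bar> * \<bar>\<beta>\<bar>^3 * 3 + \<beta>\<^sup>2/4"
    by linarith
qed

section \<open>Random phases and the density martingale\<close>

locale random_phases = prob_space M for M :: "'a measure" +
  fixes \<Phi> :: "nat \<Rightarrow> 'a \<Rightarrow> real"
  assumes indep: "indep_vars (\<lambda>_. torus) \<Phi> {1..}"
    and uniform: "\<And>n. n \<ge> 1 \<Longrightarrow> distr M torus (\<Phi> n) = torus"
begin

lemma phase_torus: "n \<ge> 1 \<Longrightarrow> \<Phi> n \<in> measurable M torus"
  using indep by (auto simp: indep_vars_def)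

lemma phase_borel: "n \<ge> 1 \<Longrightarrow> \<Phi> n \<in> borel_measurable M"
  using phase_torus by (rule measurable_torus_imp_borel)

text \<open>
  The sigma-algebra of the first \<open>n\<close> phases, pulled back along the phase vector so that its sets are
  explicit preimages.
\<close>

definition history :: "nat \<Rightarrow> 'a measure" where
  "history n = vimage_algebra (space M) (\<lambda>\<omega>. restrict (\<lambda>i. \<Phi> i \<omega>) {1..n}) (PiM {1..n} (\<lambda>_. torus))"

lemma space_history [simp]: "space (history n) = space M"
  by (simp add: history_def)

lemma history_fun: "(\<lambda>\<omega>. restrict (\<lambda>i. \<Phi> i \<omega>) {1..n}) \<in> measurable M (PiM {1..n} (\<lambda>_. torus))"
  by (rule measurable_restrict) (auto intro: phase_torus)

lemma sets_history: "sets (history n) =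
    {(\<lambda>\<omega>. restrict (\<lambda>i. \<Phi> i \<omega>) {1..n}) -` A \<inter> space M | A. A \<in> sets (PiM {1..n} (\<lambda>_. torus))}"
  unfolding history_def
  by (rule sets_vimage_algebra2) (rule measurable_space[OF history_fun, THEN Pi_I])

lemma subalgebra_history: "subalgebra M (history n)"
  unfolding subalgebra_def sets_history using measurable_sets[OF history_fun] by auto

lemma history_sets_M: "A \<in> sets (history n) \<Longrightarrow> A \<in> sets M"
  using subalgebra_history by (auto simp: subalgebra_def)

lemma measurable_history_M: "f \<in> measurable (history n) N \<Longrightarrow> f \<in> measurable M N"
  using measurable_from_subalg[OF subalgebra_history] .

lemma phase_history_torus: "1 \<le> i \<Longrightarrow> i \<le> n \<Longrightarrow> \<Phi> i \<in> measurable (history n) torus"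
proof -
  assume i: "1 \<le> i" "i \<le> n"
  have "(\<lambda>\<omega>. restrict (\<lambda>i. \<Phi> i \<omega>) {1..n}) \<in> measurable (history n) (PiM {1..n} (\<lambda>_. torus))"
    unfolding history_def by (rule measurable_vimage_algebra1) (rule measurable_space[OF history_fun, THEN Pi_I])
  then have "(\<lambda>\<omega>. restrict (\<lambda>i. \<Phi> i \<omega>) {1..n} i) \<in> measurable (history n) torus"
    by (rule measurable_compose) (use i in \<open>auto intro: measurable_component_singleton\<close>)
  then show ?thesis using i by simp
qed

lemma phase_history: "1 \<le> i \<Longrightarrow> i \<le> n \<Longrightarrow> \<Phi> i \<in> borel_measurable (history n)"
  using phase_history_torus by (rule measurable_torus_imp_borel)

lemma history_mono: "n \<le> k \<Longrightarrow> sets (history n) \<subseteq> sets (history k)"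
proof
  fix A assume nk: "n \<le> k" and "A \<in> sets (history n)"
  then obtain B where B: "B \<in> sets (PiM {1..n} (\<lambda>_. torus))"
    "A = (\<lambda>\<omega>. restrict (\<lambda>i. \<Phi> i \<omega>) {1..n}) -` B \<inter> space (history k)"
    by (auto simp: sets_history[of n])
  have "(\<lambda>\<omega>. restrict (\<lambda>i. \<Phi> i \<omega>) {1..n}) \<in> measurable (history k) (PiM {1..n} (\<lambda>_. torus))"
    by (rule measurable_restrict) (use nk in \<open>auto intro: phase_history_torus\<close>)
  from measurable_sets[OF this B(1)] show "A \<in> sets (history k)" by (simp add: B(2))
qed

lemma measurable_history_mono: "f \<in> measurable (history n) N \<Longrightarrow> n \<le> k \<Longrightarrow> f \<in> measurable (history k) N"
  using history_mono[of n k] by (auto simp: measurable_def)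

text \<open>
  The joint phase vector and the next phase are independent as vectors indexed by disjoint sets; the
  sigma-algebras generated by functions of them are smaller.
\<close>

lemma indep_history_next:
  fixes g :: "'a \<Rightarrow> real" and h :: "real \<Rightarrow> real"
  assumes g: "g \<in> borel_measurable (history n)" and h: "h \<in> borel_measurable borel"
  shows "indep_var borel g borel (\<lambda>\<omega>. h (\<Phi> (Suc n) \<omega>))"
proof -
  let ?R = "\<lambda>\<omega>. restrict (\<lambda>i. \<Phi> i \<omega>) {1..n}" and ?S = "\<lambda>\<omega>. restrict (\<lambda>i. \<Phi> i \<omega>) {Suc n}"
  have "indep_var (PiM {1..n} (\<lambda>_. torus)) ?R (PiM {Suc n} (\<lambda>_. torus)) (\<lambda>\<omega>. restrict (\<lambda>i. \<Phi> i \<omega>) {Suc n})"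
    by (rule indep_var_restrict[OF indep]) auto
  then have ind: "indep_set (sigma_sets (space M) {?R -` A \<inter> space M | A. A \<in> sets (PiM {1..n} (\<lambda>_. torus))})
      (sigma_sets (space M) {?S -` A \<inter> space M | A. A \<in> sets (PiM {Suc n} (\<lambda>_. torus))})"
    by (auto simp: indep_var_eq)
  have rv: "(\<lambda>\<omega>. h (\<Phi> (Suc n) \<omega>)) \<in> borel_measurable M"
    using phase_borel[of "Suc n"] h by simp
  have hc: "(\<lambda>f. h (f (Suc n))) \<in> borel_measurable (PiM {Suc n} (\<lambda>_. torus))"
    by (rule measurable_compose[OF measurable_component_singleton[of "Suc n" "{Suc n}" "\<lambda>_. torus"]
        borel_imp_measurable_torus[OF h]]) simp
  have "{(\<lambda>\<omega>. h (\<Phi> (Suc n) \<omega>)) -` A \<inter> space M | A. A \<in> sets borel}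
      \<subseteq> {?S -` A \<inter> space M | A. A \<in> sets (PiM {Suc n} (\<lambda>_. torus))}"
  proof safe
    fix A :: "real set" assume "A \<in> sets borel"
    from measurable_sets[OF hc this]
    show "\<exists>B. (\<lambda>\<omega>. h (\<Phi> (Suc n) \<omega>)) -` A \<inter> space M = ?S -` B \<inter> space M \<and> B \<in> sets (PiM {Suc n} (\<lambda>_. torus))"
      using measurable_space[OF phase_torus[of "Suc n"]]
      by (intro exI[of _ "(\<lambda>f. h (f (Suc n))) -` A \<inter> space (PiM {Suc n} (\<lambda>_. torus))"])
        (auto simp: space_PiM PiE_def)
  qed
  then have hS: "sigma_sets (space M) {(\<lambda>\<omega>. h (\<Phi> (Suc n) \<omega>)) -` A \<inter> space M | A. A \<in> sets borel}
      \<subseteq> sigma_sets (space M) {?S -` A \<inter> space M | A. A \<in> sets (PiM {Suc n} (\<lambda>_. torus))}"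
    by (rule sigma_sets_subseteq)
  have "{g -` A \<inter> space M | A. A \<in> sets borel} \<subseteq> sets (history n)"
    using measurable_sets[OF g] by auto
  then have "sigma_sets (space M) {g -` A \<inter> space M | A. A \<in> sets borel}
      \<subseteq> sigma_sets (space M) {?R -` A \<inter> space M | A. A \<in> sets (PiM {1..n} (\<lambda>_. torus))}"
    unfolding sets_history by (rule sigma_sets_subseteq)
  note hR = this
  have "indep_set (sigma_sets (space M) {g -` A \<inter> space M | A. A \<in> sets borel})
      (sigma_sets (space M) {(\<lambda>\<omega>. h (\<Phi> (Suc n) \<omega>)) -` A \<inter> space M | A. A \<in> sets borel})"
    unfolding indep_set_def
  proof (rule indep_sets_mono_sets[OF ind[unfolded indep_set_def]])
    fix i :: bool
    show "(case i of True \<Rightarrow> sigma_sets (space M) {g -` A \<inter> space M | A. A \<in> sets borel}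
        | False \<Rightarrow> sigma_sets (space M) {(\<lambda>\<omega>. h (\<Phi> (Suc n) \<omega>)) -` A \<inter> space M | A. A \<in> sets borel})
      \<subseteq> (case i of True \<Rightarrow> sigma_sets (space M) {?R -` A \<inter> space M | A. A \<in> sets (PiM {1..n} (\<lambda>_. torus))}
        | False \<Rightarrow> sigma_sets (space M) {?S -` A \<inter> space M | A. A \<in> sets (PiM {Suc n} (\<lambda>_. torus))})"
      using hR hS by (cases i) simp_all
  qed
  then show ?thesis
    unfolding indep_var_eq using rv measurable_history_M[OF g] by simp
qed

lemma integrable_bounded:
  fixes f :: "'a \<Rightarrow> real"
  assumes "f \<in> borel_measurable M" "\<And>\<omega>. \<bar>f \<omega>\<bar> \<le> B" shows "integrable M f"
  by (rule integrable_const_bound[where B=B]) (use assms in auto)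

lemma expectation_exp_cos_phase:
  assumes "n \<ge> 1" shows "expectation (\<lambda>\<omega>. exp (x * cos (c + \<Phi> n \<omega>))) = bessel_I0 x"
proof -
  have "bessel_I0 x = (\<integral>u. exp (x * cos (u + c)) \<partial>distr M torus (\<Phi> n))"
    by (simp only: uniform[OF assms] integral_exp_cos_shift)
  also have "\<dots> = expectation (\<lambda>\<omega>. exp (x * cos (\<Phi> n \<omega> + c)))"
    by (rule integral_distr) (auto intro: phase_torus assms borel_imp_measurable_torus)
  finally show ?thesis by (simp add: add.commute)
qed

lemma expectation_next_phase:
  assumes g: "g \<in> borel_measurable (history n)" "\<And>\<omega>. \<bar>g \<omega>\<bar> \<le> B"
  shows "expectation (\<lambda>\<omega>. g \<omega> * exp (x * cos (c + \<Phi> (Suc n) \<omega>))) = expectation g * bessel_I0 x"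
proof -
  have "expectation (\<lambda>\<omega>. g \<omega> * exp (x * cos (c + \<Phi> (Suc n) \<omega>)))
      = expectation g * expectation (\<lambda>\<omega>. exp (x * cos (c + \<Phi> (Suc n) \<omega>)))"
  proof (rule indep_var_lebesgue_integral[OF indep_history_next[OF g(1), of "\<lambda>u. exp (x * cos (c + u))"]])
    show "integrable M g" by (rule integrable_bounded[OF measurable_history_M[OF g(1)] g(2)])
    show "integrable M (\<lambda>\<omega>. exp (x * cos (c + \<Phi> (Suc n) \<omega>)))"
      using phase_borel[of "Suc n"] by (intro integrable_bounded[where B="exp \<bar>x\<bar>"]) (auto simp: mult_cos_le)
  qed simp
  then show ?thesis by (simp add: expectation_exp_cos_phase)
qed

definition field :: "nat \<Rightarrow> real \<Rightarrow> 'a \<Rightarrow> real" where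
  "field n t \<omega> = (\<Sum>i=1..n. cos (real i * t + \<Phi> i \<omega>) / sqrt (real i))"

abbreviation Q :: "real \<Rightarrow> nat \<Rightarrow> real \<Rightarrow> 'a \<Rightarrow> real" where
  "Q \<beta> n t \<omega> \<equiv> chaos_density \<Phi> \<beta> n \<omega> t"

lemma Q_eq: "Q \<beta> n t \<omega> = exp (\<beta> * field n t \<omega>) / bessel_prod n \<beta>"
  by (simp add: chaos_density_def field_def bessel_prod_def prod_dividef sum_distrib_left exp_sum)

lemma Q_Suc: "Q \<beta> (Suc n) t \<omega> = Q \<beta> n t \<omega> *
    (exp (\<beta> / sqrt (real (Suc n)) * cos (real (Suc n) * t + \<Phi> (Suc n) \<omega>)) / bessel_I0 (\<beta> / sqrt (real (Suc n))))"
  by (simp add: chaos_density_def)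

lemma Q_pos: "0 < Q \<beta> n t \<omega>"
  using bessel_prod_ge_1[of n \<beta>] by (simp add: Q_eq)

lemma Q_nonneg: "0 \<le> Q \<beta> n t \<omega>" using Q_pos by (rule less_imp_le)

lemma abs_field_le: "\<bar>field n t \<omega>\<bar> \<le> real n"
proof -
  have "\<bar>cos (real i * t + \<Phi> i \<omega>) / sqrt (real i)\<bar> \<le> 1" if "i \<in> {1..n}" for i
  proof -
    have "\<bar>cos (real i * t + \<Phi> i \<omega>)\<bar> \<le> sqrt (real i)"
      using that by (intro order.trans[OF abs_cos_le_one]) simp
    then show ?thesis using that by (simp add: divide_le_eq abs_divide)
  qed
  then have "(\<Sum>i=1..n. \<bar>cos (real i * t + \<Phi> i \<omega>) / sqrt (real i)\<bar>) \<le> (\<Sum>i=1..n. 1)"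
    by (rule sum_mono)
  then show ?thesis unfolding field_def by (intro order.trans[OF sum_abs]) simp
qed

lemma Q_le: "Q \<beta> n t \<omega> \<le> exp (\<bar>\<beta>\<bar> * real n)"
proof -
  have "\<beta> * field n t \<omega> \<le> \<bar>\<beta>\<bar> * \<bar>field n t \<omega>\<bar>" by (metis abs_ge_self abs_mult)
  also have "\<dots> \<le> \<bar>\<beta>\<bar> * real n" by (intro mult_left_mono abs_field_le) auto
  finally have "exp (\<beta> * field n t \<omega>) \<le> exp (\<bar>\<beta>\<bar> * real n)" by simp
  moreover have "exp (\<beta> * field n t \<omega>) / bessel_prod n \<beta> \<le> exp (\<beta> * field n t \<omega>) / 1"
    by (intro divide_left_mono bessel_prod_ge_1) (use bessel_prod_ge_1[of n \<beta>] in auto)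
  ultimately show ?thesis unfolding Q_eq by (simp del: exp_le_cancel_iff)
qed

lemma abs_mult_Q_le:
  assumes "\<bar>a\<bar> \<le> B" shows "\<bar>a * Q \<beta> n t \<omega>\<bar> \<le> B * exp (\<bar>\<beta>\<bar> * real n)"
  unfolding abs_mult using assms Q_le[of \<beta> n \<omega> t] Q_nonneg[of \<beta> n \<omega> t] by (intro mult_mono) auto

lemma field_history: "n \<le> k \<Longrightarrow> field n t \<in> borel_measurable (history k)"
  unfolding field_def
  by (intro borel_measurable_sum borel_measurable_divide borel_measurable_const
      measurable_compose[OF _ borel_measurable_cos] borel_measurable_add)
    (auto intro: phase_history)

lemma Q_history: "n \<le> k \<Longrightarrow> Q \<beta> n t \<in> borel_measurable (history k)"
  unfolding Q_eq using field_history[of n k t] by (intro borel_measurable_divide) auto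

lemma field_measurable [measurable]: "field n t \<in> borel_measurable M"
  using field_history[of n n t] by (rule measurable_history_M[OF _ ]) simp

lemma Q_measurable [measurable]: "Q \<beta> n t \<in> borel_measurable M"
  using Q_history[of n n \<beta> t] by (rule measurable_history_M[OF _ ]) simp

lemma integrable_Q: "integrable M (Q \<beta> n t)"
  by (rule integrable_bounded[where B="exp (\<bar>\<beta>\<bar> * real n)"]) (auto simp: abs_of_nonneg Q_nonneg Q_le)

lemma expectation_Q_martingale:
  assumes "n \<le> N" and g: "g \<in> borel_measurable (history n)" "\<And>\<omega>. \<bar>g \<omega>\<bar> \<le> B"
  shows "expectation (\<lambda>\<omega>. g \<omega> * Q \<beta> N t \<omega>) = expectation (\<lambda>\<omega>. g \<omega> * Q \<beta> n t \<omega>)"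
  using assms(1)
proof (induct N rule: dec_induct)
  case (step N)
  let ?x = "\<beta> / sqrt (real (Suc N))" and ?c = "real (Suc N) * t"
  have "expectation (\<lambda>\<omega>. g \<omega> * Q \<beta> (Suc N) t \<omega>)
      = expectation (\<lambda>\<omega>. (g \<omega> * Q \<beta> N t \<omega> / bessel_I0 ?x) * exp (?x * cos (?c + \<Phi> (Suc N) \<omega>)))"
    unfolding Q_Suc by (simp only: times_divide_eq_left times_divide_eq_right mult.assoc)
  also have "\<dots> = expectation (\<lambda>\<omega>. g \<omega> * Q \<beta> N t \<omega> / bessel_I0 ?x) * bessel_I0 ?x"
  proof (rule expectation_next_phase)
    show "(\<lambda>\<omega>. g \<omega> * Q \<beta> N t \<omega> / bessel_I0 ?x) \<in> borel_measurable (history N)"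
      using measurable_history_mono[OF g(1) step(1)] Q_history[of N N \<beta> t] by simp
    show "\<bar>g \<omega> * Q \<beta> N t \<omega> / bessel_I0 ?x\<bar> \<le> B * exp (\<bar>\<beta>\<bar> * real N)" for \<omega>
      by (intro abs_divide_ge_1_le abs_mult_Q_le g(2) bessel_I0_ge_1)
  qed
  also have "\<dots> = expectation (\<lambda>\<omega>. g \<omega> * Q \<beta> N t \<omega>)"
    using bessel_I0_ge_1[of ?x] by simp
  finally show ?case using step by simp
qed simp

lemma expectation_Q: "expectation (Q \<beta> n t) = 1"
  using expectation_Q_martingale[of 0 n "\<lambda>_. 1" 1 \<beta> t] by (simp add: chaos_density_def prob_space)

text \<open>
  The factor that the \<open>i\<close>-th phase contributes to \<open>\<E> Q\<^sub>N(t) Q\<^sub>N(s)\<close> when \<open>t - s = \<theta>\<close>.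
\<close>

definition corr :: "real \<Rightarrow> nat \<Rightarrow> real \<Rightarrow> real" where
  "corr \<beta> i \<theta> = bessel_I0 (2 * \<beta> * cos (real i * \<theta> / 2) / sqrt (real i)) / (bessel_I0 (\<beta> / sqrt (real i)))\<^sup>2"

text \<open>
  The sum \<open>cos (i t + p) + cos (i s + p)\<close> equals \<open>2 cos (i (t - s)/2) cos (i (t + s)/2 + p)\<close>, a single cosine with a new
  amplitude and a shifted phase, so each further phase contributes one value of \<open>I\<^sub>0\<close>.
\<close>

lemma expectation_Q_two_point:
  assumes "n \<le> N" and g: "g \<in> borel_measurable (history n)" "\<And>\<omega>. \<bar>g \<omega>\<bar> \<le> B"
  shows "expectation (\<lambda>\<omega>. g \<omega> * (Q \<beta> N t \<omega> * Q \<beta> N s \<omega>))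
    = expectation (\<lambda>\<omega>. g \<omega> * (Q \<beta> n t \<omega> * Q \<beta> n s \<omega>)) * (\<Prod>i=n+1..N. corr \<beta> i (t - s))"
  using assms(1)
proof (induct N rule: dec_induct)
  case (step N)
  let ?r = "sqrt (real (Suc N))"
  let ?x = "\<beta> / ?r" and ?y = "2 * \<beta> * cos (real (Suc N) * (t - s) / 2) / ?r"
  let ?c = "real (Suc N) * (t + s) / 2"
  have ee: "exp (?x * cos (real (Suc N) * t + p)) * exp (?x * cos (real (Suc N) * s + p))
      = exp (?y * cos (?c + p))" for p
  proof -
    have "cos (real (Suc N) * t + p) + cos (real (Suc N) * s + p)
        = 2 * cos (real (Suc N) * (t - s) / 2) * cos (?c + p)"
      by (subst cos_plus_cos) (simp add: field_simps)
    then have "?x * cos (real (Suc N) * t + p) + ?x * cos (real (Suc N) * s + p) = ?y * cos (?c + p)"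
      unfolding distrib_left[symmetric] by simp
    then show ?thesis by (simp only: exp_add[symmetric])
  qed
  let ?h = "\<lambda>\<omega>. g \<omega> * (Q \<beta> N t \<omega> * Q \<beta> N s \<omega>) / (bessel_I0 ?x)\<^sup>2"
  have "expectation (\<lambda>\<omega>. g \<omega> * (Q \<beta> (Suc N) t \<omega> * Q \<beta> (Suc N) s \<omega>))
      = expectation (\<lambda>\<omega>. ?h \<omega> * exp (?y * cos (?c + \<Phi> (Suc N) \<omega>)))"
    unfolding Q_Suc ee[symmetric]
    by (simp only: power2_eq_square times_divide_eq_left times_divide_eq_right divide_divide_eq_left mult_ac)
  also have "\<dots> = expectation ?h * bessel_I0 ?y"
  proof (rule expectation_next_phase)
    show "?h \<in> borel_measurable (history N)"
      using measurable_history_mono[OF g(1) step(1)] Q_history[of N N \<beta> t] Q_history[of N N \<beta> s] by simp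
    show "\<bar>?h \<omega>\<bar> \<le> B * exp (\<bar>\<beta>\<bar> * real N) * exp (\<bar>\<beta>\<bar> * real N)" for \<omega>
      unfolding mult.assoc[symmetric]
      by (intro abs_divide_ge_1_le abs_mult_Q_le g(2) one_le_power bessel_I0_ge_1)
  qed
  also have "\<dots> = expectation (\<lambda>\<omega>. g \<omega> * (Q \<beta> N t \<omega> * Q \<beta> N s \<omega>)) * corr \<beta> (Suc N) (t - s)"
    by (simp add: corr_def)
  finally show ?case using step by (simp add: mult.assoc)
qed simp

section \<open>Deviations of the field under the tilted law\<close>

text \<open>
  With \<open>\<sigma>\<close> the side of the deviation, compare the parameters \<open>\<beta>\<close> and \<open>\<beta> + l\<close> for \<open>l = 2\<epsilon>\<sigma>\<close>.  On the deviation
  event at time \<open>n\<close> the ratio of the densities is at least \<open>exp ((\<bar>l\<bar>\<epsilon> - l\<^sup>2/4) ln n)\<close> up to a constant, and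
  \<open>l = 2\<epsilon>\<sigma>\<close> maximises this exponent over all shifts, with value \<open>\<epsilon>\<^sup>2\<close>.  Hence the ratio exceeds a multiple of
  \<open>exp (\<epsilon>\<^sup>2 ln K)\<close> at every time in question.
\<close>

lemma expectation_deviation_one_sided:
  assumes \<epsilon>: "0 < \<epsilon>" and \<sigma>: "\<sigma> = 1 \<or> \<sigma> = -1"
  shows "\<exists>C. \<forall>K\<ge>1. \<forall>N t. expectation (\<lambda>\<omega>. indicator
      (\<Union>n\<in>{K..N}. {\<omega>\<in>space M. \<sigma> * (field n t \<omega> - \<beta>/2 * ln (real n)) > \<epsilon> * ln (real n)}) \<omega> * Q \<beta> N t \<omega>)
    \<le> C * real K powr (-\<epsilon>\<^sup>2)"
proof -
  define l where "l = 2 * \<epsilon> * \<sigma>"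
  have l2: "l\<^sup>2 = 4 * \<epsilon>\<^sup>2" using \<sigma> by (auto simp: l_def power2_eq_square)
  obtain C1 where C1: "\<And>n. n \<ge> 1 \<Longrightarrow> \<bar>ln (bessel_prod n \<beta>) - \<beta>\<^sup>2/4 * ln (real n)\<bar> \<le> C1"
    using ln_bessel_prod[of \<beta>] by auto
  obtain C2 where C2: "\<And>n. n \<ge> 1 \<Longrightarrow> \<bar>ln (bessel_prod n (\<beta>+l)) - (\<beta>+l)\<^sup>2/4 * ln (real n)\<bar> \<le> C2"
    using ln_bessel_prod[of "\<beta>+l"] by auto
  show ?thesis
  proof (intro exI allI impI)
    fix K N :: nat and t assume K: "1 \<le> K"
    let ?B = "\<lambda>n. {\<omega>\<in>space M. \<sigma> * (field n t \<omega> - \<beta>/2 * ln (real n)) > \<epsilon> * ln (real n)}"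
    let ?E = "\<Union>n\<in>{K..N}. ?B n"
    define c where "c = exp (\<epsilon>\<^sup>2 * ln (real K) - C1 - C2)"
    have B: "?B n \<in> sets (history n)" for n
    proof -
      have [measurable]: "field n t \<in> borel_measurable (history n)" by (rule field_history) simp
      have "{\<omega>\<in>space (history n). \<sigma> * (field n t \<omega> - \<beta>/2 * ln (real n)) > \<epsilon> * ln (real n)} \<in> sets (history n)"
        by measurable
      then show ?thesis by simp
    qed
    have mart: "(\<integral>\<omega>. indicator A \<omega> * Q \<gamma> N t \<omega> \<partial>M) = (\<integral>\<omega>. indicator A \<omega> * Q \<gamma> n t \<omega> \<partial>M)"
      if "n \<le> N" "A \<in> sets (history n)" for A n \<gamma>
      by (rule expectation_Q_martingale[OF that(1), where B=1]) (use that(2) in \<open>auto simp: indicator_def\<close>)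
    have EM: "?E \<in> sets M" using B history_sets_M by blast
    have "c * (\<integral>\<omega>. indicator ?E \<omega> * Q \<beta> N t \<omega> \<partial>M) \<le> (\<integral>\<omega>. indicator ?E \<omega> * Q (\<beta>+l) N t \<omega> \<partial>M)"
    proof (rule maximal_inequality_comparison[where F=history, OF subalgebra_history history_mono integrable_Q integrable_Q])
      fix n \<omega> assume n: "K \<le> n" "n \<le> N" and \<omega>: "\<omega> \<in> ?B n"
      have n1: "1 \<le> n" using n K by simp
      define L where "L = ln (real n)"
      have L: "ln (real K) \<le> L" using n K by (simp add: L_def)
      have "2 * \<epsilon> * (\<epsilon> * L) \<le> 2 * \<epsilon> * (\<sigma> * (field n t \<omega> - \<beta>/2 * L))"
        using \<omega> \<epsilon> unfolding L_def by (intro mult_left_mono) auto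
      then have T: "2 * \<epsilon>\<^sup>2 * L + l * \<beta> / 2 * L \<le> l * field n t \<omega>"
        by (simp add: l_def algebra_simps power2_eq_square)
      have "\<epsilon>\<^sup>2 * ln (real K) \<le> \<epsilon>\<^sup>2 * L" by (intro mult_left_mono L) auto
      moreover have "(\<beta>+l)\<^sup>2/4 * L = \<beta>\<^sup>2/4 * L + l * \<beta> / 2 * L + \<epsilon>\<^sup>2 * L"
        unfolding power2_sum l2 by (simp add: algebra_simps)
      ultimately have "\<epsilon>\<^sup>2 * ln (real K) - C1 - C2 + ln (bessel_prod n (\<beta>+l)) \<le> l * field n t \<omega> + ln (bessel_prod n \<beta>)"
        using C1[OF n1] C2[OF n1] T unfolding L_def[symmetric] by linarith
      then have "c * exp (ln (bessel_prod n (\<beta>+l))) \<le> exp (l * field n t \<omega>) * exp (ln (bessel_prod n \<beta>))"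
        unfolding c_def exp_add[symmetric] exp_le_cancel_iff .
      then have "c * bessel_prod n (\<beta>+l) \<le> exp (l * field n t \<omega>) * bessel_prod n \<beta>"
        using bessel_prod_ge_1[of n \<beta>] bessel_prod_ge_1[of n "\<beta>+l"] by simp
      then have "(c * bessel_prod n (\<beta>+l)) * exp (\<beta> * field n t \<omega>)
          \<le> (exp (l * field n t \<omega>) * bessel_prod n \<beta>) * exp (\<beta> * field n t \<omega>)"
        by (intro mult_right_mono) auto
      also have "\<dots> = exp ((\<beta>+l) * field n t \<omega>) * bessel_prod n \<beta>"
        by (simp add: distrib_right exp_add)
      finally show "c * Q \<beta> n t \<omega> \<le> Q (\<beta>+l) n t \<omega>"
        using bessel_prod_ge_1[of n \<beta>] bessel_prod_ge_1[of n "\<beta>+l"] unfolding Q_eq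
        by (simp add: field_simps)
    qed (use mart B in auto)
    also have "\<dots> \<le> (\<integral>\<omega>. Q (\<beta>+l) N t \<omega> \<partial>M)"
    proof (rule integral_mono)
      show "integrable M (\<lambda>\<omega>. indicator ?E \<omega> * Q (\<beta>+l) N t \<omega>)"
        using integrable_mult_indicator[OF EM integrable_Q] by simp
      show "indicator ?E \<omega> * Q (\<beta>+l) N t \<omega> \<le> Q (\<beta>+l) N t \<omega>" for \<omega>
        using Q_nonneg by (simp add: indicator_def)
    qed (rule integrable_Q)
    finally have *: "c * (\<integral>\<omega>. indicator ?E \<omega> * Q \<beta> N t \<omega> \<partial>M) \<le> 1" by (simp add: expectation_Q)
    have c: "0 < c" by (simp add: c_def)
    from * have "(\<integral>\<omega>. indicator ?E \<omega> * Q \<beta> N t \<omega> \<partial>M) \<le> 1 / c" using c by (simp add: field_simps)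
    also have "1 / c = exp (C1 + C2) * real K powr (-\<epsilon>\<^sup>2)"
      using K by (simp add: c_def powr_def exp_diff exp_minus exp_add field_simps)
    finally show "(\<integral>\<omega>. indicator ?E \<omega> * Q \<beta> N t \<omega> \<partial>M) \<le> exp (C1 + C2) * real K powr (-\<epsilon>\<^sup>2)" .
  qed
qed

definition deviates :: "real \<Rightarrow> real \<Rightarrow> nat \<Rightarrow> nat \<Rightarrow> real \<Rightarrow> 'a set" where
  "deviates \<beta> \<epsilon> K N t = {\<omega>\<in>space M. \<exists>n\<in>{K..N}. \<bar>field n t \<omega> - \<beta>/2 * ln (real n)\<bar> > \<epsilon> * ln (real n)}"

lemma deviates_history: "deviates \<beta> \<epsilon> K N t \<in> sets (history N)"
proof -
  have "{\<omega>\<in>space (history N). \<bar>field n t \<omega> - \<beta>/2 * ln (real n)\<bar> > \<epsilon> * ln (real n)} \<in> sets (history N)"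
    if "n \<in> {K..N}" for n
  proof -
    have [measurable]: "field n t \<in> borel_measurable (history N)" by (rule field_history) (use that in simp)
    show ?thesis by measurable
  qed
  then have "(\<Union>n\<in>{K..N}. {\<omega>\<in>space (history N). \<bar>field n t \<omega> - \<beta>/2 * ln (real n)\<bar> > \<epsilon> * ln (real n)}) \<in> sets (history N)"
    by (intro sets.finite_UN) auto
  also have "(\<Union>n\<in>{K..N}. {\<omega>\<in>space (history N). \<bar>field n t \<omega> - \<beta>/2 * ln (real n)\<bar> > \<epsilon> * ln (real n)}) = deviates \<beta> \<epsilon> K N t"
    by (auto simp: deviates_def)
  finally show ?thesis .
qed

lemma expectation_deviation:
  assumes \<epsilon>: "0 < \<epsilon>"
  shows "\<exists>C>0. \<forall>K\<ge>1. \<forall>N t. expectation (\<lambda>\<omega>. indicator (deviates \<beta> \<epsilon> K N t) \<omega> * Q \<beta> N t \<omega>)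
    \<le> C * real K powr (-\<epsilon>\<^sup>2)"
proof -
  let ?E = "\<lambda>\<sigma> K N t. \<Union>n\<in>{K..N}. {\<omega>\<in>space M. \<sigma> * (field n t \<omega> - \<beta>/2 * ln (real n)) > \<epsilon> * ln (real n)}"
  obtain C1 where C1: "\<And>K N t. K \<ge> 1 \<Longrightarrow> expectation (\<lambda>\<omega>. indicator (?E 1 K N t) \<omega> * Q \<beta> N t \<omega>) \<le> C1 * real K powr (-\<epsilon>\<^sup>2)"
    using expectation_deviation_one_sided[OF \<epsilon>, of 1 \<beta>] by blast
  obtain C2 where C2: "\<And>K N t. K \<ge> 1 \<Longrightarrow> expectation (\<lambda>\<omega>. indicator (?E (-1) K N t) \<omega> * Q \<beta> N t \<omega>) \<le> C2 * real K powr (-\<epsilon>\<^sup>2)"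
    using expectation_deviation_one_sided[OF \<epsilon>, of "-1" \<beta>] by blast
  show ?thesis
  proof (intro exI[of _ "\<bar>C1 + C2\<bar> + 1"] conjI allI impI)
    fix K N :: nat and t assume K: "1 \<le> K"
    have iI: "integrable M (\<lambda>\<omega>. indicator A \<omega> * Q \<beta> N t \<omega>)" if "A \<in> sets M" for A
      using integrable_mult_indicator[OF that integrable_Q] by simp
    have m: "?E \<sigma> K N t \<in> sets M" for \<sigma> by measurable
    have "expectation (\<lambda>\<omega>. indicator (deviates \<beta> \<epsilon> K N t) \<omega> * Q \<beta> N t \<omega>)
        \<le> expectation (\<lambda>\<omega>. indicator (?E 1 K N t) \<omega> * Q \<beta> N t \<omega> + indicator (?E (-1) K N t) \<omega> * Q \<beta> N t \<omega>)"
    proof (rule integral_mono)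
      fix \<omega> assume "\<omega> \<in> space M"
      have "indicator (deviates \<beta> \<epsilon> K N t) \<omega> \<le> indicator (?E 1 K N t) \<omega> + (indicator (?E (-1) K N t) \<omega> :: real)"
        by (auto simp: deviates_def indicator_def abs_if split: if_splits)
      then show "indicator (deviates \<beta> \<epsilon> K N t) \<omega> * Q \<beta> N t \<omega>
          \<le> indicator (?E 1 K N t) \<omega> * Q \<beta> N t \<omega> + indicator (?E (-1) K N t) \<omega> * Q \<beta> N t \<omega>"
        unfolding distrib_right[symmetric] by (intro mult_right_mono Q_nonneg)
    qed (intro Bochner_Integration.integrable_add iI m history_sets_M[OF deviates_history])+
    also have "\<dots> \<le> C1 * real K powr (-\<epsilon>\<^sup>2) + C2 * real K powr (-\<epsilon>\<^sup>2)"
      unfolding Bochner_Integration.integral_add[OF iI[OF m] iI[OF m]] by (intro add_mono C1 C2 K)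
    also have "\<dots> = (C1 + C2) * real K powr (-\<epsilon>\<^sup>2)" by (simp add: distrib_right)
    also have "\<dots> \<le> (\<bar>C1 + C2\<bar> + 1) * real K powr (-\<epsilon>\<^sup>2)"
      by (intro mult_right_mono) auto
    finally show "expectation (\<lambda>\<omega>. indicator (deviates \<beta> \<epsilon> K N t) \<omega> * Q \<beta> N t \<omega>)
        \<le> (\<bar>C1 + C2\<bar> + 1) * real K powr (-\<epsilon>\<^sup>2)" .
  qed auto
qed

end

section \<open>Correlation of the densities at two points\<close>

text \<open>
  Summation by parts: \<open>2 sin (\<theta>/2) cos (n\<theta>)\<close> is the increment \<open>a n - a (n-1)\<close> of a sequence bounded by \<open>1\<close>.  The
  induction carries the boundary term \<open>a N / (N+1)\<close> along.
\<close>

lemma dirichlet_tail_bound: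
  assumes s: "sin (\<theta>/2) \<noteq> 0" and KN: "K \<le> N"
  shows "\<bar>\<Sum>n=K+1..N. cos (real n * \<theta>) / real n\<bar> \<le> 1 / (\<bar>sin (\<theta>/2)\<bar> * real (K+1))"
proof -
  define a where "a n = sin ((real n + 1/2) * \<theta>)" for n :: nat
  have a1: "\<bar>a n\<bar> \<le> 1" for n by (simp add: a_def)
  let ?P = "\<lambda>N. \<Sum>n=K+1..N. 2 * sin (\<theta>/2) * (cos (real n * \<theta>) / real n)"
  have step: "2 * sin (\<theta>/2) * cos (real (Suc n) * \<theta>) = a (Suc n) - a n" for n
  proof -
    have "a (Suc n) - a n = sin (real (Suc n) * \<theta> + \<theta>/2) - sin (real (Suc n) * \<theta> - \<theta>/2)"
      by (simp add: a_def algebra_simps)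
    then show ?thesis by (simp add: sin_add sin_diff)
  qed
  have "\<bar>?P N - a N / real (N+1)\<bar> \<le> 2 / real (K+1) - 1 / real (N+1)"
    using KN
  proof (induct N rule: dec_induct)
    case base
    then show ?case using a1[of K]
      by (simp add: abs_divide divide_right_mono diff_divide_distrib[symmetric])
  next
    case (step n)
    have "?P (Suc n) = ?P n + (a (Suc n) - a n) / real (n+1)"
      using step(1) assms step by (simp add: \<open>\<And>n. 2 * sin (\<theta>/2) * cos (real (Suc n) * \<theta>) = a (Suc n) - a n\<close>[symmetric])
    then have "?P (Suc n) - a (Suc n) / real (Suc n+1)
        = (?P n - a n / real (n+1)) + a (Suc n) * (1 / real (n+1) - 1 / real (Suc n+1))"
      by (simp add: diff_divide_distrib algebra_simps)
    also have "\<bar>\<dots>\<bar> \<le> (2 / real (K+1) - 1 / real (n+1)) + 1 * (1 / real (n+1) - 1 / real (Suc n+1))"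
    proof (rule order.trans[OF abs_triangle_ineq], rule add_mono[OF step(3)])
      have "0 \<le> 1 / real (n+1) - 1 / real (Suc n+1)" by (simp add: field_simps)
      then show "\<bar>a (Suc n) * (1 / real (n+1) - 1 / real (Suc n+1))\<bar> \<le> 1 * (1 / real (n+1) - 1 / real (Suc n+1))"
        unfolding abs_mult using a1[of "Suc n"] by (intro mult_mono) auto
    qed
    finally show ?case by simp
  qed
  moreover have "\<bar>a N / real (N+1)\<bar> \<le> 1 / real (N+1)"
    using a1[of N] by (simp add: abs_divide divide_right_mono)
  ultimately have "\<bar>?P N\<bar> \<le> 2 / real (K+1)" by linarith
  moreover have "?P N = 2 * sin (\<theta>/2) * (\<Sum>n=K+1..N. cos (real n * \<theta>) / real n)"
    by (simp only: sum_distrib_left)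
  ultimately have *: "2 * (\<bar>sin (\<theta>/2)\<bar> * \<bar>\<Sum>n=K+1..N. cos (real n * \<theta>) / real n\<bar>) \<le> 2 / real (K+1)"
    by (simp only: abs_mult)
  have "0 < \<bar>sin (\<theta>/2)\<bar>" using s by simp
  with * show ?thesis by (simp add: field_simps del: of_nat_add of_nat_Suc)
qed

text \<open>
  From \<open>y cos y \<le> sin y\<close> at \<open>y = x/2\<close> and the double angle formula one gets \<open>x (1 + cos x) / 2 \<le> sin x\<close>.
\<close>

lemma sin_ge_half:
  assumes "0 \<le> x" "x \<le> pi/2" shows "x / 2 \<le> sin (x::real)"
proof -
  have tan: "y * cos y \<le> sin y" if "0 \<le> y" "y \<le> pi" for y :: real
  proof -
    have "sin 0 - 0 * cos 0 \<le> sin y - y * cos y"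
    proof (rule DERIV_nonneg_imp_nondecreasing[OF that(1)])
      fix x assume x: "0 \<le> x" "x \<le> y"
      have "((\<lambda>x. sin x - x * cos x) has_real_derivative x * sin x) (at x)"
        by (auto intro!: derivative_eq_intros)
      moreover have "0 \<le> x * sin x" using x that by (intro mult_nonneg_nonneg sin_ge_zero) auto
      ultimately show "\<exists>d. ((\<lambda>x. sin x - x * cos x) has_real_derivative d) (at x) \<and> 0 \<le> d" by blast
    qed
    then show ?thesis by simp
  qed
  have c: "0 \<le> cos (x/2)" "0 \<le> cos x" using assms by (auto intro!: cos_ge_zero)
  have "x / 2 \<le> x * (cos x + 1) / 2" using mult_left_mono[of 1 "cos x + 1" x] assms c by simp
  also have "\<dots> = 2 * (x/2 * cos (x/2)) * cos (x/2)"
    using cos_double_cos[of "x/2"] by (simp add: power2_eq_square field_simps)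
  also have "\<dots> \<le> 2 * sin (x/2) * cos (x/2)"
    using c assms tan[of "x/2"] by (intro mult_right_mono) auto
  also have "\<dots> = sin x" using sin_double[of "x/2"] by simp
  finally show ?thesis .
qed

lemma nn_integral_sin_powr_finite:
  assumes \<gamma>: "0 \<le> \<gamma>" "\<gamma> < 1"
  shows "(\<integral>\<^sup>+u. ennreal (\<bar>sin (u/2)\<bar> powr (-\<gamma>)) \<partial>torus) < \<infinity>"
proof -
  let ?f = "\<lambda>x. ennreal (4 powr \<gamma>) * (ennreal (x powr (-\<gamma>)) * indicator {0..2*pi} x)"
  have le: "ennreal (\<bar>sin (u/2)\<bar> powr (-\<gamma>)) * indicator {0..<2*pi} u \<le> ?f u + ?f (2*pi - u)" for u
  proof (cases "0 < u \<and> u < 2*pi")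
    case True
    have p: "v powr (-\<gamma>) \<le> 4 powr \<gamma> * (w powr (-\<gamma>))" if "0 < w" "w / 4 \<le> v" for v w
    proof -
      have "v powr (-\<gamma>) \<le> (w/4) powr (-\<gamma>)" using that \<gamma> by (intro powr_mono2') auto
      also have "\<dots> = 4 powr \<gamma> * (w powr (-\<gamma>))" using that by (simp add: powr_divide powr_minus field_simps)
      finally show ?thesis .
    qed
    show ?thesis
    proof (cases "u \<le> pi")
      case u: True
      have "u / 4 \<le> \<bar>sin (u/2)\<bar>" using sin_ge_half[of "u/2"] u True by simp
      from p[OF _ this] True have "ennreal (\<bar>sin (u/2)\<bar> powr (-\<gamma>)) \<le> ?f u"
        by (simp add: ennreal_mult[symmetric] ennreal_leI)
      then show ?thesis using True by (simp add: add_increasing2)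
    next
      case u: False
      have "sin (u/2) = sin ((2*pi-u)/2)" by (simp add: diff_divide_distrib)
      moreover have "(2*pi-u) / 4 \<le> \<bar>sin ((2*pi-u)/2)\<bar>" using sin_ge_half[of "(2*pi-u)/2"] u True by simp
      ultimately have "(2*pi-u) / 4 \<le> \<bar>sin (u/2)\<bar>" by simp
      from p[OF _ this] True have "ennreal (\<bar>sin (u/2)\<bar> powr (-\<gamma>)) \<le> ?f (2*pi-u)"
        by (simp add: ennreal_mult[symmetric] ennreal_leI)
      then show ?thesis using True by (simp add: add_increasing)
    qed
  next
    case False
    then show ?thesis by (cases "u = 0") (auto simp: indicator_def)
  qed
  have fin: "(\<integral>\<^sup>+x. ?f x \<partial>lborel) < \<infinity>"
  proof -
    have "(\<integral>\<^sup>+x. ennreal (x powr (-\<gamma>)) * indicator {0..2*pi} x \<partial>lborel)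
        = ennreal ((2*pi) powr (-\<gamma>+1) / (-\<gamma>+1))"
      by (rule nn_integral_has_integral_lebesgue'[OF _ has_integral_powr_from_0]) (use \<gamma> in auto)
    then show ?thesis by (simp add: nn_integral_cmult ennreal_mult_less_top)
  qed
  have "(\<integral>\<^sup>+u. ennreal (\<bar>sin (u/2)\<bar> powr (-\<gamma>)) * indicator {0..<2*pi} u \<partial>lborel)
      \<le> (\<integral>\<^sup>+u. ?f u + ?f (2*pi - u) \<partial>lborel)"
    by (intro nn_integral_mono le)
  also have "\<dots> = (\<integral>\<^sup>+u. ?f u \<partial>lborel) + (\<integral>\<^sup>+u. ?f (2*pi - u) \<partial>lborel)"
    by (rule nn_integral_add) auto
  also have "(\<integral>\<^sup>+u. ?f (2*pi - u) \<partial>lborel) = (\<integral>\<^sup>+u. ?f u \<partial>lborel)"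
    by (subst (2) nn_integral_real_affine[where c="-1" and t="2*pi"]) auto
  also have "(\<integral>\<^sup>+u. ?f u \<partial>lborel) + (\<integral>\<^sup>+u. ?f u \<partial>lborel) < \<infinity>" using fin by simp
  finally have "(\<integral>\<^sup>+u. ennreal (\<bar>sin (u/2)\<bar> powr (-\<gamma>)) * indicator {0..<2*pi} u \<partial>lborel) < \<infinity>" .
  then show ?thesis
    by (simp add: nn_integral_torus less_top[symmetric] ennreal_divide_eq_top_iff)
qed

lemma AE_torus_neq: "AE s in torus. s \<noteq> t"
proof (rule AE_I)
  have "space torus \<inter> {t} \<in> sets torus" unfolding sets_torus sets_restrict_space space_torus by (rule imageI) simp
  then have m: "{t} \<inter> space torus \<in> sets torus" by (simp only: Int_commute)
  show "{s\<in>space torus. \<not> s \<noteq> t} \<subseteq> {t} \<inter> space torus" by auto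
  have "emeasure torus ({t} \<inter> space torus) = (\<integral>\<^sup>+x. indicator {t} x \<partial>torus)"
    unfolding nn_integral_indicator[OF m, symmetric]
    by (intro nn_integral_cong) (auto simp: indicator_def)
  also have "\<dots> = (\<integral>\<^sup>+x. indicator {t} x * indicator {0..<2*pi} x \<partial>lborel) / ennreal (2*pi)"
    by (rule nn_integral_torus) simp
  also have "(\<integral>\<^sup>+x. indicator {t} x * indicator {0..<2*pi} x \<partial>lborel) \<le> (\<integral>\<^sup>+x. indicator {t} x \<partial>lborel)"
    by (intro nn_integral_mono) (auto simp: indicator_def)
  also have "(\<integral>\<^sup>+x. indicator {t} x \<partial>lborel) = 0" by simp
  finally show "emeasure torus ({t} \<inter> space torus) = 0" by (simp add: divide_right_mono_ennreal)
  show "{t} \<inter> space torus \<in> sets torus" by (rule m)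
qed

context random_phases
begin

text \<open>
  The quadratic terms of \<open>ln I\<^sub>0\<close> give \<open>\<beta>\<^sup>2 cos\<^sup>2 (i\<theta>/2) / i - \<beta>\<^sup>2 / (2i) = \<beta>\<^sup>2 cos (i\<theta>) / (2i)\<close>.
\<close>

lemma corr_le:
  assumes "i \<ge> 1"
  shows "corr \<beta> i \<theta> \<le> exp (\<beta>\<^sup>2/2 * (cos (real i * \<theta>) / real i) + 10 * exp (2*\<bar>\<beta>\<bar>) * \<bar>\<beta>\<bar>^3 * (1 / sqrt (real i))^3)"
proof -
  let ?x = "2 * \<beta> * cos (real i * \<theta> / 2) / sqrt (real i)" and ?y = "\<beta> / sqrt (real i)"
  let ?r = "(1 / sqrt (real i))^3"
  have x1: "\<bar>?x\<bar> \<le> 2 * \<bar>\<beta>\<bar> * (1 / sqrt (real i))"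
  proof -
    have "\<bar>?x\<bar> = \<bar>2 * \<beta> * cos (real i * \<theta> / 2)\<bar> * (1 / sqrt (real i))" by (simp add: abs_divide)
    also have "\<dots> \<le> \<bar>2 * \<beta>\<bar> * (1 / sqrt (real i))" by (intro mult_right_mono abs_mult_cos_le) auto
    finally show ?thesis by simp
  qed
  also have "\<dots> \<le> 2 * \<bar>\<beta>\<bar> * 1" using assms by (intro mult_left_mono) auto
  finally have x2: "\<bar>?x\<bar> \<le> 2 * \<bar>\<beta>\<bar>" by simp
  have y2: "\<bar>?y\<bar> \<le> 2 * \<bar>\<beta>\<bar>" using abs_div_sqrt_le[OF assms, of \<beta>] by linarith
  have "\<bar>?x\<bar>^3 \<le> (2 * \<bar>\<beta>\<bar> * (1 / sqrt (real i)))^3" by (intro power_mono x1) auto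
  then have "exp (2*\<bar>\<beta>\<bar>) * \<bar>?x\<bar>^3 \<le> exp (2*\<bar>\<beta>\<bar>) * (2 * \<bar>\<beta>\<bar> * (1 / sqrt (real i)))^3"
    by (intro mult_left_mono) auto
  then have x3: "exp (2*\<bar>\<beta>\<bar>) * \<bar>?x\<bar>^3 \<le> 8 * (exp (2*\<bar>\<beta>\<bar>) * \<bar>\<beta>\<bar>^3 * ?r)"
    unfolding power_mult_distrib by simp
  have y3: "exp (2*\<bar>\<beta>\<bar>) * \<bar>?y\<bar>^3 = exp (2*\<bar>\<beta>\<bar>) * \<bar>\<beta>\<bar>^3 * ?r" by (simp add: abs_divide power_divide)
  have c10: "10 * exp (2*\<bar>\<beta>\<bar>) * \<bar>\<beta>\<bar>^3 * ?r = 10 * (exp (2*\<bar>\<beta>\<bar>) * \<bar>\<beta>\<bar>^3 * ?r)" by simp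
  have "?x\<^sup>2/4 = \<beta>\<^sup>2 * (cos (real i * \<theta> / 2))\<^sup>2 / real i"
    using assms by (simp add: power_divide power_mult_distrib)
  also have "(cos (real i * \<theta> / 2))\<^sup>2 = (1 + cos (real i * \<theta>)) / 2"
    using cos_double_cos[of "real i * \<theta> / 2"] by simp
  finally have xq: "?x\<^sup>2/4 = \<beta>\<^sup>2/2 * (cos (real i * \<theta>) / real i) + \<beta>\<^sup>2 / (2 * real i)"
    by (simp add: add_divide_distrib distrib_left)
  have yq: "?y\<^sup>2/4 = \<beta>\<^sup>2 / (4 * real i)" by (simp add: power_divide)
  have q: "\<beta>\<^sup>2 / (2 * real i) = 2 * (\<beta>\<^sup>2 / (4 * real i))" by simp
  have "corr \<beta> i \<theta> = exp (ln (bessel_I0 ?x) - 2 * ln (bessel_I0 ?y))"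
    unfolding corr_def using bessel_I0_pos[of ?x] bessel_I0_pos[of ?y]
    by (simp add: exp_diff exp_double)
  also have "\<dots> \<le> exp (\<beta>\<^sup>2/2 * (cos (real i * \<theta>) / real i) + 10 * exp (2*\<bar>\<beta>\<bar>) * \<bar>\<beta>\<bar>^3 * ?r)"
  proof (subst exp_le_cancel_iff)
    have "\<bar>ln (bessel_I0 ?x) - ?x\<^sup>2/4\<bar> \<le> 8 * (exp (2*\<bar>\<beta>\<bar>) * \<bar>\<beta>\<bar>^3 * ?r)"
      using ln_bessel_I0[OF x2] x3 by (rule order.trans)
    moreover have "\<bar>ln (bessel_I0 ?y) - ?y\<^sup>2/4\<bar> \<le> exp (2*\<bar>\<beta>\<bar>) * \<bar>\<beta>\<bar>^3 * ?r"
      using ln_bessel_I0[OF y2] unfolding y3 .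
    ultimately show "ln (bessel_I0 ?x) - 2 * ln (bessel_I0 ?y)
        \<le> \<beta>\<^sup>2/2 * (cos (real i * \<theta>) / real i) + 10 * exp (2*\<bar>\<beta>\<bar>) * \<bar>\<beta>\<bar>^3 * ?r"
      unfolding xq yq q c10 by linarith
  qed
  finally show ?thesis .
qed

text \<open>
  Beyond the scale \<open>1 / \<bar>sin (\<theta>/2)\<bar>\<close> the phases decorrelate: the sum of \<open>cos (i\<theta>) / i\<close> over \<open>i > K\<close> is bounded there.
  The alternative \<open>K = N\<close> covers levels that have not reached this scale, where the product is empty.
\<close>

lemma prod_corr_le:
  assumes "sin (\<theta>/2) \<noteq> 0" "1 / \<bar>sin (\<theta>/2)\<bar> \<le> real K \<or> K = N" "K \<le> N"
  shows "(\<Prod>i=K+1..N. corr \<beta> i \<theta>) \<le> exp (\<beta>\<^sup>2/2 + 30 * exp (2*\<bar>\<beta>\<bar>) * \<bar>\<beta>\<bar>^3)"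
proof -
  let ?c = "10 * exp (2*\<bar>\<beta>\<bar>) * \<bar>\<beta>\<bar>^3"
  have "(\<Prod>i=K+1..N. corr \<beta> i \<theta>) \<le> (\<Prod>i=K+1..N. exp (\<beta>\<^sup>2/2 * (cos (real i * \<theta>) / real i) + ?c * (1 / sqrt (real i))^3))"
  proof (rule prod_mono)
    fix i assume "i \<in> {K+1..N}"
    then have "i \<ge> 1" by simp
    then show "0 \<le> corr \<beta> i \<theta> \<and> corr \<beta> i \<theta> \<le> exp (\<beta>\<^sup>2/2 * (cos (real i * \<theta>) / real i) + ?c * (1 / sqrt (real i))^3)"
      using corr_le by (simp add: corr_def less_imp_le[OF bessel_I0_pos])
  qed
  also have "\<dots> = exp (\<beta>\<^sup>2/2 * (\<Sum>i=K+1..N. cos (real i * \<theta>) / real i) + ?c * (\<Sum>i=K+1..N. (1 / sqrt (real i))^3))"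
    by (simp only: exp_sum[symmetric] finite_atLeastAtMost sum.distrib sum_distrib_left)
  also have "\<dots> \<le> exp (\<beta>\<^sup>2/2 * 1 + ?c * 3)"
  proof (subst exp_le_cancel_iff, intro add_mono mult_left_mono)
    show "(\<Sum>i=K+1..N. cos (real i * \<theta>) / real i) \<le> 1"
    proof (cases "K = N")
      case False
      with assms have K: "1 / \<bar>sin (\<theta>/2)\<bar> \<le> real K" by simp
      have s: "0 < \<bar>sin (\<theta>/2)\<bar>" using assms by simp
      have "1 \<le> \<bar>sin (\<theta>/2)\<bar> * real (K+1)" using K s by (simp add: field_simps)
      then have "1 / (\<bar>sin (\<theta>/2)\<bar> * real (K+1)) \<le> 1" by (simp add: divide_le_eq)
      then show ?thesis using dirichlet_tail_bound[OF assms(1,3)] by linarith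
    qed simp
    have "(\<Sum>i=K+1..N. (1 / sqrt (real i))^3) \<le> (\<Sum>i=1..N. (1 / sqrt (real i))^3)"
      by (rule sum_mono2) auto
    then show "(\<Sum>i=K+1..N. (1 / sqrt (real i))^3) \<le> 3" using sum_inverse_sqrt_cubed_le[of N] by linarith
  qed auto
  finally show ?thesis by (simp add: mult.assoc)
qed

lemma Q_le_off_deviation:
  assumes C: "\<bar>ln (bessel_prod n \<beta>) - \<beta>\<^sup>2/4 * ln (real n)\<bar> \<le> C" and n: "1 \<le> n"
    and T: "\<bar>field n t \<omega> - \<beta>/2 * ln (real n)\<bar> \<le> \<epsilon> * ln (real n)"
  shows "Q \<beta> n t \<omega> \<le> exp C * real n powr (\<beta>\<^sup>2/4 + \<bar>\<beta>\<bar> * \<epsilon>)"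
proof -
  define L where "L = ln (real n)"
  have "\<beta> * (field n t \<omega> - \<beta>/2 * L) \<le> \<bar>\<beta>\<bar> * \<bar>field n t \<omega> - \<beta>/2 * L\<bar>" by (metis abs_ge_self abs_mult)
  also have "\<dots> \<le> \<bar>\<beta>\<bar> * (\<epsilon> * L)" using T unfolding L_def by (intro mult_left_mono) auto
  finally have "\<beta> * field n t \<omega> \<le> \<beta>\<^sup>2/2 * L + \<bar>\<beta>\<bar> * \<epsilon> * L" by (simp add: algebra_simps power2_eq_square)
  then have "\<beta> * field n t \<omega> - ln (bessel_prod n \<beta>) \<le> C + (\<beta>\<^sup>2/4 + \<bar>\<beta>\<bar> * \<epsilon>) * L"
    using C unfolding L_def[symmetric] by (simp add: distrib_right)
  then have "exp (\<beta> * field n t \<omega> - ln (bessel_prod n \<beta>)) \<le> exp (C + (\<beta>\<^sup>2/4 + \<bar>\<beta>\<bar> * \<epsilon>) * L)" by simp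
  moreover have "exp (\<beta> * field n t \<omega> - ln (bessel_prod n \<beta>)) = Q \<beta> n t \<omega>"
    using bessel_prod_ge_1[of n \<beta>] by (simp add: exp_diff Q_eq)
  ultimately show ?thesis using n by (simp add: exp_add powr_def L_def)
qed

end

context random_phases
begin

text \<open>
  Split at the scale \<open>K\<close> where the two points separate.  Up to \<open>K\<close>, one of the two densities is bounded by its
  typical size \<open>K\<^sup>\<gamma>\<close> and the other one has mean \<open>1\<close>; beyond \<open>K\<close> the correlations contribute a bounded factor.
\<close>

lemma two_point_off_deviation:
  assumes \<epsilon>: "0 < \<epsilon>" and k0: "1 \<le> k0"
  shows "\<exists>C\<ge>0. \<forall>N\<ge>k0. \<forall>t s. sin ((t-s)/2) \<noteq> 0 \<longrightarrow>
    expectation (\<lambda>\<omega>. indicator (space M - deviates \<beta> \<epsilon> k0 N s) \<omega> * (Q \<beta> N t \<omega> * Q \<beta> N s \<omega>))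
    \<le> C * \<bar>sin ((t-s)/2)\<bar> powr (- (\<beta>\<^sup>2/4 + \<bar>\<beta>\<bar> * \<epsilon>))"
proof -
  define \<gamma> where "\<gamma> = \<beta>\<^sup>2/4 + \<bar>\<beta>\<bar> * \<epsilon>"
  have \<gamma>0: "0 \<le> \<gamma>" using \<epsilon> by (simp add: \<gamma>_def)
  obtain C1 where C1: "\<And>n. n \<ge> 1 \<Longrightarrow> \<bar>ln (bessel_prod n \<beta>) - \<beta>\<^sup>2/4 * ln (real n)\<bar> \<le> C1"
    using ln_bessel_prod[of \<beta>] by auto
  let ?C2 = "exp (\<beta>\<^sup>2/2 + 30 * exp (2*\<bar>\<beta>\<bar>) * \<bar>\<beta>\<bar>^3)"
  let ?C = "exp C1 * real (k0 + 2) powr \<gamma> * ?C2"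
  have "expectation (\<lambda>\<omega>. indicator (space M - deviates \<beta> \<epsilon> k0 N s) \<omega> * (Q \<beta> N t \<omega> * Q \<beta> N s \<omega>))
      \<le> ?C * \<bar>sin ((t-s)/2)\<bar> powr (- \<gamma>)" if N: "N \<ge> k0" and d0: "sin ((t-s)/2) \<noteq> 0" for N t s
  proof -
    define d where "d = \<bar>sin ((t-s)/2)\<bar>"
    have d: "0 < d" "d \<le> 1" using d0 by (auto simp: d_def)
    \<comment> \<open>K is the scale at which the phases at t and s decouple\<close>
    define K where "K = min N (max k0 (nat \<lceil>1/d\<rceil>))"
    have "1/d \<le> real (nat \<lceil>1/d\<rceil>)" by (rule real_nat_ceiling_ge)
    also have "\<dots> \<le> real (max k0 (nat \<lceil>1/d\<rceil>))" by simp
    finally have K: "k0 \<le> K" "K \<le> N" "1 \<le> K" "1/d \<le> real K \<or> K = N"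
      using N k0 unfolding K_def min_def by (auto simp del: of_nat_max)
    have Kd: "real K \<le> real (k0 + 2) / d"
    proof -
      have "real (nat \<lceil>1/d\<rceil>) \<le> 1/d + 1" using d by simp
      then have "real K \<le> real k0 + 1/d + 1" by (auto simp: K_def min_def max_def)
      also have "\<dots> \<le> real k0 / d + 1/d + 1/d"
      proof -
        have 1: "1 \<le> 1/d" using d by simp
        then have "real k0 * 1 \<le> real k0 * (1/d)" by (intro mult_left_mono) auto
        then show ?thesis using 1 by simp
      qed
      also have "\<dots> = real (k0 + 2) / d" by (simp add: add_divide_distrib)
      finally show ?thesis .
    qed
    let ?A = "space M - deviates \<beta> \<epsilon> K K s"
    have AF: "?A \<in> sets (history K)" using sets.compl_sets[OF deviates_history[of \<beta> \<epsilon> K K s]] by simp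
    have abs_indicator_le: "\<bar>indicator ?A \<omega> :: real\<bar> \<le> 1" for \<omega> by (simp add: indicator_def)
    have ii: "integrable M (\<lambda>\<omega>. indicator B \<omega> * (Q \<beta> n t \<omega> * Q \<beta> n s \<omega>))" if "B \<in> sets M" for B n
    proof (rule integrable_bounded)
      fix \<omega>
      have "indicator B \<omega> * (Q \<beta> n t \<omega> * Q \<beta> n s \<omega>) \<le> 1 * (exp (\<bar>\<beta>\<bar> * real n) * exp (\<bar>\<beta>\<bar> * real n))"
        by (intro mult_mono Q_le Q_nonneg mult_nonneg_nonneg) (auto simp: indicator_def)
      then show "\<bar>indicator B \<omega> * (Q \<beta> n t \<omega> * Q \<beta> n s \<omega>)\<bar> \<le> 1 * (exp (\<bar>\<beta>\<bar> * real n) * exp (\<bar>\<beta>\<bar> * real n))"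
        by (simp add: Q_nonneg abs_of_nonneg)
    qed (use that in measurable)
    have "expectation (\<lambda>\<omega>. indicator (space M - deviates \<beta> \<epsilon> k0 N s) \<omega> * (Q \<beta> N t \<omega> * Q \<beta> N s \<omega>))
        \<le> expectation (\<lambda>\<omega>. indicator ?A \<omega> * (Q \<beta> N t \<omega> * Q \<beta> N s \<omega>))"
    proof (rule integral_mono[OF ii ii])
      show "space M - deviates \<beta> \<epsilon> k0 N s \<in> sets M"
        by (intro sets.Diff sets.top history_sets_M[OF deviates_history])
      show "?A \<in> sets M" using AF by (rule history_sets_M)
      fix \<omega>
      have "indicator (space M - deviates \<beta> \<epsilon> k0 N s) \<omega> \<le> (indicator ?A \<omega> :: real)"
        using K by (auto simp: deviates_def indicator_def)
      then show "indicator (space M - deviates \<beta> \<epsilon> k0 N s) \<omega> * (Q \<beta> N t \<omega> * Q \<beta> N s \<omega>)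
          \<le> indicator ?A \<omega> * (Q \<beta> N t \<omega> * Q \<beta> N s \<omega>)"
        by (intro mult_right_mono mult_nonneg_nonneg Q_nonneg)
    qed
    also have "\<dots> = expectation (\<lambda>\<omega>. indicator ?A \<omega> * (Q \<beta> K t \<omega> * Q \<beta> K s \<omega>)) * (\<Prod>i=K+1..N. corr \<beta> i (t - s))"
      by (rule expectation_Q_two_point[OF K(2) borel_measurable_indicator[OF AF] abs_indicator_le])
    also have "\<dots> \<le> (exp C1 * real K powr \<gamma>) * ?C2"
    proof (rule mult_mono)
      show "(\<Prod>i=K+1..N. corr \<beta> i (t - s)) \<le> ?C2"
        by (rule prod_corr_le[OF d0 K(4)[unfolded d_def] K(2)])
      have "expectation (\<lambda>\<omega>. indicator ?A \<omega> * (Q \<beta> K t \<omega> * Q \<beta> K s \<omega>))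
          \<le> expectation (\<lambda>\<omega>. (exp C1 * real K powr \<gamma>) * Q \<beta> K t \<omega>)"
      proof (rule integral_mono[OF ii])
        show "?A \<in> sets M" using AF by (rule history_sets_M)
        fix \<omega> assume \<omega>: "\<omega> \<in> space M"
        show "indicator ?A \<omega> * (Q \<beta> K t \<omega> * Q \<beta> K s \<omega>) \<le> (exp C1 * real K powr \<gamma>) * Q \<beta> K t \<omega>"
        proof (cases "\<omega> \<in> ?A")
          case True
          then have "Q \<beta> K s \<omega> \<le> exp C1 * real K powr \<gamma>"
            unfolding \<gamma>_def by (intro Q_le_off_deviation[OF C1[OF K(3)] K(3)]) (auto simp: deviates_def)
          from mult_right_mono[OF this Q_nonneg[of \<beta> K \<omega> t]] show ?thesis
            using True by (simp add: mult.commute[of "Q \<beta> K t \<omega>"])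
        qed (simp add: Q_nonneg)
      qed (simp add: integrable_Q)
      then show "expectation (\<lambda>\<omega>. indicator ?A \<omega> * (Q \<beta> K t \<omega> * Q \<beta> K s \<omega>)) \<le> exp C1 * real K powr \<gamma>"
        by (simp add: expectation_Q)
      show "0 \<le> (\<Prod>i=K+1..N. corr \<beta> i (t - s))"
        by (intro prod_nonneg) (simp add: corr_def less_imp_le[OF bessel_I0_pos])
    qed auto
    also have "\<dots> \<le> (exp C1 * (real (k0 + 2) / d) powr \<gamma>) * ?C2"
      using Kd \<gamma>0 by (intro mult_right_mono mult_left_mono powr_mono2) auto
    also have "(real (k0 + 2) / d) powr \<gamma> = real (k0 + 2) powr \<gamma> * d powr (-\<gamma>)"
      using d by (simp add: powr_divide powr_minus field_simps)
    finally show ?thesis by (simp add: d_def mult_ac)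
  qed
  then show ?thesis unfolding \<gamma>_def[symmetric] by (intro exI[of _ ?C]) auto
qed

end

context random_phases
begin

section \<open>Uniform integrability of the total mass\<close>

lemma field_comp:
  assumes "\<tau> \<in> borel_measurable N" "\<And>i. 1 \<le> i \<Longrightarrow> i \<le> n \<Longrightarrow> (\<lambda>x. \<Phi> i (w x)) \<in> borel_measurable N"
  shows "(\<lambda>x. field n (\<tau> x) (w x)) \<in> borel_measurable N"
  unfolding field_def
  by (intro borel_measurable_sum borel_measurable_divide borel_measurable_const
      measurable_compose[OF _ borel_measurable_cos] borel_measurable_add borel_measurable_times)
    (use assms in auto)

lemma Q_comp:
  assumes "\<tau> \<in> borel_measurable N" "\<And>i. 1 \<le> i \<Longrightarrow> i \<le> n \<Longrightarrow> (\<lambda>x. \<Phi> i (w x)) \<in> borel_measurable N"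
  shows "(\<lambda>x. Q \<beta> n (\<tau> x) (w x)) \<in> borel_measurable N"
  unfolding Q_eq using field_comp[OF assms] by measurable

lemma phase_snd: "1 \<le> i \<Longrightarrow> (\<lambda>p. \<Phi> i (snd p)) \<in> borel_measurable (torus \<Otimes>\<^sub>M M)"
  by (rule measurable_compose[OF measurable_snd phase_borel])

lemma fst_torus: "fst \<in> borel_measurable (torus \<Otimes>\<^sub>M N)"
  using measurable_compose[OF measurable_fst measurable_ident_torus] by (simp add: comp_def)

lemma Q_joint: "(\<lambda>p. Q \<beta> n (fst p) (snd p)) \<in> borel_measurable (torus \<Otimes>\<^sub>M M)"
  by (rule Q_comp[OF fst_torus phase_snd])

lemma measurable_pair_history: "(\<lambda>p. p) \<in> measurable (torus \<Otimes>\<^sub>M M) (torus \<Otimes>\<^sub>M history n)"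
proof -
  have "(\<lambda>\<omega>. \<omega>) \<in> measurable M (history n)"
  proof (rule measurableI)
    fix A assume A: "A \<in> sets (history n)"
    have "(\<lambda>\<omega>. \<omega>) -` A \<inter> space M = A" using sets.sets_into_space[OF A] by auto
    then show "(\<lambda>\<omega>. \<omega>) -` A \<inter> space M \<in> sets M" using history_sets_M[OF A] by simp
  qed simp
  from measurable_Pair[OF measurable_fst measurable_compose[OF measurable_snd this]] show ?thesis by simp
qed

lemma pair_history_sets:
  assumes D: "D \<in> sets (torus \<Otimes>\<^sub>M history n)" shows "D \<in> sets (torus \<Otimes>\<^sub>M M)"
proof -
  have "(\<lambda>p. p) -` D \<inter> space (torus \<Otimes>\<^sub>M M) = D"
    using sets.sets_into_space[OF D] by (auto simp: space_pair_measure)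
  then show ?thesis using measurable_sets[OF measurable_pair_history D] by simp
qed

definition deviation_set :: "real \<Rightarrow> real \<Rightarrow> nat \<Rightarrow> nat \<Rightarrow> (real \<times> 'a) set" where
  "deviation_set \<beta> \<epsilon> K N = {p\<in>space torus \<times> space M. snd p \<in> deviates \<beta> \<epsilon> K N (fst p)}"

text \<open>
  Measurability with respect to the phases up to \<open>N\<close> only is what later allows the Peyriere measure of this
  set to be computed from the density at level \<open>N\<close>.
\<close>

lemma deviation_set_history: "deviation_set \<beta> \<epsilon> K N \<in> sets (torus \<Otimes>\<^sub>M history N)"
proof -
  let ?D = "\<lambda>n. {p\<in>space (torus \<Otimes>\<^sub>M history N). \<bar>field n (fst p) (snd p) - \<beta>/2 * ln (real n)\<bar> > \<epsilon> * ln (real n)}"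
  have f: "(\<lambda>p. field n (fst p) (snd p)) \<in> borel_measurable (torus \<Otimes>\<^sub>M history N)" if "n \<le> N" for n
    by (rule field_comp[OF fst_torus]) (use that in \<open>auto intro: measurable_compose[OF measurable_snd phase_history]\<close>)
  have "?D n \<in> sets (torus \<Otimes>\<^sub>M history N)" if "n \<in> {K..N}" for n
    by (intro borel_measurable_less borel_measurable_const borel_measurable_abs borel_measurable_diff f)
      (use that in simp)
  then have "(\<Union>n\<in>{K..N}. ?D n) \<in> sets (torus \<Otimes>\<^sub>M history N)" by (intro sets.finite_UN) auto
  also have "(\<Union>n\<in>{K..N}. ?D n) = deviation_set \<beta> \<epsilon> K N"
    by (auto simp: deviation_set_def deviates_def space_pair_measure)
  finally show ?thesis .
qed

lemma joint_section_time:
  assumes "(\<lambda>p. h (fst p) (snd p)) \<in> borel_measurable (torus \<Otimes>\<^sub>M M)" "\<omega> \<in> space M"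
  shows "(\<lambda>t. h t \<omega>) \<in> borel_measurable torus"
  using measurable_compose[OF measurable_Pair2'[OF assms(2)] assms(1)] by simp

lemma joint_integral_measurable:
  fixes h :: "real \<Rightarrow> 'a \<Rightarrow> real"
  assumes h: "(\<lambda>p. h (fst p) (snd p)) \<in> borel_measurable (torus \<Otimes>\<^sub>M M)"
  shows "(\<lambda>\<omega>. \<integral>t. h t \<omega> \<partial>torus) \<in> borel_measurable M"
proof (rule torus.borel_measurable_lebesgue_integral)
  show "(\<lambda>(\<omega>, t). h t \<omega>) \<in> borel_measurable (M \<Otimes>\<^sub>M torus)"
    using measurable_compose[OF measurable_Pair[OF measurable_snd measurable_fst] h] by (simp add: case_prod_beta')
qed

text \<open>
  The density is cut into the part where the field has stayed in its typical range since time \<open>K\<close>, which has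
  a bounded second moment, and the rest, which has small mean.
\<close>

definition good_density :: "real \<Rightarrow> real \<Rightarrow> nat \<Rightarrow> nat \<Rightarrow> real \<Rightarrow> 'a \<Rightarrow> real" where
  "good_density \<beta> \<epsilon> K N t \<omega> = indicator (space M - deviates \<beta> \<epsilon> K N t) \<omega> * Q \<beta> N t \<omega>"

definition bad_density :: "real \<Rightarrow> real \<Rightarrow> nat \<Rightarrow> nat \<Rightarrow> real \<Rightarrow> 'a \<Rightarrow> real" where
  "bad_density \<beta> \<epsilon> K N t \<omega> = indicator (deviates \<beta> \<epsilon> K N t) \<omega> * Q \<beta> N t \<omega>"

lemma density_split: "\<omega> \<in> space M \<Longrightarrow> Q \<beta> N t \<omega> = good_density \<beta> \<epsilon> K N t \<omega> + bad_density \<beta> \<epsilon> K N t \<omega>"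
  by (auto simp: good_density_def bad_density_def indicator_def)

lemma good_bad_density_bounds:
  "0 \<le> good_density \<beta> \<epsilon> K N t \<omega>" "good_density \<beta> \<epsilon> K N t \<omega> \<le> Q \<beta> N t \<omega>"
  "0 \<le> bad_density \<beta> \<epsilon> K N t \<omega>" "bad_density \<beta> \<epsilon> K N t \<omega> \<le> Q \<beta> N t \<omega>"
  using Q_nonneg[of \<beta> N \<omega> t] by (auto simp: good_density_def bad_density_def indicator_def)

lemma good_bad_density_abs:
  "\<bar>good_density \<beta> \<epsilon> K N t \<omega>\<bar> \<le> exp (\<bar>\<beta>\<bar> * real N)" "\<bar>bad_density \<beta> \<epsilon> K N t \<omega>\<bar> \<le> exp (\<bar>\<beta>\<bar> * real N)"
  using good_bad_density_bounds[of \<beta> \<epsilon> K N t \<omega>] Q_le[of \<beta> N \<omega> t] by auto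

lemma bad_density_joint:
  "(\<lambda>p. bad_density \<beta> \<epsilon> K N (fst p) (snd p)) \<in> borel_measurable (torus \<Otimes>\<^sub>M M)"
proof -
  have "(\<lambda>p. indicator (deviation_set \<beta> \<epsilon> K N) p * Q \<beta> N (fst p) (snd p)) \<in> borel_measurable (torus \<Otimes>\<^sub>M M)"
    by (intro borel_measurable_times borel_measurable_indicator pair_history_sets[OF deviation_set_history] Q_joint)
  then show ?thesis
    by (rule measurable_cong[THEN iffD1, rotated])
      (auto simp: deviation_set_def bad_density_def indicator_def space_pair_measure)
qed

lemma good_density_joint:
  "(\<lambda>p. good_density \<beta> \<epsilon> K N (fst p) (snd p)) \<in> borel_measurable (torus \<Otimes>\<^sub>M M)"
proof -
  have "(\<lambda>p. Q \<beta> N (fst p) (snd p) - bad_density \<beta> \<epsilon> K N (fst p) (snd p)) \<in> borel_measurable (torus \<Otimes>\<^sub>M M)"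
    by (intro borel_measurable_diff bad_density_joint Q_joint)
  then show ?thesis
    by (rule measurable_cong[THEN iffD1, rotated])
      (auto simp: good_density_def bad_density_def indicator_def space_pair_measure)
qed

lemma good_bad_density_integrable:
  assumes "\<omega> \<in> space M"
  shows "integrable torus (\<lambda>t. good_density \<beta> \<epsilon> K N t \<omega>)" "integrable torus (\<lambda>t. bad_density \<beta> \<epsilon> K N t \<omega>)"
  by (rule torus.integrable_const_bound[where B="exp (\<bar>\<beta>\<bar> * real N)"];
      use good_bad_density_abs joint_section_time[OF good_density_joint assms]
        joint_section_time[OF bad_density_joint assms] in auto)+

definition good_mass :: "real \<Rightarrow> real \<Rightarrow> nat \<Rightarrow> nat \<Rightarrow> 'a \<Rightarrow> real" where
  "good_mass \<beta> \<epsilon> K N \<omega> = (\<integral>t. good_density \<beta> \<epsilon> K N t \<omega> \<partial>torus)"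

definition bad_mass :: "real \<Rightarrow> real \<Rightarrow> nat \<Rightarrow> nat \<Rightarrow> 'a \<Rightarrow> real" where
  "bad_mass \<beta> \<epsilon> K N \<omega> = (\<integral>t. bad_density \<beta> \<epsilon> K N t \<omega> \<partial>torus)"

lemma good_bad_mass_measurable:
  "good_mass \<beta> \<epsilon> K N \<in> borel_measurable M" "bad_mass \<beta> \<epsilon> K N \<in> borel_measurable M"
  unfolding good_mass_def[abs_def] bad_mass_def[abs_def]
  by (intro joint_integral_measurable good_density_joint bad_density_joint)+

lemma good_bad_mass_nonneg: "0 \<le> good_mass \<beta> \<epsilon> K N \<omega>" "0 \<le> bad_mass \<beta> \<epsilon> K N \<omega>"
  unfolding good_mass_def bad_mass_def by (intro Bochner_Integration.integral_nonneg good_bad_density_bounds)+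

lemma Fubini_bounded:
  fixes h :: "real \<Rightarrow> 'a \<Rightarrow> real"
  assumes h: "(\<lambda>p. h (fst p) (snd p)) \<in> borel_measurable (torus \<Otimes>\<^sub>M M)" and B: "\<And>t \<omega>. \<bar>h t \<omega>\<bar> \<le> B"
  shows "expectation (\<lambda>\<omega>. \<integral>t. h t \<omega> \<partial>torus) = (\<integral>t. expectation (h t) \<partial>torus)"
proof -
  interpret TM: pair_prob_space torus M ..
  have "integrable (torus \<Otimes>\<^sub>M M) (case_prod h)"
    by (rule TM.P.integrable_const_bound[where B=B]) (use h B in \<open>auto simp: case_prod_beta'\<close>)
  from TM.Fubini_integral[OF this] show ?thesis by simp
qed

definition smear :: "real \<Rightarrow> (real \<Rightarrow> real) \<Rightarrow> nat \<Rightarrow> 'a \<Rightarrow> real" where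
  "smear \<beta> f n \<omega> = (\<integral>t. f t * Q \<beta> n t \<omega> \<partial>torus)"

lemma Q_time_measurable: "(\<lambda>t. Q \<beta> n t \<omega>) \<in> borel_measurable torus"
  by (rule Q_comp[where \<tau>="\<lambda>t. t" and w="\<lambda>_. \<omega>"]) auto

lemma smear_history:
  assumes f: "f \<in> borel_measurable torus"
  shows "smear \<beta> f n \<in> borel_measurable (history n)"
proof -
  have "(\<lambda>p. Q \<beta> n (snd p) (fst p)) \<in> borel_measurable (history n \<Otimes>\<^sub>M torus)"
    by (rule Q_comp) (auto intro: measurable_compose[OF measurable_fst phase_history]
        measurable_compose[OF measurable_snd measurable_ident_torus])
  then have "(\<lambda>(\<omega>, t). f t * Q \<beta> n t \<omega>) \<in> borel_measurable (history n \<Otimes>\<^sub>M torus)"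
    unfolding case_prod_beta' by (intro borel_measurable_times measurable_compose[OF measurable_snd f])
  then show ?thesis unfolding smear_def[abs_def] by (rule torus.borel_measurable_lebesgue_integral)
qed

lemma smear_measurable: "f \<in> borel_measurable torus \<Longrightarrow> smear \<beta> f n \<in> borel_measurable M"
  using smear_history by (rule measurable_history_M)

lemma integrable_smear_density:
  assumes f: "f \<in> borel_measurable torus" "\<And>t. \<bar>f t\<bar> \<le> B"
  shows "integrable torus (\<lambda>t. f t * Q \<beta> n t \<omega>)"
  by (rule torus.integrable_const_bound[where B="B * exp (\<bar>\<beta>\<bar> * real n)"])
    (use f abs_mult_Q_le[OF f(2)] Q_time_measurable[of \<beta> n \<omega>] in auto)

lemma abs_smear_le:
  assumes f: "f \<in> borel_measurable torus" "\<And>t. \<bar>f t\<bar> \<le> B"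
  shows "\<bar>smear \<beta> f n \<omega>\<bar> \<le> B * exp (\<bar>\<beta>\<bar> * real n)"
proof -
  have "\<bar>smear \<beta> f n \<omega>\<bar> \<le> (\<integral>t. \<bar>f t * Q \<beta> n t \<omega>\<bar> \<partial>torus)" unfolding smear_def by (rule integral_abs_bound)
  also have "\<dots> \<le> (\<integral>t. B * exp (\<bar>\<beta>\<bar> * real n) \<partial>torus)"
    by (intro integral_mono integrable_abs integrable_smear_density[OF f] abs_mult_Q_le[OF f(2)]) auto
  finally show ?thesis by simp
qed

lemma integrable_smear:
  assumes "f \<in> borel_measurable torus" "\<And>t. \<bar>f t\<bar> \<le> B"
  shows "integrable M (smear \<beta> f n)"
  by (rule integrable_bounded[OF smear_measurable[OF assms(1)] abs_smear_le[OF assms]])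

lemma expectation_mult_smear:
  assumes f: "f \<in> borel_measurable torus" "\<And>t. \<bar>f t\<bar> \<le> B"
    and g: "g \<in> borel_measurable M" "\<And>\<omega>. \<bar>g \<omega>\<bar> \<le> C"
  shows "expectation (\<lambda>\<omega>. g \<omega> * smear \<beta> f n \<omega>) = (\<integral>t. f t * expectation (\<lambda>\<omega>. g \<omega> * Q \<beta> n t \<omega>) \<partial>torus)"
proof -
  have "expectation (\<lambda>\<omega>. g \<omega> * smear \<beta> f n \<omega>) = expectation (\<lambda>\<omega>. \<integral>t. (f t * g \<omega>) * Q \<beta> n t \<omega> \<partial>torus)"
    unfolding smear_def by (simp add: mult_ac flip: integral_mult_right_zero)
  also have "\<dots> = (\<integral>t. expectation (\<lambda>\<omega>. (f t * g \<omega>) * Q \<beta> n t \<omega>) \<partial>torus)"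
  proof (rule Fubini_bounded)
    show "(\<lambda>p. (f (fst p) * g (snd p)) * Q \<beta> n (fst p) (snd p)) \<in> borel_measurable (torus \<Otimes>\<^sub>M M)"
      by (intro borel_measurable_times Q_joint measurable_compose[OF measurable_fst f(1)]
          measurable_compose[OF measurable_snd g(1)])
    have "\<bar>f t * g \<omega>\<bar> \<le> B * C" for t \<omega>
      unfolding abs_mult using f(2)[of t] g(2)[of \<omega>] by (intro mult_mono) auto
    then show "\<bar>(f t * g \<omega>) * Q \<beta> n t \<omega>\<bar> \<le> B * C * exp (\<bar>\<beta>\<bar> * real n)" for t \<omega>
      by (rule abs_mult_Q_le)
  qed
  finally show ?thesis by (simp add: mult.assoc)
qed

lemma smear_martingale:
  assumes f: "f \<in> borel_measurable torus" "\<And>t. \<bar>f t\<bar> \<le> B"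
    and g: "g \<in> borel_measurable (history n)" "\<And>\<omega>. \<bar>g \<omega>\<bar> \<le> C" and "n \<le> N"
  shows "expectation (\<lambda>\<omega>. g \<omega> * smear \<beta> f N \<omega>) = expectation (\<lambda>\<omega>. g \<omega> * smear \<beta> f n \<omega>)"
  unfolding expectation_mult_smear[OF f measurable_history_M[OF g(1)] g(2)]
  using expectation_Q_martingale[OF \<open>n \<le> N\<close> g] by simp

lemma smear_nonneg: "(\<And>t. 0 \<le> f t) \<Longrightarrow> 0 \<le> smear \<beta> f n \<omega>"
  unfolding smear_def by (intro Bochner_Integration.integral_nonneg mult_nonneg_nonneg Q_nonneg)

lemma expectation_total_mass: "expectation (smear \<beta> (\<lambda>_. 1) n) = 1"
proof -
  have "expectation (\<lambda>\<omega>. 1 * smear \<beta> (\<lambda>_. 1) n \<omega>) = (\<integral>t. 1 * expectation (\<lambda>\<omega>. 1 * Q \<beta> n t \<omega>) \<partial>torus)"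
    by (rule expectation_mult_smear[where B=1 and C=1]) auto
  also have "\<dots> = (\<integral>t. 1 \<partial>torus)" by (simp only: mult_1 expectation_Q)
  finally show ?thesis by (simp only: mult_1) simp
qed

lemma total_mass_split:
  assumes "\<omega> \<in> space M"
  shows "smear \<beta> (\<lambda>_. 1) N \<omega> = good_mass \<beta> \<epsilon> K N \<omega> + bad_mass \<beta> \<epsilon> K N \<omega>"
  unfolding smear_def good_mass_def bad_mass_def
    Bochner_Integration.integral_add[OF good_bad_density_integrable[OF assms], symmetric]
  by (intro Bochner_Integration.integral_cong) (simp_all add: density_split[OF assms, of \<beta> N _ \<epsilon> K])

lemma good_bad_mass_le:
  assumes "\<omega> \<in> space M"
  shows "good_mass \<beta> \<epsilon> K N \<omega> \<le> smear \<beta> (\<lambda>_. 1) N \<omega>" "good_mass \<beta> \<epsilon> K N \<omega> \<le> exp (\<bar>\<beta>\<bar> * real N)"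
    "bad_mass \<beta> \<epsilon> K N \<omega> \<le> exp (\<bar>\<beta>\<bar> * real N)"
  using total_mass_split[OF assms, of \<beta> N \<epsilon> K] good_bad_mass_nonneg[of \<beta> \<epsilon> K N \<omega>]
    abs_smear_le[of "\<lambda>_. 1" 1 \<beta> N \<omega>] by auto

lemma integrable_good_mass_sq: "integrable M (\<lambda>\<omega>. (good_mass \<beta> \<epsilon> K N \<omega>)\<^sup>2)"
proof (rule integrable_const_bound[where B="(exp (\<bar>\<beta>\<bar> * real N))\<^sup>2"], rule AE_I2)
  show "norm ((good_mass \<beta> \<epsilon> K N \<omega>)\<^sup>2) \<le> (exp (\<bar>\<beta>\<bar> * real N))\<^sup>2" if "\<omega> \<in> space M" for \<omega>
    by (simp add: power_mono good_bad_mass_le(2)[OF that] good_bad_mass_nonneg)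
qed (use good_bad_mass_measurable(1) in simp)

text \<open>
  Integrability holds because the kernel has a singularity of order \<open>\<gamma> < 1\<close>; by shift invariance the integral
  is the same for every \<open>t\<close>.
\<close>

lemma integral_sin_powr_shift:
  assumes \<gamma>: "0 \<le> \<gamma>" "\<gamma> < 1"
  shows "integrable torus (\<lambda>s. \<bar>sin ((t - s)/2)\<bar> powr (-\<gamma>))"
    and "(\<integral>s. \<bar>sin ((t - s)/2)\<bar> powr (-\<gamma>) \<partial>torus) = (\<integral>s. \<bar>sin (s/2)\<bar> powr (-\<gamma>) \<partial>torus)"
proof -
  let ?f = "\<lambda>u. \<bar>sin (u/2)\<bar> powr (-\<gamma>)"
  have per: "?f (x + 2*pi) = ?f x" for x by (simp add: add_divide_distrib)
  have "sin ((t - s)/2) = - sin ((s + - t)/2)" for s by (simp add: sin_minus[symmetric] minus_divide_left)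
  then have sym: "(\<lambda>s. \<bar>sin ((t - s)/2)\<bar> powr (-\<gamma>)) = (\<lambda>s. ?f (s + - t))" by simp
  have "(\<integral>\<^sup>+s. ennreal (?f (s + - t)) \<partial>torus) = (\<integral>\<^sup>+s. ennreal (?f s) \<partial>torus)"
    by (rule nn_integral_torus_shift) (simp_all only: per, measurable)
  then have "(\<integral>\<^sup>+s. ennreal (?f (s + - t)) \<partial>torus) < \<infinity>" using nn_integral_sin_powr_finite[OF \<gamma>] by simp
  then show "integrable torus (\<lambda>s. \<bar>sin ((t - s)/2)\<bar> powr (-\<gamma>))" unfolding sym
    by (intro integrableI_bounded borel_imp_measurable_torus) simp_all
  show "(\<integral>s. \<bar>sin ((t - s)/2)\<bar> powr (-\<gamma>) \<partial>torus) = (\<integral>s. ?f s \<partial>torus)"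
    unfolding sym by (rule integral_torus_shift) (simp_all only: per, measurable)
qed

text \<open>
  The square of the good mass is at most the good mass times the total mass, so only one of the two
  points has to be good.
\<close>

lemma good_mass_second_moment:
  assumes \<epsilon>: "0 < \<epsilon>" and k0: "1 \<le> k0" and \<gamma>: "\<beta>\<^sup>2/4 + \<bar>\<beta>\<bar> * \<epsilon> < 1"
  shows "\<exists>D\<ge>0. \<forall>N\<ge>k0. expectation (\<lambda>\<omega>. (good_mass \<beta> \<epsilon> k0 N \<omega>)\<^sup>2) \<le> D"
proof -
  define \<gamma>' where "\<gamma>' = \<beta>\<^sup>2/4 + \<bar>\<beta>\<bar> * \<epsilon>"
  have \<gamma>': "0 \<le> \<gamma>'" "\<gamma>' < 1" using \<gamma> \<epsilon> by (auto simp: \<gamma>'_def)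
  define J where "J = (\<integral>s. \<bar>sin (s/2)\<bar> powr (-\<gamma>') \<partial>torus)"
  have J: "0 \<le> J" unfolding J_def by (intro Bochner_Integration.integral_nonneg) simp
  obtain C where C: "C \<ge> 0" "\<And>N t s. N \<ge> k0 \<Longrightarrow> sin ((t-s)/2) \<noteq> 0 \<Longrightarrow>
    expectation (\<lambda>\<omega>. indicator (space M - deviates \<beta> \<epsilon> k0 N s) \<omega> * (Q \<beta> N t \<omega> * Q \<beta> N s \<omega>))
      \<le> C * \<bar>sin ((t-s)/2)\<bar> powr (-\<gamma>')"
    using two_point_off_deviation[OF \<epsilon> k0, of \<beta>] unfolding \<gamma>'_def[symmetric] by blast
  have "expectation (\<lambda>\<omega>. (good_mass \<beta> \<epsilon> k0 N \<omega>)\<^sup>2) \<le> C * J" if N: "k0 \<le> N" for N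
  proof -
    let ?a = "good_density \<beta> \<epsilon> k0 N" and ?G = "good_mass \<beta> \<epsilon> k0 N" and ?X = "smear \<beta> (\<lambda>_. 1) N"
    let ?e = "exp (\<bar>\<beta>\<bar> * real N)"
    \<comment> \<open>multiplied by the indicator of the space to be bounded for every argument\<close>
    let ?G' = "\<lambda>\<omega>. indicator (space M) \<omega> * ?G \<omega>"
    have pair: "expectation (\<lambda>\<omega>. ?a s \<omega> * Q \<beta> N t \<omega>) \<le> C * \<bar>sin ((t-s)/2)\<bar> powr (-\<gamma>')"
      if "sin ((t-s)/2) \<noteq> 0" for s t
      using C(2)[OF N that] by (simp add: good_density_def mult_ac)
    have G'm: "?G' \<in> borel_measurable M"
      by (intro borel_measurable_times borel_measurable_indicator good_bad_mass_measurable) simp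
    have G'B: "\<bar>?G' \<omega>\<bar> \<le> ?e" for \<omega>
      using good_bad_mass_le(2)[of \<omega> \<beta> \<epsilon> k0 N] good_bad_mass_nonneg(1)[of \<beta> \<epsilon> k0 N \<omega>] by (simp add: indicator_def)
    have "expectation (\<lambda>\<omega>. (?G \<omega>)\<^sup>2) \<le> expectation (\<lambda>\<omega>. ?G' \<omega> * ?X \<omega>)"
    proof (rule integral_mono[OF integrable_good_mass_sq])
      show "integrable M (\<lambda>\<omega>. ?G' \<omega> * ?X \<omega>)"
      proof (rule integrable_bounded)
        show "(\<lambda>\<omega>. ?G' \<omega> * ?X \<omega>) \<in> borel_measurable M"
          by (intro borel_measurable_times[OF G'm] smear_measurable) simp
        show "\<bar>?G' \<omega> * ?X \<omega>\<bar> \<le> ?e * (1 * ?e)" for \<omega>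
          unfolding abs_mult[of "?G' \<omega>"] by (intro mult_mono G'B abs_smear_le) auto
      qed
      show "(?G \<omega>)\<^sup>2 \<le> ?G' \<omega> * ?X \<omega>" if "\<omega> \<in> space M" for \<omega>
        using good_bad_mass_le(1)[OF that] good_bad_mass_nonneg(1) that
        by (simp add: power2_eq_square mult_left_mono)
    qed
    also have "\<dots> = (\<integral>t. 1 * expectation (\<lambda>\<omega>. ?G' \<omega> * Q \<beta> N t \<omega>) \<partial>torus)"
      by (rule expectation_mult_smear[where B=1, OF _ _ G'm G'B]) auto
    also have "\<dots> \<le> (\<integral>t. C * J \<partial>torus)"
    proof (rule integral_mono')
      fix t assume t: "t \<in> space torus"
      have "1 * expectation (\<lambda>\<omega>. ?G' \<omega> * Q \<beta> N t \<omega>) = expectation (\<lambda>\<omega>. \<integral>s. ?a s \<omega> * Q \<beta> N t \<omega> \<partial>torus)"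
        unfolding mult_1 by (intro Bochner_Integration.integral_cong) (simp_all add: good_mass_def)
      also have "\<dots> = (\<integral>s. expectation (\<lambda>\<omega>. ?a s \<omega> * Q \<beta> N t \<omega>) \<partial>torus)"
        by (rule Fubini_bounded[OF borel_measurable_times[OF good_density_joint
              measurable_compose[OF measurable_snd Q_measurable]] abs_mult_Q_le[OF good_bad_density_abs(1)]])
      also have "\<dots> \<le> (\<integral>s. C * \<bar>sin ((t-s)/2)\<bar> powr (-\<gamma>') \<partial>torus)"
      proof (rule integral_mono_AE')
        show "integrable torus (\<lambda>s. C * \<bar>sin ((t-s)/2)\<bar> powr (-\<gamma>'))"
          by (intro integrable_mult_right integral_sin_powr_shift \<gamma>')
        show "AE s in torus. expectation (\<lambda>\<omega>. ?a s \<omega> * Q \<beta> N t \<omega>) \<le> C * \<bar>sin ((t-s)/2)\<bar> powr (-\<gamma>')"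
          using AE_torus_neq[of t] AE_space
        proof eventually_elim
          case (elim s)
          have "-pi < (t-s)/2" "(t-s)/2 < pi" "(t-s)/2 \<noteq> 0" using elim t by auto
          then have "sin ((t-s)/2) \<noteq> 0" using sin_zero_pi_iff by (metis abs_less_iff minus_less_iff)
          then show ?case by (rule pair)
        qed
        show "AE s in torus. 0 \<le> C * \<bar>sin ((t-s)/2)\<bar> powr (-\<gamma>')" using C(1) by simp
      qed
      also have "\<dots> = C * J" by (simp add: integral_sin_powr_shift(2)[OF \<gamma>'] J_def)
      finally show "1 * expectation (\<lambda>\<omega>. ?G' \<omega> * Q \<beta> N t \<omega>) \<le> C * J" .
    qed (use C(1) J in auto)
    finally show ?thesis by simp
  qed
  then show ?thesis using C(1) J by (intro exI[of _ "C * J"]) auto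
qed

end

context random_phases
begin

text \<open>
  Let \<open>X\<close> be the total mass, \<open>G\<close> and \<open>B\<close> its good and bad parts.  Large values of \<open>X\<^sub>n\<close> are examined at the later
  time \<open>N = max n k0\<close>, which the martingale property permits, and on \<open>{X\<^sub>n > R}\<close>, an event of probability at most
  \<open>1/R\<close>, one has \<open>X\<^sub>N \<le> B + G\<^sup>2/r + r\<close>.
\<close>

lemma total_mass_uniformly_integrable:
  assumes \<beta>: "\<bar>\<beta>\<bar> < 2" and e: "0 < e"
  shows "\<exists>R. \<forall>n. expectation (\<lambda>\<omega>. if smear \<beta> (\<lambda>_. 1) n \<omega> > R then smear \<beta> (\<lambda>_. 1) n \<omega> else 0) \<le> e"
proof -
  \<comment> \<open>small enough for \<open>\<beta>\<^sup>2/4 + \<bar>\<beta>\<bar>\<epsilon> < 1\<close>\<close>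
  define \<epsilon> where "\<epsilon> = (1 - \<beta>\<^sup>2/4) / (2 * (\<bar>\<beta>\<bar> + 1))"
  have "\<beta>\<^sup>2 < 2\<^sup>2" using \<beta> by (metis abs_ge_zero power2_abs power_strict_mono zero_less_numeral)
  then have q: "0 < 1 - \<beta>\<^sup>2/4" by simp
  then have \<epsilon>: "0 < \<epsilon>" unfolding \<epsilon>_def by (intro divide_pos_pos) auto
  have "\<bar>\<beta>\<bar> * \<epsilon> \<le> (\<bar>\<beta>\<bar> + 1) * \<epsilon>" using \<epsilon> by (intro mult_right_mono) auto
  also have "\<dots> = (1 - \<beta>\<^sup>2/4) / 2" unfolding \<epsilon>_def by (simp add: field_simps)
  also have "\<dots> < 1 - \<beta>\<^sup>2/4" using q by simp
  finally have \<gamma>: "\<beta>\<^sup>2/4 + \<bar>\<beta>\<bar> * \<epsilon> < 1" by simp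
  obtain C where C: "C > 0" "\<And>K N t. K \<ge> 1 \<Longrightarrow>
      expectation (\<lambda>\<omega>. indicator (deviates \<beta> \<epsilon> K N t) \<omega> * Q \<beta> N t \<omega>) \<le> C * real K powr (-\<epsilon>\<^sup>2)"
    using expectation_deviation[OF \<epsilon>, of \<beta>] by blast
  have "((\<lambda>k. C * real k powr (-\<epsilon>\<^sup>2)) \<longlongrightarrow> C * 0) sequentially"
    using \<epsilon> by (intro tendsto_mult_left tendsto_neg_powr filterlim_real_sequentially) simp
  then have "eventually (\<lambda>k. C * real k powr (-\<epsilon>\<^sup>2) < e/3) sequentially"
    using e by (intro order_tendstoD(2)) auto
  then obtain k0 where k0: "1 \<le> k0" "C * real k0 powr (-\<epsilon>\<^sup>2) < e/3"
    unfolding eventually_sequentially by (metis le_add1 le_add2)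
  obtain D where D: "D \<ge> 0" "\<And>N. N \<ge> k0 \<Longrightarrow>
      expectation (\<lambda>\<omega>. (good_mass \<beta> \<epsilon> k0 N \<omega>)\<^sup>2) \<le> D"
    using good_mass_second_moment[OF \<epsilon> k0(1) \<gamma>] by blast
  define r where "r = 3 * D / e + 1"
  have r: "0 < r" "D / r \<le> e/3" using D(1) e by (auto simp: r_def add_nonneg_pos field_simps)
  define R where "R = 3 * r / e"
  have R: "0 < R" "r / R = e/3" using r e by (auto simp: R_def)
  let ?X = "\<lambda>n. smear \<beta> (\<lambda>_. 1) n"
  have "expectation (\<lambda>\<omega>. if ?X n \<omega> > R then ?X n \<omega> else 0) \<le> e" for n
  proof -
    define N where "N = max n k0"
    define A where "A = {\<omega>\<in>space M. ?X n \<omega> > R}"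
    have AF: "A \<in> sets (history n)"
    proof -
      have [measurable]: "?X n \<in> borel_measurable (history n)" by (rule smear_history) simp
      have "{\<omega>\<in>space (history n). ?X n \<omega> > R} \<in> sets (history n)" by measurable
      then show ?thesis by (simp add: A_def)
    qed
    note AM = history_sets_M[OF AF]
    have iX: "integrable M (?X k)" for k by (rule integrable_smear[where B=1]) auto
    have iAX: "integrable M (\<lambda>\<omega>. indicator A \<omega> * ?X k \<omega>)" for k
      using integrable_mult_indicator[OF AM iX] by simp
    have X0: "0 \<le> ?X k \<omega>" for k \<omega> by (rule smear_nonneg) simp
    let ?G = "good_mass \<beta> \<epsilon> k0 N" and ?B = "bad_mass \<beta> \<epsilon> k0 N"
    note nn = good_bad_mass_nonneg[of \<beta> \<epsilon> k0 N] and iG2 = integrable_good_mass_sq[of \<beta> \<epsilon> k0 N]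
    have iB: "integrable M ?B"
      by (rule integrable_const_bound[where B="exp (\<bar>\<beta>\<bar> * real N)"], rule AE_I2)
        (use good_bad_mass_le(3) nn good_bad_mass_measurable(2) in auto)
    have iA: "integrable M (indicator A :: 'a \<Rightarrow> real)"
      by (rule integrable_bounded[OF borel_measurable_indicator[OF AM], where B=1]) (simp add: indicator_def)
    have EB: "expectation ?B \<le> e/3"
    proof -
      have "expectation ?B = (\<integral>s. expectation (bad_density \<beta> \<epsilon> k0 N s) \<partial>torus)"
        unfolding bad_mass_def[abs_def] by (rule Fubini_bounded[OF bad_density_joint good_bad_density_abs(2)])
      also have "\<dots> \<le> (\<integral>s. e/3 \<partial>torus)"
      proof (rule integral_mono')
        show "expectation (bad_density \<beta> \<epsilon> k0 N s) \<le> e/3" for s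
          unfolding bad_density_def[abs_def] using C(2)[OF k0(1), of N s] k0(2) by linarith
      qed (use e in auto)
      finally show ?thesis by simp
    qed
    have PA: "r * prob A \<le> e/3"
    proof -
      have "R * prob A = expectation (\<lambda>\<omega>. R * indicator A \<omega>)" using AM by simp
      also have "\<dots> \<le> expectation (?X n)"
      proof (rule integral_mono)
        show "R * indicator A \<omega> \<le> ?X n \<omega>" for \<omega> using X0[of n \<omega>] by (cases "\<omega> \<in> A") (auto simp: A_def)
      qed (simp_all only: iX integrable_mult_right iA)
      finally have "R * prob A \<le> 1" unfolding expectation_total_mass .
      then have "r * (R * prob A) / R \<le> r * 1 / R" using R r by (intro divide_right_mono mult_left_mono) auto
      then show ?thesis using R by simp
    qed
    have "expectation (\<lambda>\<omega>. if ?X n \<omega> > R then ?X n \<omega> else 0) = expectation (\<lambda>\<omega>. indicator A \<omega> * ?X n \<omega>)"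
      by (intro Bochner_Integration.integral_cong) (auto simp: A_def)
    also have "\<dots> = expectation (\<lambda>\<omega>. indicator A \<omega> * ?X N \<omega>)"
      by (rule smear_martingale[where B=1 and C=1, symmetric])
        (auto simp: N_def indicator_def intro: borel_measurable_indicator[OF AF, unfolded indicator_def])
    also have "\<dots> \<le> expectation (\<lambda>\<omega>. ?B \<omega> + ((?G \<omega>)\<^sup>2 / r + r * indicator A \<omega>))"
    proof (rule integral_mono)
      fix \<omega> assume \<omega>: "\<omega> \<in> space M"
      have "?G \<omega> \<le> (?G \<omega>)\<^sup>2 / r + r" using abs_le_sq_div[OF r(1), of "?G \<omega>"] by linarith
      moreover have "0 \<le> (?G \<omega>)\<^sup>2 / r" using r by simp
      ultimately show "indicator A \<omega> * ?X N \<omega> \<le> ?B \<omega> + ((?G \<omega>)\<^sup>2 / r + r * indicator A \<omega>)"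
        using nn[of \<omega>] unfolding total_mass_split[OF \<omega>, of \<beta> N \<epsilon> k0] by (cases "\<omega> \<in> A") auto
    qed (use iAX iB iG2 iA in auto)
    also have "\<dots> = expectation ?B + (expectation (\<lambda>\<omega>. (?G \<omega>)\<^sup>2) / r + r * prob A)"
      using iB iG2 iA AM by simp
    also have "\<dots> \<le> e/3 + (e/3 + e/3)"
    proof (intro add_mono EB PA)
      have "expectation (\<lambda>\<omega>. (?G \<omega>)\<^sup>2) / r \<le> D / r"
        using D(2)[of N] r(1) by (intro divide_right_mono) (auto simp: N_def)
      then show "expectation (\<lambda>\<omega>. (?G \<omega>)\<^sup>2) / r \<le> e/3" using r(2) by linarith
    qed
    finally show ?thesis by simp
  qed
  then show ?thesis by blast
qed

text \<open>
  As \<open>f \<le> 1\<close>, the large values of the integral are controlled by those of the total mass.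
\<close>

lemma smear_converges:
  assumes \<beta>: "\<bar>\<beta>\<bar> < 2" and f: "f \<in> borel_measurable torus" "\<And>t. 0 \<le> f t" "\<And>t. f t \<le> 1"
  shows "AE \<omega> in M. convergent (\<lambda>n. smear \<beta> f n \<omega>)"
    and "integrable M (\<lambda>\<omega>. lim (\<lambda>n. smear \<beta> f n \<omega>))"
    and "(\<lambda>n. expectation (\<lambda>\<omega>. \<bar>smear \<beta> f n \<omega> - lim (\<lambda>n. smear \<beta> f n \<omega>)\<bar>)) \<longlonglongrightarrow> 0"
proof -
  have f1: "\<bar>f t\<bar> \<le> 1" for t using f by (simp add: abs_of_nonneg)
  have ui: "\<exists>K. \<forall>n. expectation (\<lambda>\<omega>. if smear \<beta> f n \<omega> > K then smear \<beta> f n \<omega> else 0) \<le> e" if e: "0 < e" for e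
  proof -
    obtain K where K: "\<And>n. expectation (\<lambda>\<omega>. if smear \<beta> (\<lambda>_. 1) n \<omega> > K then smear \<beta> (\<lambda>_. 1) n \<omega> else 0) \<le> e"
      using total_mass_uniformly_integrable[OF \<beta> e] by blast
    have "expectation (\<lambda>\<omega>. if smear \<beta> f n \<omega> > K then smear \<beta> f n \<omega> else 0) \<le> e" for n
    proof -
      have le: "smear \<beta> f n \<omega> \<le> smear \<beta> (\<lambda>_. 1) n \<omega>" for \<omega>
        unfolding smear_def
        by (intro integral_mono integrable_smear_density[OF f(1) f1] integrable_smear_density[where B=1]
            mult_right_mono f(3) Q_nonneg) auto
      have nn: "0 \<le> smear \<beta> f n \<omega>" for \<omega> by (rule smear_nonneg[OF f(2)])
      have [measurable]: "smear \<beta> f n \<in> borel_measurable M" "smear \<beta> (\<lambda>_. 1) n \<in> borel_measurable M"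
        by (intro smear_measurable f(1) borel_measurable_const)+
      have iX: "integrable M (smear \<beta> (\<lambda>_. 1) n)" by (rule integrable_smear[where B=1]) auto
      have "expectation (\<lambda>\<omega>. if smear \<beta> f n \<omega> > K then smear \<beta> f n \<omega> else 0)
          \<le> expectation (\<lambda>\<omega>. if smear \<beta> (\<lambda>_. 1) n \<omega> > K then smear \<beta> (\<lambda>_. 1) n \<omega> else 0)"
      proof (rule integral_mono)
        show "integrable M (\<lambda>\<omega>. if smear \<beta> (\<lambda>_. 1) n \<omega> > K then smear \<beta> (\<lambda>_. 1) n \<omega> else 0)"
          by (rule Bochner_Integration.integrable_bound[OF iX]) auto
        show "integrable M (\<lambda>\<omega>. if smear \<beta> f n \<omega> > K then smear \<beta> f n \<omega> else 0)"
          by (rule Bochner_Integration.integrable_bound[OF iX])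
            (use le nn order.trans[OF nn le] in auto)
        show "(if smear \<beta> f n \<omega> > K then smear \<beta> f n \<omega> else 0)
            \<le> (if smear \<beta> (\<lambda>_. 1) n \<omega> > K then smear \<beta> (\<lambda>_. 1) n \<omega> else 0)" for \<omega>
          using le[of \<omega>] nn[of \<omega>] by auto
      qed
      then show ?thesis using K[of n] by linarith
    qed
    then show ?thesis by blast
  qed
  have mart: "expectation (\<lambda>\<omega>. g \<omega> * smear \<beta> f N \<omega>) = expectation (\<lambda>\<omega>. g \<omega> * smear \<beta> f n \<omega>)"
    if "n \<le> N" "g \<in> borel_measurable (history n)" "\<And>\<omega>. \<bar>g \<omega>\<bar> \<le> 1" for n N g
    by (rule smear_martingale[OF f(1) f1 that(2,3,1)])
  note conv = nonneg_ui_martingale_converges[where F=history and X="smear \<beta> f",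
      OF subalgebra_history history_mono smear_history[OF f(1)] integrable_smear[OF f(1) f1] smear_nonneg[OF f(2)] mart ui]
  show "AE \<omega> in M. convergent (\<lambda>n. smear \<beta> f n \<omega>)"
    and "integrable M (\<lambda>\<omega>. lim (\<lambda>n. smear \<beta> f n \<omega>))"
    and "(\<lambda>n. expectation (\<lambda>\<omega>. \<bar>smear \<beta> f n \<omega> - lim (\<lambda>n. smear \<beta> f n \<omega>)\<bar>)) \<longlonglongrightarrow> 0"
    using conv by blast+
qed

text \<open>
  Convergence in mean carries the martingale property over to the limit.
\<close>

lemma expectation_smear_limit:
  assumes \<beta>: "\<bar>\<beta>\<bar> < 2" and f: "f \<in> borel_measurable torus" "\<And>t. 0 \<le> f t" "\<And>t. f t \<le> 1"
    and g: "g \<in> borel_measurable (history n)" "\<And>\<omega>. \<bar>g \<omega>\<bar> \<le> 1"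
  shows "expectation (\<lambda>\<omega>. g \<omega> * lim (\<lambda>n. smear \<beta> f n \<omega>)) = expectation (\<lambda>\<omega>. g \<omega> * smear \<beta> f n \<omega>)"
proof -
  have f1: "\<bar>f t\<bar> \<le> 1" for t using f by (simp add: abs_of_nonneg)
  let ?L = "\<lambda>\<omega>. lim (\<lambda>n. smear \<beta> f n \<omega>)"
  note iL = smear_converges(2)[OF \<beta> f]
  note iS = integrable_smear[OF f(1) f1, of \<beta>]
  have gM [measurable]: "g \<in> borel_measurable M" by (rule measurable_history_M[OF g(1)])
  have ig: "integrable M (\<lambda>\<omega>. g \<omega> * h \<omega>)" if "integrable M h" for h :: "'a \<Rightarrow> real"
  proof (rule Bochner_Integration.integrable_bound[OF that])
    show "(\<lambda>\<omega>. g \<omega> * h \<omega>) \<in> borel_measurable M" using that by measurable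
    show "AE \<omega> in M. norm (g \<omega> * h \<omega>) \<le> norm (h \<omega>)"
      using g(2) by (intro AE_I2) (simp add: abs_mult mult_left_le_one_le)
  qed
  have "\<bar>expectation (\<lambda>\<omega>. g \<omega> * smear \<beta> f n \<omega>) - expectation (\<lambda>\<omega>. g \<omega> * ?L \<omega>)\<bar>
      \<le> expectation (\<lambda>\<omega>. \<bar>smear \<beta> f N \<omega> - ?L \<omega>\<bar>)" if "n \<le> N" for N
  proof -
    have "expectation (\<lambda>\<omega>. g \<omega> * smear \<beta> f n \<omega>) - expectation (\<lambda>\<omega>. g \<omega> * ?L \<omega>)
        = expectation (\<lambda>\<omega>. g \<omega> * smear \<beta> f N \<omega>) - expectation (\<lambda>\<omega>. g \<omega> * ?L \<omega>)"
      using smear_martingale[OF f(1) f1 g that] by simp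
    also have "\<dots> = expectation (\<lambda>\<omega>. g \<omega> * (smear \<beta> f N \<omega> - ?L \<omega>))"
      using Bochner_Integration.integral_diff[OF ig[OF iS[of N]] ig[OF iL]]
      by (simp add: right_diff_distrib)
    also have "\<bar>\<dots>\<bar> \<le> expectation (\<lambda>\<omega>. \<bar>g \<omega> * (smear \<beta> f N \<omega> - ?L \<omega>)\<bar>)" by (rule integral_abs_bound)
    also have "\<dots> \<le> expectation (\<lambda>\<omega>. \<bar>smear \<beta> f N \<omega> - ?L \<omega>\<bar>)"
      by (intro integral_mono integrable_abs ig Bochner_Integration.integrable_diff iS iL)
        (use g(2) in \<open>simp add: abs_mult mult_left_le_one_le\<close>)
    finally show ?thesis .
  qed
  then have "\<bar>expectation (\<lambda>\<omega>. g \<omega> * smear \<beta> f n \<omega>) - expectation (\<lambda>\<omega>. g \<omega> * ?L \<omega>)\<bar> \<le> 0"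
    by (intro LIMSEQ_le_const[OF smear_converges(3)[OF \<beta> f]]) auto
  then show ?thesis by simp
qed

end

section \<open>Weak limits of measures on the circle\<close>

definition cont_periodic :: "(real \<Rightarrow> real) \<Rightarrow> bool" where
  "cont_periodic f \<longleftrightarrow> continuous_on UNIV f \<and> (\<forall>t. f (t + 2*pi) = f t)"

lemma cont_periodic_borel: "cont_periodic f \<Longrightarrow> f \<in> borel_measurable borel"
  by (simp add: cont_periodic_def borel_measurable_continuous_onI)

lemma cont_periodic_torus: "cont_periodic f \<Longrightarrow> sets N = sets torus \<Longrightarrow> f \<in> borel_measurable N"
  using borel_imp_measurable_torus[OF cont_periodic_borel] measurable_cong_sets by blast

text \<open>
  The representative modulo \<open>2\<pi>\<close> in \<open>[0, 2\<pi>)\<close>; it pushes measures on the line forward to the circle.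
\<close>

definition wrap :: "real \<Rightarrow> real" where
  "wrap x = x - of_int \<lfloor>x / (2*pi)\<rfloor> * (2*pi)"

lemma wrap_range: "wrap x \<in> {0..<2*pi}"
  using floor_divide_lower[of "2*pi" x] floor_divide_upper[of "2*pi" x]
  by (auto simp: wrap_def algebra_simps)

lemma wrap_periodic: "cont_periodic f \<Longrightarrow> f (wrap x) = f x"
  using periodic_int[of f "2*pi" "wrap x" "\<lfloor>x / (2*pi)\<rfloor>"] by (simp add: cont_periodic_def wrap_def)

lemma wrap_measurable: "wrap \<in> measurable borel torus"
proof -
  have "wrap \<in> borel_measurable borel" unfolding wrap_def[abs_def]
    by (intro borel_measurable_diff borel_measurable_times borel_measurable_const measurable_ident_sets refl
        measurable_compose[OF _ borel_measurable_real_floor] borel_measurable_divide)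
  then have "wrap \<in> measurable borel (restrict_space borel {0..<2*pi})"
    by (rule measurable_restrict_space2[rotated]) (use wrap_range in auto)
  then show ?thesis using measurable_cong_sets[OF refl sets_torus] by blast
qed

lemma cont_periodic_bounded:
  assumes "cont_periodic f" shows "\<exists>B>0. \<forall>t. \<bar>f t\<bar> \<le> B"
proof -
  have "continuous_on {0..2*pi} f" using assms continuous_on_subset unfolding cont_periodic_def by blast
  then have "compact (f ` {0..2*pi})" by (rule compact_continuous_image) simp
  then obtain B where B: "B > 0" "\<And>y. y \<in> f ` {0..2*pi} \<Longrightarrow> norm y \<le> B"
    using compact_imp_bounded bounded_pos by metis
  have "\<bar>f t\<bar> \<le> B" for t
  proof -
    have "f (wrap t) \<in> f ` {0..2*pi}" using wrap_range[of t] by (intro imageI) simp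
    then show ?thesis using B(2) by (simp add: wrap_periodic[OF assms])
  qed
  then show ?thesis using B(1) by blast
qed

lemma cis_eq_torus:
  assumes "cis s = cis t" "0 \<le> s" "s < 2*pi" "0 \<le> t" "t < 2*pi" shows "s = t"
proof -
  have "sin s = sin t \<and> cos s = cos t" using assms(1) by (simp add: complex_eq_iff)
  then obtain n :: int where n: "s = t + 2 * pi * n" using sin_cos_eq_iff by blast
  have "\<bar>2 * pi * real_of_int n\<bar> < 2 * pi * 1" using n assms by auto
  then have "\<bar>real_of_int n\<bar> < 1" by (simp add: abs_mult)
  then have "n = 0" by linarith
  then show ?thesis using n by simp
qed

text \<open>
  On the circle \<open>[0, b]\<close> is a closed arc, so its indicator is the limit of continuous periodic functions that
  decrease with the distance of \<open>cis t\<close> from the arc.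
\<close>

lemma arc_indicator_approx:
  "\<exists>h :: nat \<Rightarrow> real \<Rightarrow> real. (\<forall>k. cont_periodic (h k) \<and> (\<forall>t. 0 \<le> h k t \<and> h k t \<le> 1)) \<and>
    (\<forall>t\<in>{0..<2*pi}. (\<lambda>k. h k t) \<longlonglongrightarrow> indicator {..b} t)"
proof -
  consider "b < 0" | "2*pi \<le> b" | "0 \<le> b" "b < 2*pi" by linarith
  then show ?thesis
  proof cases
    case 1
    then show ?thesis by (intro exI[of _ "\<lambda>k t. 0"]) (auto simp: cont_periodic_def indicator_def)
  next
    case 2
    then show ?thesis by (intro exI[of _ "\<lambda>k t. 1"]) (auto simp: cont_periodic_def indicator_def)
  next
    case 3
    \<comment> \<open>cases 1 and 2 are the empty arc and the whole circle\<close>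
    define S where "S = cis ` {0..b}"
    have "compact S" unfolding S_def by (intro compact_continuous_image continuous_intros) simp
    then have cl: "closed S" by (rule compact_imp_closed)
    have ne: "S \<noteq> {}" using 3 by (auto simp: S_def)
    define h where "h k t = max 0 (1 - real k * infdist (cis t) S)" for k :: nat and t
    have "cont_periodic (h k)" for k
      unfolding cont_periodic_def h_def
    proof
      show "continuous_on UNIV (\<lambda>t. max 0 (1 - real k * infdist (cis t) S))"
        by (intro continuous_intros)
    qed (simp add: cis_mult[symmetric])
    moreover have "0 \<le> h k t \<and> h k t \<le> 1" for k t by (simp add: h_def infdist_nonneg)
    moreover have "(\<lambda>k. h k t) \<longlonglongrightarrow> indicator {..b} t" if t: "t \<in> {0..<2*pi}" for t
    proof (cases "t \<le> b")
      case True
      then have "cis t \<in> S" using t by (auto simp: S_def)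
      then show ?thesis using True by (simp add: h_def)
    next
      case False
      then have "cis t \<notin> S" using t 3 cis_eq_torus[of t] by (auto simp: S_def) force
      then have pos: "0 < infdist (cis t) S" by (rule infdist_pos_not_in_closed[OF cl ne])
      obtain n :: nat where n: "1 / infdist (cis t) S < real n" using reals_Archimedean2 by blast
      have "h k t = 0" if "k \<ge> n" for k
      proof -
        have "1 / infdist (cis t) S \<le> real k" using n that by simp
        then have "1 \<le> real k * infdist (cis t) S" using pos by (simp add: divide_le_eq)
        then show ?thesis by (simp add: h_def)
      qed
      then have "eventually (\<lambda>k. h k t = 0) sequentially" by (auto simp: eventually_sequentially)
      then show ?thesis using False by (simp add: tendsto_eventually)
    qed
    ultimately show ?thesis by blast
  qed
qed

definition torus_arcs :: "real set set" where
  "torus_arcs = range (\<lambda>b. {0..<2*pi} \<inter> {..b})"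

lemma sets_torus_arcs: "sets torus = sigma_sets {0..<2*pi} torus_arcs"
proof -
  have b: "sets (borel :: real measure) = sigma_sets UNIV (range (\<lambda>a. {..a}))"
    by (subst borel_eq_atMost) simp
  have "sets torus = (\<inter>) {0..<2*pi} ` sigma_sets UNIV (range (\<lambda>a::real. {..a}))"
    unfolding sets_torus sets_restrict_space b ..
  also have "\<dots> = sigma_sets {0..<2*pi} ((\<inter>) {0..<2*pi} ` range (\<lambda>a. {..a}))"
    by (rule sigma_sets_Int) (simp_all add: b[symmetric])
  also have "(\<inter>) {0..<2*pi} ` range (\<lambda>a. {..a}) = torus_arcs"
    by (simp add: torus_arcs_def image_image)
  finally show ?thesis .
qed

lemma torus_arcs_Int_stable: "Int_stable torus_arcs"
proof (rule Int_stableI)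
  fix A B assume "A \<in> torus_arcs" "B \<in> torus_arcs"
  then obtain a b where "A = {0..<2*pi} \<inter> {..a}" "B = {0..<2*pi} \<inter> {..b}" by (auto simp: torus_arcs_def)
  then have "A \<inter> B = {0..<2*pi} \<inter> {..min a b}" by auto
  then show "A \<inter> B \<in> torus_arcs" by (auto simp: torus_arcs_def)
qed

lemma torus_space_arc: "{0..<2*pi} \<in> torus_arcs"
proof -
  have "{0..<2*pi} = {0..<2*pi} \<inter> {..2*pi}" by auto
  then show ?thesis unfolding torus_arcs_def by blast
qed

lemma torus_arcs_Pow: "torus_arcs \<subseteq> Pow {0..<2*pi}"
  by (auto simp: torus_arcs_def)

definition torus_boxes :: "'a measure \<Rightarrow> (real \<times> 'a) set set" where
  "torus_boxes N = {a \<times> b | a b. a \<in> torus_arcs \<and> b \<in> sets N}"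

lemma torus_boxes_Pow: "torus_boxes N \<subseteq> Pow ({0..<2*pi} \<times> space N)"
  using torus_arcs_Pow sets.sets_into_space[of _ N] by (fastforce simp: torus_boxes_def)

lemma sets_pair_torus_boxes:
  "sets (torus \<Otimes>\<^sub>M N) = sigma_sets ({0..<2*pi} \<times> space N) (torus_boxes N)"
proof -
  have "sets (torus \<Otimes>\<^sub>M N) = sets (sigma (space torus \<times> space N) (torus_boxes N))"
    unfolding torus_boxes_def
  proof (rule sets_pair_eq)
    show "torus_arcs \<subseteq> Pow (space torus)" using torus_arcs_Pow by simp
    show "sets torus = sigma_sets (space torus) torus_arcs" using sets_torus_arcs by simp
    show "{{0..<2*pi}} \<subseteq> torus_arcs" using torus_space_arc by simp
    show "sets N = sigma_sets (space N) (sets N)" by (rule sets.sigma_sets_eq[symmetric])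
    show "{space N} \<subseteq> sets N" by simp
  qed (auto dest: sets.sets_into_space)
  then show ?thesis using torus_boxes_Pow[of N] by (simp add: sets_measure_of)
qed

lemma torus_boxes_Int_stable: "Int_stable (torus_boxes N)"
proof (rule Int_stableI)
  fix A B assume "A \<in> torus_boxes N" "B \<in> torus_boxes N"
  then obtain a b c d where *: "A = a \<times> b" "B = c \<times> d" "a \<in> torus_arcs" "c \<in> torus_arcs" "b \<in> sets N" "d \<in> sets N"
    by (auto simp: torus_boxes_def)
  have "a \<inter> c \<in> torus_arcs" using torus_arcs_Int_stable * by (auto simp: Int_stable_def)
  moreover have "A \<inter> B = (a \<inter> c) \<times> (b \<inter> d)" using * by auto
  ultimately show "A \<inter> B \<in> torus_boxes N" using * unfolding torus_boxes_def by blast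
qed

lemma integral_arc_approx:
  assumes fin: "finite_measure \<mu>" and S: "sets \<mu> = sets torus"
    and h: "\<And>k. cont_periodic (h k)" "\<And>k t. 0 \<le> h k t" "\<And>k t. h k t \<le> 1"
    and lim: "\<And>t. t \<in> {0..<2*pi} \<Longrightarrow> (\<lambda>k. h k t) \<longlonglongrightarrow> indicator {..b} t"
  shows "(\<lambda>k. \<integral>t. h k t \<partial>\<mu>) \<longlonglongrightarrow> measure \<mu> ({0..<2*pi} \<inter> {..b})"
proof -
  interpret finite_measure \<mu> by (rule fin)
  have sp: "space \<mu> = {0..<2*pi}" using sets_eq_imp_space_eq[OF S] by simp
  have "{0..<2*pi} \<inter> {..b} \<in> sets torus"
    unfolding sets_torus_arcs by (rule sigma_sets.Basic) (auto simp: torus_arcs_def)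
  then have m: "{0..<2*pi} \<inter> {..b} \<in> sets \<mu>" using S by simp
  have "(\<lambda>k. \<integral>t. h k t \<partial>\<mu>) \<longlonglongrightarrow> (\<integral>t. indicator ({0..<2*pi} \<inter> {..b}) t \<partial>\<mu>)"
  proof (rule integral_dominated_convergence[where w="\<lambda>_. 1"])
    show "AE t in \<mu>. (\<lambda>k. h k t) \<longlonglongrightarrow> indicator ({0..<2*pi} \<inter> {..b}) t"
      using lim sp by (intro AE_I2) (auto simp: indicator_def)
  qed (use h m cont_periodic_torus[OF h(1) S] in \<open>auto simp: abs_of_nonneg\<close>)
  then show ?thesis using m by simp
qed

text \<open>
  Continuous periodic functions determine the measure of every closed arc starting at \<open>0\<close>, and these arcs
  form a generator closed under intersections.
\<close>

lemma torus_measure_eqI: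
  assumes fin: "finite_measure \<mu>" "finite_measure \<nu>" and S: "sets \<mu> = sets torus" "sets \<nu> = sets torus"
    and eq: "\<And>f. cont_periodic f \<Longrightarrow> (\<integral>t. f t \<partial>\<mu>) = (\<integral>t. f t \<partial>\<nu>)"
  shows "\<mu> = \<nu>"
proof (rule measure_eqI_generator_eq[where E=torus_arcs and \<Omega>="{0..<2*pi}" and A="\<lambda>_. {0..<2*pi}"])
  interpret m: finite_measure \<mu> by (rule fin)
  interpret n: finite_measure \<nu> by (rule fin)
  show "emeasure \<mu> {0..<2*pi} \<noteq> \<infinity>" by simp
  fix X assume "X \<in> torus_arcs"
  then obtain b where X: "X = {0..<2*pi} \<inter> {..b}" by (auto simp: torus_arcs_def)
  obtain h :: "nat \<Rightarrow> real \<Rightarrow> real" where h: "\<And>k. cont_periodic (h k)" "\<And>k t. 0 \<le> h k t" "\<And>k t. h k t \<le> 1"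
    "\<And>t. t \<in> {0..<2*pi} \<Longrightarrow> (\<lambda>k. h k t) \<longlonglongrightarrow> indicator {..b} t"
    using arc_indicator_approx[of b] by blast
  have "measure \<mu> X = measure \<nu> X" unfolding X
    using integral_arc_approx[OF fin(1) S(1) h] integral_arc_approx[OF fin(2) S(2) h] eq[OF h(1)]
    by (simp add: LIMSEQ_unique)
  then show "emeasure \<mu> X = emeasure \<nu> X" by (simp add: m.emeasure_eq_measure n.emeasure_eq_measure)
qed (use S sets_torus_arcs torus_arcs_Pow torus_arcs_Int_stable torus_space_arc in auto)

lemma Bernstein_le_1:
  assumes "0 \<le> x" "x \<le> 1" shows "Bernstein m k x \<le> 1"
proof (cases "k \<le> m")
  case True
  have "Bernstein m k x \<le> (\<Sum>k\<le>m. Bernstein m k x)"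
    using True assms by (intro member_le_sum) (auto intro: Bernstein_nonneg)
  then show ?thesis by simp
next
  case False
  then show ?thesis by (simp add: Bernstein_def binomial_eq_0)
qed

text \<open>
  Countably many test functions whose linear combinations are uniformly dense, on \<open>[0, 2\<pi>)\<close>, among the
  continuous functions on the line.
\<close>

definition bernstein_torus :: "nat \<Rightarrow> nat \<Rightarrow> real \<Rightarrow> real" where
  "bernstein_torus m k t = (if t \<in> {0..<2*pi} then Bernstein m k (t / (2*pi)) else 0)"

lemma bernstein_torus_measurable: "bernstein_torus m k \<in> borel_measurable torus"
  by (rule borel_imp_measurable_torus) (unfold bernstein_torus_def[abs_def] Bernstein_def, measurable)

lemma bernstein_torus_range: "0 \<le> bernstein_torus m k t" "bernstein_torus m k t \<le> 1"
  unfolding bernstein_torus_def by (auto intro!: Bernstein_nonneg Bernstein_le_1)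

text \<open>
  Uniform approximation by Bernstein polynomials makes the integrals of all continuous periodic functions
  converge.  After normalisation the measures live on a bounded interval of the line, so that Helly's theorem
  gives a weakly convergent subsequence; its limit, wrapped around the circle and rescaled by the limit of
  the total masses, has the right integrals, as the full sequence of integrals converges anyway.
\<close>

lemma torus_weak_limit_exists:
  fixes q :: "nat \<Rightarrow> real \<Rightarrow> real"
  assumes q: "\<And>N. q N \<in> borel_measurable torus" "\<And>N t. 0 < q N t" "\<And>N. integrable torus (q N)"
    and conv: "\<And>m k. convergent (\<lambda>N. \<integral>t. bernstein_torus m k t * q N t \<partial>torus)"
  shows "\<exists>\<mu>. finite_measure \<mu> \<and> sets \<mu> = sets torus \<and> torus_weak_conv (\<lambda>N. density torus (\<lambda>t. ennreal (q N t))) \<mu>"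
proof -
  define I where "I N f = (\<integral>t. f t * q N t \<partial>torus)" for N f
  have iq: "integrable torus (\<lambda>t. f t * q N t)" if "f \<in> borel_measurable torus" "\<And>t. t \<in> {0..<2*pi} \<Longrightarrow> \<bar>f t\<bar> \<le> B" for f N and B :: real
  proof (rule Bochner_Integration.integrable_bound[OF integrable_mult_right[OF q(3), of B N]])
    show "AE t in torus. norm (f t * q N t) \<le> norm (B * q N t)"
      using that(2) q(2)[of N] by (intro AE_I2) (force simp: abs_mult intro!: mult_right_mono)
  qed (use that q in measurable)
  have d: "(\<integral>t. f t \<partial>density torus (\<lambda>t. ennreal (q N t))) = I N f" if "f \<in> borel_measurable torus" for f :: "real \<Rightarrow> real" and N
    unfolding I_def using integral_density[OF that q(1)] q(2)[of N] by (simp add: mult.commute less_imp_le)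
  define m where "m N = I N (\<lambda>_. 1)" for N
  have m_eq: "m N = (\<integral>t. bernstein_torus 0 0 t * q N t \<partial>torus)" for N
    unfolding m_def I_def
    by (intro Bochner_Integration.integral_cong) (auto simp: bernstein_torus_def Bernstein_def)
  have m_conv: "convergent m" using conv[of 0 0] by (simp add: m_eq[abs_def])
  have m_pos: "0 < m N" for N
  proof -
    have "0 \<le> m N" unfolding m_def I_def
      by (intro Bochner_Integration.integral_nonneg) (simp add: less_imp_le[OF q(2)])
    moreover have "m N \<noteq> 0"
    proof
      assume "m N = 0"
      then have "AE t in torus. q N t = 0"
        using integral_nonneg_eq_0_iff_AE[OF q(3)[of N]] q(2)[of N] by (simp add: m_def I_def less_imp_le)
      then have "AE t in torus. False" by eventually_elim (use q(2)[of N] in \<open>metis less_irrefl\<close>)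
      then show False by (simp add: torus.AE_False)
    qed
    ultimately show ?thesis by linarith
  qed
  obtain M where M: "\<And>N. \<bar>m N\<bar> \<le> M"
    using convergent_imp_Bseq[OF m_conv] by (auto simp: Bseq_def)
  have M0: "0 < M" using M[of 0] m_pos[of 0] by linarith
  have conv_cont: "convergent (\<lambda>N. I N f)" if f: "cont_periodic f" for f
  proof -
    obtain B where B: "\<And>t. \<bar>f t\<bar> \<le> B" using cont_periodic_bounded[OF f] by blast
    have fm: "f \<in> borel_measurable torus" using cont_periodic_torus[OF f] by simp
    have "Cauchy (\<lambda>N. I N f)"
    proof (rule metric_CauchyI)
      fix e :: real assume e: "e > 0"
      define e' where "e' = e / (4 * M)"
      have e': "e' > 0" using e M0 by (simp add: e'_def)
      have "continuous_on {0..1} (\<lambda>x. f (2*pi*x))"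
      proof (rule continuous_on_compose2[of UNIV f])
        show "continuous_on UNIV f" using f by (simp add: cont_periodic_def)
      qed (auto intro!: continuous_intros)
      from Bernstein_Weierstrass[OF this e'] obtain j where
        j: "\<And>x. x \<in> {0..1} \<Longrightarrow> \<bar>f (2*pi*x) - (\<Sum>k\<le>j. f (2*pi*(k/j)) * Bernstein j k x)\<bar> < e'" by blast
      let ?p = "\<lambda>t. \<Sum>k\<le>j. f (2*pi*(k/j)) * bernstein_torus j k t"
      let ?P = "\<lambda>N. \<Sum>k\<le>j. f (2*pi*(k/j)) * I N (bernstein_torus j k)"
      have close: "\<bar>f t - ?p t\<bar> \<le> e'" if "t \<in> {0..<2*pi}" for t
        using j[of "t / (2*pi)"] that by (auto simp: bernstein_torus_def)
      have ib: "integrable torus (\<lambda>t. bernstein_torus j k t * q N t)" for k N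
        by (rule iq[OF bernstein_torus_measurable, where B=1]) (use bernstein_torus_range in auto)
      have ip: "integrable torus (\<lambda>t. ?p t * q N t)" for N
        unfolding sum_distrib_right mult.assoc by (intro Bochner_Integration.integrable_sum integrable_mult_right ib)
      have P: "?P N = (\<integral>t. ?p t * q N t \<partial>torus)" for N
        unfolding I_def sum_distrib_right mult.assoc
        by (subst Bochner_Integration.integral_sum) (auto intro!: integrable_mult_right ib)
      have diff: "\<bar>I N f - ?P N\<bar> \<le> e' * M" for N
      proof -
        have "I N f - ?P N = (\<integral>t. (f t - ?p t) * q N t \<partial>torus)"
          unfolding P unfolding I_def left_diff_distrib
          by (rule Bochner_Integration.integral_diff[symmetric, OF iq[OF fm B] ip])
        also have "\<bar>\<dots>\<bar> \<le> (\<integral>t. \<bar>(f t - ?p t) * q N t\<bar> \<partial>torus)" by (rule integral_abs_bound)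
        also have "\<dots> \<le> (\<integral>t. e' * q N t \<partial>torus)"
        proof (rule integral_mono)
          show "integrable torus (\<lambda>t. \<bar>(f t - ?p t) * q N t\<bar>)"
            unfolding left_diff_distrib by (intro integrable_abs Bochner_Integration.integrable_diff iq[OF fm B] ip)
          show "\<bar>(f t - ?p t) * q N t\<bar> \<le> e' * q N t" if "t \<in> space torus" for t
            using close[of t] that q(2)[of N t] unfolding abs_mult by (intro mult_mono) auto
        qed (simp add: q(3))
        also have "\<dots> = e' * m N" by (simp add: m_def I_def)
        also have "\<dots> \<le> e' * M" using M[of N] e' by (intro mult_left_mono) auto
        finally show ?thesis .
      qed
      have "convergent ?P"
        unfolding I_def by (intro convergent_sum convergent_mult convergent_const conv)
      then have "Cauchy ?P" by (rule convergent_Cauchy)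
      from metric_CauchyD[OF this, of "e/4"] e
      obtain n0 where n0: "\<And>a b. a \<ge> n0 \<Longrightarrow> b \<ge> n0 \<Longrightarrow> dist (?P a) (?P b) < e/4" by auto
      have eM: "e' * M = e/4" using M0 by (simp add: e'_def)
      show "\<exists>n. \<forall>a\<ge>n. \<forall>b\<ge>n. dist (I a f) (I b f) < e"
      proof (intro exI allI impI)
        fix a b assume "n0 \<le> a" "n0 \<le> b"
        from n0[OF this] have "\<bar>?P a - ?P b\<bar> < e/4" by (simp only: dist_real_def)
        with diff[of a] diff[of b] eM show "dist (I a f) (I b f) < e" unfolding dist_real_def by linarith
      qed
    qed
    then show ?thesis by (rule Cauchy_convergent)
  qed
  \<comment> \<open>normalised measures on the line; Helly's theorem applies as they all live on a bounded interval\<close>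
  define \<nu> where "\<nu> N = distr (density torus (\<lambda>t. ennreal (q N t / m N))) borel (\<lambda>t. t)" for N
  have nu_em: "emeasure (\<nu> N) A = 1" if A: "A \<in> sets borel" "{0..<2*pi} \<subseteq> A" for A N
  proof -
    have idm: "(\<lambda>t. t) \<in> measurable (density torus (\<lambda>t. ennreal (q N t / m N))) borel" by simp
    have "emeasure (\<nu> N) A = emeasure (density torus (\<lambda>t. ennreal (q N t / m N))) (space torus)"
      unfolding \<nu>_def emeasure_distr[OF idm A(1)] using A(2) by (intro arg_cong2[where f=emeasure]) auto
    also have "\<dots> = (\<integral>\<^sup>+t. ennreal (q N t / m N) \<partial>torus)"
      using q(1)[of N] by (subst emeasure_density) (auto intro!: nn_integral_cong)
    also have "\<dots> = ennreal (\<integral>t. q N t / m N \<partial>torus)"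
      by (rule nn_integral_eq_integral) (use q(2)[of N] q(3)[of N] m_pos[of N] in \<open>auto simp: less_imp_le\<close>)
    also have "(\<integral>t. q N t / m N \<partial>torus) = 1" using m_pos[of N] by (simp add: m_def I_def)
    finally show ?thesis by simp
  qed
  have rd: "real_distribution (\<nu> N)" for N
  proof -
    have "prob_space (\<nu> N)" by (rule prob_spaceI) (use nu_em[of UNIV N] in \<open>simp add: \<nu>_def\<close>)
    then show ?thesis by (simp add: real_distribution_def real_distribution_axioms_def \<nu>_def)
  qed
  have nu_int: "(\<integral>x. f x \<partial>\<nu> N) = I N f / m N" if "f \<in> borel_measurable borel" for f :: "real \<Rightarrow> real" and N
  proof -
    have "(\<integral>x. f x \<partial>\<nu> N) = (\<integral>x. f x \<partial>density torus (\<lambda>t. ennreal (q N t / m N)))"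
      unfolding \<nu>_def by (rule integral_distr) (use that in auto)
    also have "\<dots> = (\<integral>t. (q N t / m N) *\<^sub>R f t \<partial>torus)"
      by (rule integral_density) (use that q m_pos[of N] in \<open>auto intro: borel_imp_measurable_torus simp: less_imp_le\<close>)
    finally show ?thesis by (simp add: I_def mult.commute)
  qed
  have "tight \<nu>"
    unfolding tight_def
  proof (intro conjI allI impI rd)
    fix \<epsilon> :: real assume e: "\<epsilon> > 0"
    have sub: "{0..<2*pi} \<subseteq> {-1<..2*pi}" by auto
    have "measure (\<nu> n) {-1<..2*pi} = 1" for n
      using nu_em[OF _ sub, of n] by (simp add: measure_def)
    then have "-1 < 2*pi \<and> (\<forall>n. 1 - \<epsilon> < measure (\<nu> n) {-1<..2*pi})"
      using e pi_gt_zero by (simp del: pi_gt_zero)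
    then show "\<exists>a b. a < b \<and> (\<forall>n. 1 - \<epsilon> < measure (\<nu> n) {a<..b})" by blast
  qed
  from tight_imp_convergent_subsubsequence[OF this strict_mono_id]
  obtain r L where r: "strict_mono r" and L: "real_distribution L" and wc: "weak_conv_m (\<nu> \<circ> r) L"
    by (auto simp: comp_def)
  interpret L: real_distribution L by (rule L)
  define c where "c = lim m"
  have mc: "m \<longlonglongrightarrow> c" using m_conv by (simp add: c_def convergent_LIMSEQ_iff)
  have c0: "0 \<le> c" by (rule LIMSEQ_le_const[OF mc]) (use m_pos in \<open>auto intro: less_imp_le\<close>)
  define \<mu> where "\<mu> = density (distr L torus wrap) (\<lambda>_. ennreal c)"
  have wL: "wrap \<in> measurable L torus" using wrap_measurable by (simp add: measurable_cong_sets[OF L.events_eq_borel refl])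
  have sets: "sets \<mu> = sets torus" by (simp add: \<mu>_def)
  have fin: "finite_measure \<mu>"
  proof (rule finite_measureI)
    interpret D: prob_space "distr L torus wrap" by (rule L.prob_space_distr[OF wL])
    have "emeasure \<mu> (space \<mu>) = ennreal c * emeasure (distr L torus wrap) (space (distr L torus wrap))"
      by (simp add: \<mu>_def emeasure_density nn_integral_cmult_indicator)
    then show "emeasure \<mu> (space \<mu>) \<noteq> \<infinity>" by (simp add: D.emeasure_space_1 del: space_distr)
  qed
  have mu_int: "(\<integral>t. f t \<partial>\<mu>) = c * (\<integral>x. f x \<partial>L)" if f: "cont_periodic f" for f
  proof -
    have fm: "f \<in> borel_measurable torus" using cont_periodic_torus[OF f] by simp
    have "(\<integral>t. f t \<partial>\<mu>) = (\<integral>t. c *\<^sub>R f t \<partial>distr L torus wrap)"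
      unfolding \<mu>_def by (rule integral_density) (use fm c0 in auto)
    also have "\<dots> = (\<integral>x. c *\<^sub>R f (wrap x) \<partial>L)" by (rule integral_distr[OF wL]) (use fm in auto)
    finally show ?thesis using wrap_periodic[OF f] by simp
  qed
  have "torus_weak_conv (\<lambda>N. density torus (\<lambda>t. ennreal (q N t))) \<mu>"
    unfolding torus_weak_conv_def
  proof (intro allI impI)
    fix f :: "real \<Rightarrow> real" assume "continuous_on UNIV f" "\<forall>t. f (t + 2*pi) = f t"
    then have f: "cont_periodic f" by (simp add: cont_periodic_def)
    obtain B where B: "\<And>t. \<bar>f t\<bar> \<le> B" using cont_periodic_bounded[OF f] by blast
    have fm: "f \<in> borel_measurable torus" using cont_periodic_torus[OF f] by simp
    have "(\<lambda>n. \<integral>x. f x \<partial>(\<nu> \<circ> r) n) \<longlonglongrightarrow> (\<integral>x. f x \<partial>L)"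
    proof (rule weak_conv_imp_integral_bdd_continuous_conv[OF _ L wc])
      show "isCont f x" for x using f by (simp add: cont_periodic_def continuous_on_eq_continuous_at)
      show "norm (f x) \<le> B" for x using B by simp
    qed (simp add: rd)
    then have "(\<lambda>n. I (r n) f / m (r n)) \<longlonglongrightarrow> (\<integral>x. f x \<partial>L)"
      by (simp add: nu_int cont_periodic_borel[OF f])
    moreover have "(\<lambda>n. m (r n)) \<longlonglongrightarrow> c" using LIMSEQ_subseq_LIMSEQ[OF mc r] by (simp add: comp_def)
    ultimately have "(\<lambda>n. m (r n) * (I (r n) f / m (r n))) \<longlonglongrightarrow> c * (\<integral>x. f x \<partial>L)"
      by (rule tendsto_mult[rotated])
    then have sub: "(\<lambda>n. I (r n) f) \<longlonglongrightarrow> c * (\<integral>x. f x \<partial>L)"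
      using m_pos by (simp add: less_imp_neq[OF m_pos, symmetric])
    obtain l where l: "(\<lambda>N. I N f) \<longlonglongrightarrow> l" using conv_cont[OF f] by (auto simp: convergent_def)
    have "l = c * (\<integral>x. f x \<partial>L)"
      using LIMSEQ_subseq_LIMSEQ[OF l r] sub by (auto simp: comp_def intro: LIMSEQ_unique)
    then show "(\<lambda>N. \<integral>t. f t \<partial>density torus (\<lambda>t. ennreal (q N t))) \<longlonglongrightarrow> (\<integral>t. f t \<partial>\<mu>)"
      using l by (simp add: d[OF fm] mu_int[OF f])
  qed
  with fin sets show ?thesis by blast
qed

section \<open>The Peyriere measure on events of finitely many phases\<close>

text \<open>
  For a box the section is an arc or empty, and the mass of an arc is a limit of integrals of continuous
  periodic functions; a Dynkin argument reaches all measurable sets.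
\<close>

lemma kernel_section_measurable:
  assumes fin: "\<And>\<omega>. finite_measure (K \<omega>)" and S: "\<And>\<omega>. sets (K \<omega>) = sets torus"
    and meas: "\<And>f. cont_periodic f \<Longrightarrow> (\<And>t. 0 \<le> f t) \<Longrightarrow> (\<And>t. f t \<le> 1) \<Longrightarrow> (\<lambda>\<omega>. \<integral>t. f t \<partial>K \<omega>) \<in> borel_measurable M"
    and D: "D \<in> sets (torus \<Otimes>\<^sub>M M)"
  shows "(\<lambda>\<omega>. emeasure (K \<omega>) ((\<lambda>t. (t, \<omega>)) -` D)) \<in> borel_measurable M"
proof -
  let ?s = "\<lambda>D \<omega>. (\<lambda>t. (t, \<omega>)) -` D"
  let ?E = "torus_boxes M" and ?\<Omega> = "{0..<2*pi} \<times> space M"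
  have sp: "space (K \<omega>) = {0..<2*pi}" for \<omega> using sets_eq_imp_space_eq[OF S] by simp
  have EP: "?E \<subseteq> Pow ?\<Omega>" by (rule torus_boxes_Pow)
  have arc: "(\<lambda>\<omega>. emeasure (K \<omega>) a) \<in> borel_measurable M" if at: "a \<in> torus_arcs" for a
  proof -
    obtain b where a: "a = {0..<2*pi} \<inter> {..b}" using at by (auto simp: torus_arcs_def)
    obtain h :: "nat \<Rightarrow> real \<Rightarrow> real" where h: "\<And>k. cont_periodic (h k)" "\<And>k t. 0 \<le> h k t" "\<And>k t. h k t \<le> 1"
      "\<And>t. t \<in> {0..<2*pi} \<Longrightarrow> (\<lambda>k. h k t) \<longlonglongrightarrow> indicator {..b} t"
      using arc_indicator_approx[of b] by blast
    have "(\<lambda>\<omega>. measure (K \<omega>) a) \<in> borel_measurable M"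
    proof (rule borel_measurable_LIMSEQ_real)
      show "(\<lambda>k. \<integral>t. h k t \<partial>K \<omega>) \<longlonglongrightarrow> measure (K \<omega>) a" for \<omega>
        unfolding a by (rule integral_arc_approx[OF fin S h])
      show "(\<lambda>\<omega>. \<integral>t. h k t \<partial>K \<omega>) \<in> borel_measurable M" for k by (intro meas h)
    qed
    then show ?thesis by (simp add: finite_measure.emeasure_eq_measure[OF fin])
  qed
  have gen: "D \<in> sigma_sets ?\<Omega> ?E" using D by (simp add: sets_pair_torus_boxes)
  have sec: "?s D \<omega> \<in> sets (K \<omega>)" if "D \<in> sigma_sets ?\<Omega> ?E" for D \<omega>
    using that unfolding sets_pair_torus_boxes[symmetric] S by (rule sets_Pair2)
  show ?thesis
    using gen
  proof (induct rule: sigma_sets_induct_disjoint[OF torus_boxes_Int_stable[of M] EP,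
      consumes 1, case_names basic empty compl union])
    case (basic A)
    then obtain a b where A: "A = a \<times> b" "a \<in> torus_arcs" "b \<in> sets M" by (auto simp: torus_boxes_def)
    have "(\<lambda>\<omega>. emeasure (K \<omega>) a * indicator b \<omega>) \<in> borel_measurable M"
      by (intro borel_measurable_times_ennreal arc A borel_measurable_indicator)
    moreover have "emeasure (K \<omega>) (?s A \<omega>) = emeasure (K \<omega>) a * indicator b \<omega>" for \<omega>
      by (cases "\<omega> \<in> b") (simp_all add: A(1) vimage_def)
    ultimately show ?case by simp
  next
    case (compl A)
    have "(\<lambda>\<omega>. emeasure (K \<omega>) {0..<2*pi} - emeasure (K \<omega>) (?s A \<omega>)) \<in> borel_measurable M"
      using compl arc[OF torus_space_arc] by (intro borel_measurable_minus_ennreal) auto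
    moreover have "emeasure (K \<omega>) (?s (?\<Omega> - A) \<omega>) = emeasure (K \<omega>) {0..<2*pi} - emeasure (K \<omega>) (?s A \<omega>)"
      if \<omega>: "\<omega> \<in> space M" for \<omega>
    proof -
      interpret finite_measure "K \<omega>" by (rule fin)
      have "?s (?\<Omega> - A) \<omega> = {0..<2*pi} - ?s A \<omega>" using \<omega> by auto
      moreover have "?s A \<omega> \<subseteq> {0..<2*pi}" using sets.sets_into_space[OF sec[OF compl(1)], of \<omega>] sp by simp
      ultimately show ?thesis using sec[OF compl(1), of \<omega>] by (simp add: emeasure_Diff S)
    qed
    ultimately show ?case by (simp cong: measurable_cong)
  next
    case (union A)
    have "(\<lambda>\<omega>. \<Sum>i. emeasure (K \<omega>) (?s (A i) \<omega>)) \<in> borel_measurable M"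
      by (intro borel_measurable_suminf_order union)
    moreover have "emeasure (K \<omega>) (?s (\<Union>i. A i) \<omega>) = (\<Sum>i. emeasure (K \<omega>) (?s (A i) \<omega>))" for \<omega>
    proof -
      have "disjoint_family (\<lambda>i. ?s (A i) \<omega>)" using union(1) by (auto simp: disjoint_family_on_def)
      moreover have "range (\<lambda>i. ?s (A i) \<omega>) \<subseteq> sets (K \<omega>)" using sec union(2) by blast
      ultimately show ?thesis unfolding vimage_UN by (intro suminf_emeasure[symmetric])
    qed
    ultimately show ?case by simp
  qed simp
qed

context random_phases
begin

lemma chaos_limit_unique:
  assumes "is_chaos_limit \<Phi> \<alpha> \<omega> \<mu>" "is_chaos_limit \<Phi> \<alpha> \<omega> \<nu>" shows "\<mu> = \<nu>"
proof (rule torus_measure_eqI)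
  fix f assume "cont_periodic f"
  then show "(\<integral>t. f t \<partial>\<mu>) = (\<integral>t. f t \<partial>\<nu>)"
    using assms unfolding is_chaos_limit_def torus_weak_conv_def cont_periodic_def
    by (blast intro: LIMSEQ_unique)
qed (use assms in \<open>auto simp: is_chaos_limit_def\<close>)

lemma integral_Q_density:
  assumes "f \<in> borel_measurable torus"
  shows "(\<integral>t. f t \<partial>density torus (\<lambda>t. ennreal (Q \<alpha> n t \<omega>))) = smear \<alpha> f n \<omega>"
  using integral_density[OF assms Q_time_measurable[of \<alpha> n \<omega>]]
  by (simp add: smear_def Q_nonneg mult.commute)

text \<open>
  This makes the choice in the definition of the chaos measure the genuine weak limit.
\<close>

lemma chaos_limit_if_bernstein:
  assumes "\<And>m k. convergent (\<lambda>n. smear \<alpha> (bernstein_torus m k) n \<omega>)"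
  shows "is_chaos_limit \<Phi> \<alpha> \<omega> (chaos_measure \<Phi> \<alpha> \<omega>)"
proof -
  have i: "integrable torus (\<lambda>t. Q \<alpha> N t \<omega>)" for N
    using integrable_smear_density[of "\<lambda>_. 1" 1 \<alpha> N \<omega>] by simp
  have "\<exists>\<mu>. finite_measure \<mu> \<and> sets \<mu> = sets torus \<and>
      torus_weak_conv (\<lambda>N. density torus (\<lambda>t. ennreal (Q \<alpha> N t \<omega>))) \<mu>"
    by (rule torus_weak_limit_exists[OF Q_time_measurable Q_pos i]) (use assms in \<open>simp add: smear_def\<close>)
  then have ex: "\<exists>\<mu>. is_chaos_limit \<Phi> \<alpha> \<omega> \<mu>" by (simp add: is_chaos_limit_def)
  then have "\<exists>!\<mu>. is_chaos_limit \<Phi> \<alpha> \<omega> \<mu>" using chaos_limit_unique by blast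
  from theI'[OF this] ex show ?thesis by (simp add: chaos_measure_def)
qed

lemma integral_chaos_limit:
  assumes "is_chaos_limit \<Phi> \<alpha> \<omega> \<mu>" and f: "cont_periodic f"
  shows "(\<integral>t. f t \<partial>\<mu>) = lim (\<lambda>n. smear \<alpha> f n \<omega>)"
proof -
  have fm: "f \<in> borel_measurable torus" using cont_periodic_torus[OF f] by simp
  have "(\<lambda>N. \<integral>t. f t \<partial>density torus (\<lambda>t. ennreal (Q \<alpha> N t \<omega>))) \<longlonglongrightarrow> (\<integral>t. f t \<partial>\<mu>)"
    using assms unfolding is_chaos_limit_def torus_weak_conv_def cont_periodic_def by blast
  then show ?thesis unfolding integral_Q_density[OF fm] by (rule limI[symmetric])
qed

text \<open>
  A version of the chaos measure that is measurable in \<open>\<omega>\<close>.  Existence of the weak limit is only known off a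
  null set, so the chaos measure itself need not depend measurably on \<open>\<omega>\<close>; integrals over \<open>\<omega>\<close> do not see the
  difference.
\<close>

definition chaos_kernel :: "real \<Rightarrow> ('a \<Rightarrow> real measure) \<Rightarrow> bool" where
  "chaos_kernel \<alpha> K \<longleftrightarrow> (AE \<omega> in M. K \<omega> = chaos_measure \<Phi> \<alpha> \<omega>) \<and>
    (\<forall>\<omega>. finite_measure (K \<omega>)) \<and> (\<forall>\<omega>. sets (K \<omega>) = sets torus) \<and>
    (\<forall>f. cont_periodic f \<longrightarrow> (\<lambda>\<omega>. \<integral>t. f t \<partial>K \<omega>) \<in> borel_measurable M) \<and>
    (\<forall>f. cont_periodic f \<longrightarrow> (AE \<omega> in M. (\<integral>t. f t \<partial>K \<omega>) = lim (\<lambda>n. smear \<alpha> f n \<omega>)))"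

lemma chaos_kernelD:
  assumes "chaos_kernel \<alpha> K"
  shows "AE \<omega> in M. K \<omega> = chaos_measure \<Phi> \<alpha> \<omega>"
    "\<And>\<omega>. finite_measure (K \<omega>)" "\<And>\<omega>. sets (K \<omega>) = sets torus"
    "\<And>f. cont_periodic f \<Longrightarrow> (\<lambda>\<omega>. \<integral>t. f t \<partial>K \<omega>) \<in> borel_measurable M"
    "\<And>f. cont_periodic f \<Longrightarrow> AE \<omega> in M. (\<integral>t. f t \<partial>K \<omega>) = lim (\<lambda>n. smear \<alpha> f n \<omega>)"
  using assms by (simp_all add: chaos_kernel_def)

lemma chaos_kernel_exists:
  assumes \<alpha>: "\<bar>\<alpha>\<bar> < 2" shows "\<exists>K. chaos_kernel \<alpha> K"
proof -
  have "AE \<omega> in M. \<forall>m k. convergent (\<lambda>n. smear \<alpha> (bernstein_torus m k) n \<omega>)"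
    unfolding AE_all_countable
    by (intro allI smear_converges(1)[OF \<alpha>] bernstein_torus_measurable bernstein_torus_range)
  then have "AE \<omega> in M. is_chaos_limit \<Phi> \<alpha> \<omega> (chaos_measure \<Phi> \<alpha> \<omega>)"
    by eventually_elim (rule chaos_limit_if_bernstein, blast)
  then obtain Z where Z: "{\<omega>\<in>space M. \<not> is_chaos_limit \<Phi> \<alpha> \<omega> (chaos_measure \<Phi> \<alpha> \<omega>)} \<subseteq> Z"
    "emeasure M Z = 0" "Z \<in> sets M" by (rule AE_E)
  have AEZ: "AE \<omega> in M. \<omega> \<notin> Z" using Z by (intro AE_not_in) auto
  define K where "K \<omega> = (if \<omega> \<in> space M - Z then chaos_measure \<Phi> \<alpha> \<omega> else null_measure torus)" for \<omega>
  have lim: "is_chaos_limit \<Phi> \<alpha> \<omega> (K \<omega>)" if "\<omega> \<in> space M - Z" for \<omega>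
    using that Z(1) by (auto simp: K_def)
  have "chaos_kernel \<alpha> K"
    unfolding chaos_kernel_def
  proof (intro conjI allI impI)
    show "AE \<omega> in M. K \<omega> = chaos_measure \<Phi> \<alpha> \<omega>"
      using AEZ AE_space by eventually_elim (simp add: K_def)
    show "finite_measure (K \<omega>)" for \<omega>
      using lim[of \<omega>] by (cases "\<omega> \<in> space M - Z") (auto simp: is_chaos_limit_def K_def intro!: finite_measureI)
    show "sets (K \<omega>) = sets torus" for \<omega>
      using lim[of \<omega>] by (cases "\<omega> \<in> space M - Z") (auto simp: is_chaos_limit_def K_def)
    fix f assume f: "cont_periodic f"
    have fm: "f \<in> borel_measurable torus" using cont_periodic_torus[OF f] by simp
    have "(\<lambda>\<omega>. indicator (space M - Z) \<omega> * lim (\<lambda>n. smear \<alpha> f n \<omega>)) \<in> borel_measurable M"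
      by (intro borel_measurable_times borel_measurable_indicator sets.Diff sets.top Z(3)
          borel_measurable_lim_metric smear_measurable fm)
    moreover have "(\<integral>t. f t \<partial>K \<omega>) = indicator (space M - Z) \<omega> * lim (\<lambda>n. smear \<alpha> f n \<omega>)" for \<omega>
      using integral_chaos_limit[OF lim f, of \<omega>] by (cases "\<omega> \<in> space M - Z") (auto simp: K_def)
    ultimately show "(\<lambda>\<omega>. \<integral>t. f t \<partial>K \<omega>) \<in> borel_measurable M" by simp
  next
    fix f assume f: "cont_periodic f"
    show "AE \<omega> in M. (\<integral>t. f t \<partial>K \<omega>) = lim (\<lambda>n. smear \<alpha> f n \<omega>)"
      using AEZ AE_space by eventually_elim (intro integral_chaos_limit[OF lim f], simp)
  qed
  then show ?thesis by blast
qed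

lemma sets_peyriere: "sets (peyriere_measure M \<Phi> \<alpha>) = sets (torus \<Otimes>\<^sub>M M)"
proof -
  have "sets (torus \<Otimes>\<^sub>M M) \<subseteq> Pow (space torus \<times> space M)"
    using sets.space_closed[of "torus \<Otimes>\<^sub>M M"] by (simp only: space_pair_measure)
  then show ?thesis
    unfolding peyriere_measure_def by (subst sets_measure_of)
      (simp_all only: space_pair_measure[symmetric] sets.sigma_sets_eq)
qed

text \<open>
  The set function defining the Peyriere measure agrees with one built from a measurable kernel, which is
  countably additive; hence it is the value of the measure.
\<close>

lemma emeasure_peyriere:
  assumes kern: "chaos_kernel \<alpha> K" and D: "D \<in> sets (torus \<Otimes>\<^sub>M M)"
  shows "emeasure (peyriere_measure M \<Phi> \<alpha>) D = (\<integral>\<^sup>+\<omega>. emeasure (K \<omega>) ((\<lambda>t. (t, \<omega>)) -` D) \<partial>M)"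
proof -
  note K = chaos_kernelD(1)[OF kern] and fin = chaos_kernelD(2)[OF kern]
    and S = chaos_kernelD(3)[OF kern] and meas = chaos_kernelD(4)[OF kern]
  let ?s = "\<lambda>D \<omega>. (\<lambda>t. (t, \<omega>)) -` D"
  let ?P = "peyriere_measure M \<Phi> \<alpha>"
  have sub: "sets (torus \<Otimes>\<^sub>M M) \<subseteq> Pow (space torus \<times> space M)"
    using sets.space_closed[of "torus \<Otimes>\<^sub>M M"] by (simp only: space_pair_measure)
  have val: "(\<integral>\<^sup>+\<omega>. (\<integral>\<^sup>+t. indicator A (t, \<omega>) \<partial>chaos_measure \<Phi> \<alpha> \<omega>) \<partial>M) = (\<integral>\<^sup>+\<omega>. emeasure (K \<omega>) (?s A \<omega>) \<partial>M)"
    if A: "A \<in> sets (torus \<Otimes>\<^sub>M M)" for A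
  proof (rule nn_integral_cong_AE)
    show "AE \<omega> in M. (\<integral>\<^sup>+t. indicator A (t, \<omega>) \<partial>chaos_measure \<Phi> \<alpha> \<omega>) = emeasure (K \<omega>) (?s A \<omega>)"
      using K
    proof eventually_elim
      case (elim \<omega>)
      have "?s A \<omega> \<in> sets (K \<omega>)" unfolding S by (rule sets_Pair2[OF A])
      then have "emeasure (K \<omega>) (?s A \<omega>) = (\<integral>\<^sup>+t. indicator (?s A \<omega>) t \<partial>K \<omega>)" by simp
      also have "\<dots> = (\<integral>\<^sup>+t. indicator A (t, \<omega>) \<partial>K \<omega>)" by (intro nn_integral_cong) (simp add: indicator_def)
      finally show ?case using elim by simp
    qed
  qed
  have "emeasure ?P D = (\<integral>\<^sup>+\<omega>. (\<integral>\<^sup>+t. indicator D (t, \<omega>) \<partial>chaos_measure \<Phi> \<alpha> \<omega>) \<partial>M)"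
  proof (rule emeasure_measure_of[OF peyriere_measure_def[of M \<Phi> \<alpha>] sub, unfolded sets_peyriere])
    show "positive (sets (torus \<Otimes>\<^sub>M M)) (\<lambda>A. \<integral>\<^sup>+\<omega>. (\<integral>\<^sup>+t. indicator A (t, \<omega>) \<partial>chaos_measure \<Phi> \<alpha> \<omega>) \<partial>M)"
      by (simp add: positive_def)
    show "countably_additive (sets (torus \<Otimes>\<^sub>M M)) (\<lambda>A. \<integral>\<^sup>+\<omega>. (\<integral>\<^sup>+t. indicator A (t, \<omega>) \<partial>chaos_measure \<Phi> \<alpha> \<omega>) \<partial>M)"
    proof (rule countably_additiveI)
      fix A :: "nat \<Rightarrow> (real \<times> 'a) set"
      assume A: "range A \<subseteq> sets (torus \<Otimes>\<^sub>M M)" and dis: "disjoint_family A" and un: "(\<Union>i. A i) \<in> sets (torus \<Otimes>\<^sub>M M)"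
      have Ai: "A i \<in> sets (torus \<Otimes>\<^sub>M M)" for i using A by blast
      have "(\<Sum>i. \<integral>\<^sup>+\<omega>. emeasure (K \<omega>) (?s (A i) \<omega>) \<partial>M) = (\<integral>\<^sup>+\<omega>. (\<Sum>i. emeasure (K \<omega>) (?s (A i) \<omega>)) \<partial>M)"
        by (rule nn_integral_suminf[symmetric]) (rule kernel_section_measurable[OF fin S meas Ai])
      also have "\<dots> = (\<integral>\<^sup>+\<omega>. emeasure (K \<omega>) (?s (\<Union>i. A i) \<omega>) \<partial>M)"
      proof (rule nn_integral_cong)
        fix \<omega>
        have "disjoint_family (\<lambda>i. ?s (A i) \<omega>)" using dis by (auto simp: disjoint_family_on_def)
        moreover have "range (\<lambda>i. ?s (A i) \<omega>) \<subseteq> sets (K \<omega>)" using sets_Pair2[OF Ai] S by auto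
        ultimately show "(\<Sum>i. emeasure (K \<omega>) (?s (A i) \<omega>)) = emeasure (K \<omega>) (?s (\<Union>i. A i) \<omega>)"
          unfolding vimage_UN by (intro suminf_emeasure)
      qed
      finally show "(\<Sum>i. \<integral>\<^sup>+\<omega>. (\<integral>\<^sup>+t. indicator (A i) (t, \<omega>) \<partial>chaos_measure \<Phi> \<alpha> \<omega>) \<partial>M)
          = (\<integral>\<^sup>+\<omega>. (\<integral>\<^sup>+t. indicator (\<Union>i. A i) (t, \<omega>) \<partial>chaos_measure \<Phi> \<alpha> \<omega>) \<partial>M)"
        unfolding val[OF Ai] val[OF un] .
    qed
  qed (rule D)
  then show ?thesis unfolding val[OF D] .
qed

text \<open>
  For continuous periodic functions in place of the indicator of \<open>a\<close> this is the martingale property carried to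
  the limit; both sides pass to the indicator by dominated convergence, on the left with the random but
  integrable total mass as a bound.
\<close>

lemma peyriere_rectangle:
  assumes \<alpha>: "\<bar>\<alpha>\<bar> < 2" and a: "a \<in> torus_arcs" and b: "b \<in> sets (history n)"
    and kern: "chaos_kernel \<alpha> K"
  shows "integrable M (\<lambda>\<omega>. indicator b \<omega> * measure (K \<omega>) a)"
    and "expectation (\<lambda>\<omega>. indicator b \<omega> * measure (K \<omega>) a) = expectation (\<lambda>\<omega>. indicator b \<omega> * smear \<alpha> (indicator a) n \<omega>)"
proof -
  note fin = chaos_kernelD(2)[OF kern] and S = chaos_kernelD(3)[OF kern]
    and meas = chaos_kernelD(4)[OF kern] and lim = chaos_kernelD(5)[OF kern]
  obtain c where ac: "a = {0..<2*pi} \<inter> {..c}" using a by (auto simp: torus_arcs_def)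
  obtain h :: "nat \<Rightarrow> real \<Rightarrow> real" where h: "\<And>k. cont_periodic (h k)" "\<And>k t. 0 \<le> h k t" "\<And>k t. h k t \<le> 1"
    "\<And>t. t \<in> {0..<2*pi} \<Longrightarrow> (\<lambda>k. h k t) \<longlonglongrightarrow> indicator {..c} t"
    using arc_indicator_approx[of c] by blast
  have hm: "h k \<in> borel_measurable torus" for k using cont_periodic_torus[OF h(1)] by simp
  have one: "cont_periodic (\<lambda>_. 1)" by (simp add: cont_periodic_def)
  have bM: "b \<in> sets M" by (rule history_sets_M[OF b])
  let ?m = "\<lambda>\<omega>. \<integral>t. (1::real) \<partial>K \<omega>"
  have im: "integrable M ?m"
  proof (rule integrable_cong_AE_imp[OF _ meas[OF one]])
    show "integrable M (\<lambda>\<omega>. lim (\<lambda>n. smear \<alpha> (\<lambda>_. 1) n \<omega>))" by (rule smear_converges(2)[OF \<alpha>]) auto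
    show "AE \<omega> in M. lim (\<lambda>n. smear \<alpha> (\<lambda>_. 1) n \<omega>) = ?m \<omega>" using lim[OF one] by eventually_elim simp
  qed
  have K1: "(\<integral>t. h k t \<partial>K \<omega>) \<le> ?m \<omega>" "0 \<le> (\<integral>t. h k t \<partial>K \<omega>)" for k \<omega>
  proof -
    interpret finite_measure "K \<omega>" by (rule fin)
    have "integrable (K \<omega>) (h k)"
      by (rule integrable_const_bound[where B=1]) (use h cont_periodic_torus[OF h(1) S] in \<open>auto simp: abs_of_nonneg\<close>)
    then show "(\<integral>t. h k t \<partial>K \<omega>) \<le> ?m \<omega>" using h by (intro integral_mono) auto
    show "0 \<le> (\<integral>t. h k t \<partial>K \<omega>)" using h by (intro Bochner_Integration.integral_nonneg) auto
  qed
  have conv: "(\<lambda>k. \<integral>t. h k t \<partial>K \<omega>) \<longlonglongrightarrow> measure (K \<omega>) a" for \<omega>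
    unfolding ac by (rule integral_arc_approx[OF fin S h])
  have Ka: "measure (K \<omega>) a \<le> ?m \<omega>" for \<omega>
    using K1 by (intro LIMSEQ_le_const2[OF conv]) auto
  have Km: "(\<lambda>\<omega>. measure (K \<omega>) a) \<in> borel_measurable M"
    by (rule borel_measurable_LIMSEQ_real[OF conv meas[OF h(1)]])
  have bm: "(\<lambda>\<omega>. indicator b \<omega> * f \<omega>) \<in> borel_measurable M" if "f \<in> borel_measurable M" for f :: "'a \<Rightarrow> real"
    by (intro borel_measurable_times borel_measurable_indicator bM that)
  show iK: "integrable M (\<lambda>\<omega>. indicator b \<omega> * measure (K \<omega>) a)"
    by (rule Bochner_Integration.integrable_bound[OF im bm[OF Km]])
      (use Ka order.trans[OF measure_nonneg Ka] in \<open>auto simp: indicator_def\<close>)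
  have lim1: "(\<lambda>k. expectation (\<lambda>\<omega>. indicator b \<omega> * (\<integral>t. h k t \<partial>K \<omega>)))
      \<longlonglongrightarrow> expectation (\<lambda>\<omega>. indicator b \<omega> * measure (K \<omega>) a)"
  proof (rule integral_dominated_convergence[where w="?m"])
    show "AE \<omega> in M. (\<lambda>k. indicator b \<omega> * (\<integral>t. h k t \<partial>K \<omega>)) \<longlonglongrightarrow> indicator b \<omega> * measure (K \<omega>) a"
      by (intro AE_I2 tendsto_mult_left conv)
    show "AE \<omega> in M. norm (indicator b \<omega> * (\<integral>t. h k t \<partial>K \<omega>)) \<le> ?m \<omega>" for k
      using K1 order.trans[OF K1(2) K1(1)] by (intro AE_I2) (auto simp: indicator_def)
  qed (use im bm Km meas[OF h(1)] in auto)
  have am: "(indicator a :: real \<Rightarrow> real) \<in> borel_measurable torus"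
    using a sets_torus_arcs by (intro borel_measurable_indicator) auto
  have lim2: "(\<lambda>k. expectation (\<lambda>\<omega>. indicator b \<omega> * smear \<alpha> (h k) n \<omega>))
      \<longlonglongrightarrow> expectation (\<lambda>\<omega>. indicator b \<omega> * smear \<alpha> (indicator a) n \<omega>)"
  proof (rule integral_dominated_convergence[where w="\<lambda>_. 1 * exp (\<bar>\<alpha>\<bar> * real n)"])
    show "AE \<omega> in M. (\<lambda>k. indicator b \<omega> * smear \<alpha> (h k) n \<omega>) \<longlonglongrightarrow> indicator b \<omega> * smear \<alpha> (indicator a) n \<omega>"
    proof (intro AE_I2 tendsto_mult_left)
      fix \<omega>
      show "(\<lambda>k. smear \<alpha> (h k) n \<omega>) \<longlonglongrightarrow> smear \<alpha> (indicator a) n \<omega>"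
        unfolding smear_def
      proof (rule integral_dominated_convergence[where w="\<lambda>_. 1 * exp (\<bar>\<alpha>\<bar> * real n)"])
        show "AE t in torus. (\<lambda>k. h k t * Q \<alpha> n t \<omega>) \<longlonglongrightarrow> indicator a t * Q \<alpha> n t \<omega>"
          using h(4) by (intro AE_I2 tendsto_mult_right) (auto simp: ac indicator_def)
        show "AE t in torus. norm (h k t * Q \<alpha> n t \<omega>) \<le> 1 * exp (\<bar>\<alpha>\<bar> * real n)" for k
          unfolding real_norm_def by (intro AE_I2 abs_mult_Q_le) (simp add: h abs_of_nonneg)
      qed (use hm am Q_time_measurable[of \<alpha> n \<omega>] in auto)
    qed
    show "AE \<omega> in M. norm (indicator b \<omega> * smear \<alpha> (h k) n \<omega>) \<le> 1 * exp (\<bar>\<alpha>\<bar> * real n)" for k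
    proof (rule AE_I2)
      fix \<omega>
      have "\<bar>smear \<alpha> (h k) n \<omega>\<bar> \<le> 1 * exp (\<bar>\<alpha>\<bar> * real n)"
        by (rule abs_smear_le[OF hm]) (simp add: h abs_of_nonneg)
      then show "norm (indicator b \<omega> * smear \<alpha> (h k) n \<omega>) \<le> 1 * exp (\<bar>\<alpha>\<bar> * real n)" by (simp add: indicator_def)
    qed
  qed (use bm smear_measurable[OF hm] smear_measurable[OF am] in auto)
  have "expectation (\<lambda>\<omega>. indicator b \<omega> * (\<integral>t. h k t \<partial>K \<omega>)) = expectation (\<lambda>\<omega>. indicator b \<omega> * smear \<alpha> (h k) n \<omega>)" for k
  proof -
    have "expectation (\<lambda>\<omega>. indicator b \<omega> * (\<integral>t. h k t \<partial>K \<omega>)) = expectation (\<lambda>\<omega>. indicator b \<omega> * lim (\<lambda>n. smear \<alpha> (h k) n \<omega>))"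
    proof (rule integral_cong_AE)
      show "AE \<omega> in M. indicator b \<omega> * (\<integral>t. h k t \<partial>K \<omega>) = indicator b \<omega> * lim (\<lambda>n. smear \<alpha> (h k) n \<omega>)"
        using lim[OF h(1), of k] by eventually_elim simp
    qed (intro bm meas h borel_measurable_lim_metric smear_measurable hm)+
    also have "\<dots> = expectation (\<lambda>\<omega>. indicator b \<omega> * smear \<alpha> (h k) n \<omega>)"
      by (rule expectation_smear_limit[OF \<alpha> hm h(2,3) borel_measurable_indicator[OF b]]) (simp add: indicator_def)
    finally show ?thesis .
  qed
  with lim1 lim2 show "expectation (\<lambda>\<omega>. indicator b \<omega> * measure (K \<omega>) a) = expectation (\<lambda>\<omega>. indicator b \<omega> * smear \<alpha> (indicator a) n \<omega>)"
    by (simp add: LIMSEQ_unique)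
qed

text \<open>
  Both sides are finite measures on the circle times the first \<open>n\<close> phases and agree on boxes.
\<close>

lemma peyriere_history:
  assumes \<alpha>: "\<bar>\<alpha>\<bar> < 2" and D: "D \<in> sets (torus \<Otimes>\<^sub>M history n)"
  shows "emeasure (peyriere_measure M \<Phi> \<alpha>) D
    = (\<integral>\<^sup>+t. (\<integral>\<^sup>+\<omega>. indicator D (t, \<omega>) * ennreal (Q \<alpha> n t \<omega>) \<partial>M) \<partial>torus)"
proof -
  obtain K where kern: "chaos_kernel \<alpha> K" using chaos_kernel_exists[OF \<alpha>] by blast
  note K = chaos_kernelD[OF kern]
  let ?P = "peyriere_measure M \<Phi> \<alpha>" and ?H = "torus \<Otimes>\<^sub>M history n"
  interpret TM: pair_prob_space torus M ..
  let ?Q = "density (torus \<Otimes>\<^sub>M M) (\<lambda>p. ennreal (Q \<alpha> n (fst p) (snd p)))"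
  define N1 where "N1 = distr ?P ?H (\<lambda>p. p)"
  define N2 where "N2 = distr ?Q ?H (\<lambda>p. p)"
  have idP: "(\<lambda>p. p) \<in> measurable ?P ?H" using measurable_pair_history measurable_cong_sets[OF sets_peyriere refl] by blast
  have idQ: "(\<lambda>p. p) \<in> measurable ?Q ?H" using measurable_pair_history by simp
  have Qm: "(\<lambda>p. ennreal (Q \<alpha> n (fst p) (snd p))) \<in> borel_measurable (torus \<Otimes>\<^sub>M M)" using Q_joint by measurable
  have spH: "space ?H = space torus \<times> space M" by (simp add: space_pair_measure)
  have vim: "(\<lambda>p. p) -` X \<inter> space (torus \<Otimes>\<^sub>M M) = X" if "X \<in> sets ?H" for X
    using sets.sets_into_space[OF that] by (auto simp: space_pair_measure)
  have spP: "space ?P = space (torus \<Otimes>\<^sub>M M)" by (rule sets_eq_imp_space_eq[OF sets_peyriere])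
  have e1: "emeasure N1 X = (\<integral>\<^sup>+\<omega>. emeasure (K \<omega>) ((\<lambda>t. (t, \<omega>)) -` X) \<partial>M)" if "X \<in> sets ?H" for X
    unfolding N1_def emeasure_distr[OF idP that] spP vim[OF that]
    by (rule emeasure_peyriere[OF kern pair_history_sets[OF that]])
  have e2: "emeasure N2 X = (\<integral>\<^sup>+p. ennreal (Q \<alpha> n (fst p) (snd p)) * indicator X p \<partial>(torus \<Otimes>\<^sub>M M))" if "X \<in> sets ?H" for X
    unfolding N2_def emeasure_distr[OF idQ that] space_density vim[OF that]
    by (rule emeasure_density[OF Qm pair_history_sets[OF that]])
  have fm: "(\<lambda>p. ennreal (Q \<alpha> n (fst p) (snd p)) * indicator X p) \<in> borel_measurable (torus \<Otimes>\<^sub>M M)" if "X \<in> sets ?H" for X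
    by (intro borel_measurable_times_ennreal Qm borel_measurable_indicator pair_history_sets[OF that])
  have rect: "emeasure N1 X = emeasure N2 X \<and> emeasure N1 X \<noteq> \<infinity>"
    if X0: "X \<in> torus_boxes (history n)" for X
  proof -
    obtain a b where X: "X = a \<times> b" and a: "a \<in> torus_arcs" and b: "b \<in> sets (history n)" using X0 by (auto simp: torus_boxes_def)
    have at: "a \<in> sets torus" using a sets_torus_arcs by auto
    have XH: "X \<in> sets ?H" unfolding X by (intro pair_measureI at b)
    note R = peyriere_rectangle[OF \<alpha> a b kern]
    have am: "(indicator a :: real \<Rightarrow> real) \<in> borel_measurable torus" by (rule borel_measurable_indicator[OF at])
    have a1: "\<bar>indicator a t :: real\<bar> \<le> 1" for t by (simp add: indicator_def)
    have "emeasure N1 X = (\<integral>\<^sup>+\<omega>. ennreal (indicator b \<omega> * measure (K \<omega>) a) \<partial>M)"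
      unfolding e1[OF XH]
    proof (rule nn_integral_cong)
      fix \<omega>
      show "emeasure (K \<omega>) ((\<lambda>t. (t, \<omega>)) -` X) = ennreal (indicator b \<omega> * measure (K \<omega>) a)"
        unfolding X finite_measure.emeasure_eq_measure[OF K(2)] by (cases "\<omega> \<in> b") (simp_all add: vimage_def)
    qed
    also have "\<dots> = ennreal (expectation (\<lambda>\<omega>. indicator b \<omega> * measure (K \<omega>) a))"
      by (rule nn_integral_eq_integral[OF R(1)]) (intro AE_I2 mult_nonneg_nonneg measure_nonneg indicator_pos_le)
    finally have 1: "emeasure N1 X = ennreal (expectation (\<lambda>\<omega>. indicator b \<omega> * smear \<alpha> (indicator a) n \<omega>))"
      unfolding R(2) .
    have ib: "integrable M (\<lambda>\<omega>. indicator b \<omega> * smear \<alpha> (indicator a) n \<omega>)"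
      using integrable_mult_indicator[OF history_sets_M[OF b] integrable_smear[OF am a1]] by simp
    have "emeasure N2 X = (\<integral>\<^sup>+\<omega>. \<integral>\<^sup>+t. ennreal (Q \<alpha> n t \<omega>) * indicator X (t, \<omega>) \<partial>torus \<partial>M)"
      unfolding e2[OF XH] TM.nn_integral_snd[OF fm[OF XH], symmetric] by simp
    also have "\<dots> = (\<integral>\<^sup>+\<omega>. ennreal (indicator b \<omega> * smear \<alpha> (indicator a) n \<omega>) \<partial>M)"
    proof (rule nn_integral_cong)
      fix \<omega>
      have "(\<integral>\<^sup>+t. ennreal (Q \<alpha> n t \<omega>) * indicator X (t, \<omega>) \<partial>torus)
          = (\<integral>\<^sup>+t. ennreal (indicator b \<omega> * (indicator a t * Q \<alpha> n t \<omega>)) \<partial>torus)"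
        by (intro nn_integral_cong) (auto simp: X indicator_def)
      also have "\<dots> = ennreal (\<integral>t. indicator b \<omega> * (indicator a t * Q \<alpha> n t \<omega>) \<partial>torus)"
        by (rule nn_integral_eq_integral[OF integrable_mult_right[OF integrable_smear_density[OF am a1]]])
          (intro AE_I2 mult_nonneg_nonneg Q_nonneg indicator_pos_le)
      finally show "(\<integral>\<^sup>+t. ennreal (Q \<alpha> n t \<omega>) * indicator X (t, \<omega>) \<partial>torus) = ennreal (indicator b \<omega> * smear \<alpha> (indicator a) n \<omega>)"
        by (simp add: smear_def)
    qed
    also have "\<dots> = ennreal (expectation (\<lambda>\<omega>. indicator b \<omega> * smear \<alpha> (indicator a) n \<omega>))"
      by (rule nn_integral_eq_integral[OF ib]) (intro AE_I2 mult_nonneg_nonneg smear_nonneg indicator_pos_le)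
    finally show ?thesis using 1 by simp
  qed
  have "N1 = N2"
  proof (rule measure_eqI_generator_eq[where E="torus_boxes (history n)"
        and \<Omega>="{0..<2*pi} \<times> space (history n)" and A="\<lambda>_. {0..<2*pi} \<times> space (history n)"])
    show "Int_stable (torus_boxes (history n))" by (rule torus_boxes_Int_stable)
    show "torus_boxes (history n) \<subseteq> Pow ({0..<2*pi} \<times> space (history n))"
      by (rule torus_boxes_Pow)
    show "sets N1 = sigma_sets ({0..<2*pi} \<times> space (history n)) (torus_boxes (history n))"
      "sets N2 = sigma_sets ({0..<2*pi} \<times> space (history n)) (torus_boxes (history n))"
      by (simp_all only: N1_def N2_def sets_distr sets_pair_torus_boxes)
    have top: "{0..<2*pi} \<times> space (history n) \<in> torus_boxes (history n)"
      using torus_space_arc unfolding torus_boxes_def by blast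
    then show "range (\<lambda>_. {0..<2*pi} \<times> space (history n)) \<subseteq> torus_boxes (history n)" by blast
    show "emeasure N1 ({0..<2*pi} \<times> space (history n)) \<noteq> \<infinity>" using rect[OF top] by blast
    show "emeasure N1 X = emeasure N2 X" if "X \<in> torus_boxes (history n)" for X
      using rect[OF that] by blast
  qed simp
  have "emeasure ?P D = emeasure N1 D"
    unfolding e1[OF D] by (rule emeasure_peyriere[OF kern pair_history_sets[OF D]])
  also have "\<dots> = (\<integral>\<^sup>+p. ennreal (Q \<alpha> n (fst p) (snd p)) * indicator D p \<partial>(torus \<Otimes>\<^sub>M M))"
    unfolding \<open>N1 = N2\<close> by (rule e2[OF D])
  also have "\<dots> = (\<integral>\<^sup>+t. \<integral>\<^sup>+\<omega>. ennreal (Q \<alpha> n t \<omega>) * indicator D (t, \<omega>) \<partial>M \<partial>torus)"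
    using nn_integral_fst[OF fm[OF D]] by simp
  finally show ?thesis by (simp add: mult.commute)
qed

end

context random_phases
begin

section \<open>Large deviations and almost sure convergence\<close>

definition deviation_prob :: "real \<Rightarrow> real \<Rightarrow> nat \<Rightarrow> nat \<Rightarrow> real \<Rightarrow> real" where
  "deviation_prob \<beta> \<epsilon> K N t = expectation (\<lambda>\<omega>. indicator (deviates \<beta> \<epsilon> K N t) \<omega> * Q \<beta> N t \<omega>)"

lemma emeasure_peyriere_deviation:
  assumes \<alpha>: "\<bar>\<alpha>\<bar> < 2"
  shows "emeasure (peyriere_measure M \<Phi> \<alpha>) (deviation_set \<alpha> \<epsilon> K N) = (\<integral>\<^sup>+t. ennreal (deviation_prob \<alpha> \<epsilon> K N t) \<partial>torus)"
  unfolding peyriere_history[OF \<alpha> deviation_set_history]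
proof (rule nn_integral_cong)
  fix t assume t: "t \<in> space torus"
  have i: "integrable M (\<lambda>\<omega>. indicator (deviates \<alpha> \<epsilon> K N t) \<omega> * Q \<alpha> N t \<omega>)"
    using integrable_mult_indicator[OF history_sets_M[OF deviates_history] integrable_Q] by simp
  have "(\<integral>\<^sup>+\<omega>. indicator (deviation_set \<alpha> \<epsilon> K N) (t, \<omega>) * ennreal (Q \<alpha> N t \<omega>) \<partial>M)
      = (\<integral>\<^sup>+\<omega>. ennreal (indicator (deviates \<alpha> \<epsilon> K N t) \<omega> * Q \<alpha> N t \<omega>) \<partial>M)"
    using t by (intro nn_integral_cong) (auto simp: deviation_set_def indicator_def)
  also have "\<dots> = ennreal (deviation_prob \<alpha> \<epsilon> K N t)"
    unfolding deviation_prob_def by (rule nn_integral_eq_integral[OF i]) (simp add: Q_nonneg)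
  finally show "(\<integral>\<^sup>+\<omega>. indicator (deviation_set \<alpha> \<epsilon> K N) (t, \<omega>) * ennreal (Q \<alpha> N t \<omega>) \<partial>M) = ennreal (deviation_prob \<alpha> \<epsilon> K N t)" .
qed

lemma peyriere_deviation_le:
  assumes \<alpha>: "\<bar>\<alpha>\<bar> < 2" and b: "\<And>t. deviation_prob \<alpha> \<epsilon> K N t \<le> b"
  shows "emeasure (peyriere_measure M \<Phi> \<alpha>) (deviation_set \<alpha> \<epsilon> K N) \<le> ennreal b"
proof -
  have "(\<integral>\<^sup>+t. ennreal (deviation_prob \<alpha> \<epsilon> K N t) \<partial>torus) \<le> (\<integral>\<^sup>+t. ennreal b \<partial>torus)"
    by (intro nn_integral_mono ennreal_leI b)
  also have "\<dots> = ennreal b" using torus.emeasure_space_1 by simp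
  finally show ?thesis unfolding emeasure_peyriere_deviation[OF \<alpha>] .
qed

lemma peyriere_deviation_ge:
  assumes \<alpha>: "\<bar>\<alpha>\<bar> < 2" and b: "\<And>t. b \<le> deviation_prob \<alpha> \<epsilon> K N t"
  shows "ennreal b \<le> emeasure (peyriere_measure M \<Phi> \<alpha>) (deviation_set \<alpha> \<epsilon> K N)"
proof -
  have "ennreal b = (\<integral>\<^sup>+t. ennreal b \<partial>torus)" using torus.emeasure_space_1 by simp
  also have "\<dots> \<le> (\<integral>\<^sup>+t. ennreal (deviation_prob \<alpha> \<epsilon> K N t) \<partial>torus)"
    by (intro nn_integral_mono ennreal_leI b)
  finally show ?thesis unfolding emeasure_peyriere_deviation[OF \<alpha>] .
qed

text \<open>
  Tilting by \<open>l = 2(\<eta> + \<delta>)\<close> moves the typical value of the field to \<open>(\<alpha>/2 + \<eta> + \<delta>) ln N\<close>, inside the deviation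
  event, and under the new parameter the window of radius \<open>\<delta> ln N / 2\<close> around it has weight at least one half.  In
  this window the ratio of the original to the tilted density is at least a constant times \<open>exp (-(\<eta> + \<delta>)(\<eta> + 3\<delta>) ln N)\<close>.
\<close>

lemma deviation_prob_lower:
  assumes \<eta>: "0 < \<eta>" and \<delta>: "0 < \<delta>"
  shows "\<exists>c>0. \<exists>N0. \<forall>N\<ge>N0. \<forall>t. c * real N powr (- ((\<eta> + \<delta>) * (\<eta> + 3 * \<delta>))) \<le> deviation_prob \<alpha> \<eta> N N t"
proof -
  define l where "l = 2 * (\<eta> + \<delta>)"
  obtain C where C: "C > 0" "\<And>K N t. K \<ge> 1 \<Longrightarrow> deviation_prob (\<alpha> + l) (\<delta>/2) K N t \<le> C * real K powr (-(\<delta>/2)\<^sup>2)"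
    using expectation_deviation[of "\<delta>/2" "\<alpha> + l"] \<delta> unfolding deviation_prob_def by auto
  obtain C1 where C1: "\<And>n. n \<ge> 1 \<Longrightarrow> \<bar>ln (bessel_prod n \<alpha>) - \<alpha>\<^sup>2/4 * ln (real n)\<bar> \<le> C1"
    using ln_bessel_prod[of \<alpha>] by auto
  obtain C2 where C2: "\<And>n. n \<ge> 1 \<Longrightarrow> \<bar>ln (bessel_prod n (\<alpha>+l)) - (\<alpha>+l)\<^sup>2/4 * ln (real n)\<bar> \<le> C2"
    using ln_bessel_prod[of "\<alpha>+l"] by auto
  have "((\<lambda>k. C * real k powr (-(\<delta>/2)\<^sup>2)) \<longlongrightarrow> C * 0) sequentially"
    using \<delta> by (intro tendsto_mult_left tendsto_neg_powr filterlim_real_sequentially) simp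
  then have "eventually (\<lambda>k. C * real k powr (-(\<delta>/2)\<^sup>2) < 1/2) sequentially"
    by (intro order_tendstoD(2)) auto
  then obtain n0 where n0: "\<And>N. N \<ge> n0 \<Longrightarrow> C * real N powr (-(\<delta>/2)\<^sup>2) < 1/2"
    unfolding eventually_sequentially by blast
  let ?c = "exp (- C1 - C2)"
  let ?x = "(\<eta> + \<delta>) * (\<eta> + 3 * \<delta>)"
  have "?c / 2 * real N powr (- ?x) \<le> deviation_prob \<alpha> \<eta> N N t" if N: "N \<ge> max n0 2" for N t
  proof -
    have N2: "2 \<le> N" "n0 \<le> N" using N by auto
    define L where "L = ln (real N)"
    have L: "0 < L" using N2 by (simp add: L_def)
    define k where "k = ?c * real N powr (- ?x)"
    have k: "0 < k" using N2 by (simp add: k_def)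
    let ?A = "deviates (\<alpha>+l) (\<delta>/2) N N t" and ?B = "deviates \<alpha> \<eta> N N t"
    have AM: "?A \<in> sets M" "?B \<in> sets M" by (intro history_sets_M[OF deviates_history])+
    have iI: "integrable M (\<lambda>\<omega>. indicator S \<omega> * Q \<beta> N t \<omega>)" if "S \<in> sets M" for S \<beta>
      using integrable_mult_indicator[OF that integrable_Q] by simp
    have pt: "k * (Q (\<alpha>+l) N t \<omega> - indicator ?A \<omega> * Q (\<alpha>+l) N t \<omega>) \<le> indicator ?B \<omega> * Q \<alpha> N t \<omega>" if \<omega>: "\<omega> \<in> space M" for \<omega>
    proof (cases "\<omega> \<in> ?A")
      case True
      then show ?thesis using Q_nonneg[of \<alpha> N \<omega> t] by (simp add: indicator_def)
    next
      case False
      define T where "T = field N t \<omega>"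
      have T: "\<bar>T - (\<alpha>+l)/2 * L\<bar> \<le> \<delta>/2 * L"
        using False \<omega> by (auto simp: deviates_def T_def L_def not_less)
      have half: "(\<alpha>+l)/2 * L = \<alpha>/2 * L + \<eta> * L + \<delta> * L" by (simp add: l_def field_simps)
      have dL: "\<delta>/2 * L < \<delta> * L" using \<delta> L by simp
      have "\<eta> * L < T - \<alpha>/2 * L" using T half dL by linarith
      then have B: "\<omega> \<in> ?B" using \<omega> by (auto simp: deviates_def T_def L_def)
      have "T \<le> \<alpha>/2 * L + \<eta> * L + 2 * \<delta> * L" using T half dL by linarith
      then have "l * T \<le> l * (\<alpha>/2 * L + \<eta> * L + 2 * \<delta> * L)"
        using \<eta> \<delta> by (intro mult_left_mono) (auto simp: l_def)
      moreover have "l * (\<alpha>/2 * L + \<eta> * L + 2 * \<delta> * L) = (\<alpha>+l)\<^sup>2/4 * L - \<alpha>\<^sup>2/4 * L + ?x * L"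
        by (simp add: l_def power2_eq_square field_simps)
      ultimately have "- C1 - C2 - ?x * L + l * T + ln (bessel_prod N \<alpha>) \<le> ln (bessel_prod N (\<alpha>+l))"
        using C1[of N] C2[of N] N2 unfolding L_def[symmetric] by linarith
      then have "exp (- C1 - C2 - ?x * L + l * T + ln (bessel_prod N \<alpha>)) \<le> exp (ln (bessel_prod N (\<alpha>+l)))" by simp
      then have "k * exp (l * T) * bessel_prod N \<alpha> \<le> bessel_prod N (\<alpha>+l)"
        using bessel_prod_ge_1[of N \<alpha>] bessel_prod_ge_1[of N "\<alpha>+l"] N2
        by (simp add: k_def exp_add exp_diff powr_def L_def exp_minus field_simps)
      then have "(k * exp (l * T) * bessel_prod N \<alpha>) * exp (\<alpha> * T) \<le> bessel_prod N (\<alpha>+l) * exp (\<alpha> * T)"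
        by (intro mult_right_mono) auto
      moreover have "exp ((\<alpha>+l) * T) = exp (l * T) * exp (\<alpha> * T)" by (simp add: distrib_right exp_add)
      ultimately have "k * exp ((\<alpha>+l) * T) * bessel_prod N \<alpha> \<le> bessel_prod N (\<alpha>+l) * exp (\<alpha> * T)"
        by (simp only: mult_ac)
      then have "k * Q (\<alpha>+l) N t \<omega> \<le> Q \<alpha> N t \<omega>"
        using bessel_prod_ge_1[of N \<alpha>] bessel_prod_ge_1[of N "\<alpha>+l"]
        unfolding Q_eq T_def[symmetric] by (simp add: field_simps)
      then show ?thesis using False B by simp
    qed
    have "k * (1 - deviation_prob (\<alpha>+l) (\<delta>/2) N N t)
        = expectation (\<lambda>\<omega>. k * (Q (\<alpha>+l) N t \<omega> - indicator ?A \<omega> * Q (\<alpha>+l) N t \<omega>))"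
      using Bochner_Integration.integral_diff[OF integrable_Q[of "\<alpha>+l" N t] iI[OF AM(1), of "\<alpha>+l"]]
      by (simp add: deviation_prob_def expectation_Q)
    also have "\<dots> \<le> deviation_prob \<alpha> \<eta> N N t"
      unfolding deviation_prob_def
      by (intro integral_mono integrable_mult_right Bochner_Integration.integrable_diff integrable_Q iI AM pt)
    finally have "k * (1 - deviation_prob (\<alpha>+l) (\<delta>/2) N N t) \<le> deviation_prob \<alpha> \<eta> N N t" .
    moreover have "k * (1/2) \<le> k * (1 - deviation_prob (\<alpha>+l) (\<delta>/2) N N t)"
      using C(2)[of N N t] n0[OF N2(2)] N2 k by (intro mult_left_mono) auto
    moreover have "?c / 2 * real N powr (- ?x) = k * (1/2)" by (simp add: k_def)
    ultimately show ?thesis by linarith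
  qed
  then show ?thesis by (intro exI[of _ "?c/2"] conjI exI[of _ "max n0 2"]) auto
qed

lemma log_average_field: "log_average \<Phi> N \<omega> t = field N t \<omega> / ln (real N)"
  by (simp add: log_average_def field_def)

lemma log_average_deviates:
  assumes N: "2 \<le> N"
  shows "{(t, \<omega>) \<in> space torus \<times> space M. log_average \<Phi> N \<omega> t \<notin> {\<alpha>/2 - \<eta>..\<alpha>/2 + \<eta>}} = deviation_set \<alpha> \<eta> N N"
proof -
  have L: "0 < ln (real N)" using N by simp
  have "log_average \<Phi> N \<omega> t \<notin> {\<alpha>/2 - \<eta>..\<alpha>/2 + \<eta>} \<longleftrightarrow> \<bar>field N t \<omega> - \<alpha>/2 * ln (real N)\<bar> > \<eta> * ln (real N)" for t \<omega>
    using L unfolding log_average_field by (auto simp: abs_le_iff not_less field_simps abs_if)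
  then show ?thesis by (auto simp: deviation_set_def deviates_def)
qed

text \<open>
  The upper bound is \<open>expectation_deviation\<close> with \<open>K = N\<close>.  In the lower bound \<open>(\<eta> + \<delta>)(\<eta> + 3\<delta>)\<close> tends to \<open>\<eta>\<^sup>2\<close> as
  \<open>\<delta>\<close> decreases to \<open>0\<close>.
\<close>

theorem peyriere_large_deviations:
  assumes \<alpha>: "\<bar>\<alpha>\<bar> < 2" and \<eta>: "0 < \<eta>"
  shows "(\<lambda>N. 1 / ln (real N) * ln (measure (peyriere_measure M \<Phi> \<alpha>)
      {(t, \<omega>) \<in> space torus \<times> space M. log_average \<Phi> N \<omega> t \<notin> {\<alpha>/2 - \<eta>..\<alpha>/2 + \<eta>}})) \<longlonglongrightarrow> - (\<eta>\<^sup>2)"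
proof -
  let ?P = "peyriere_measure M \<Phi> \<alpha>"
  define p where "p N = measure ?P (deviation_set \<alpha> \<eta> N N)" for N
  define r where "r N = 1 / ln (real N) * ln (p N)" for N
  obtain C where C: "C > 0" "\<And>K N t. K \<ge> 1 \<Longrightarrow> deviation_prob \<alpha> \<eta> K N t \<le> C * real K powr (-\<eta>\<^sup>2)"
    using expectation_deviation[OF \<eta>, of \<alpha>] unfolding deviation_prob_def by blast
  have up: "emeasure ?P (deviation_set \<alpha> \<eta> N N) \<le> ennreal (C * real N powr (-\<eta>\<^sup>2))" if "N \<ge> 1" for N
    by (rule peyriere_deviation_le[OF \<alpha> C(2)[OF that]])
  have em: "emeasure ?P (deviation_set \<alpha> \<eta> N N) = ennreal (p N)" if "N \<ge> 1" for N
    unfolding p_def using up[OF that] by (intro emeasure_eq_ennreal_measure) (auto simp: top_unique)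
  have pu: "p N \<le> C * real N powr (-\<eta>\<^sup>2)" if "N \<ge> 1" for N
    using up[OF that] C(1) unfolding em[OF that] by (simp add: ennreal_le_iff)
  have lnN: "filterlim (\<lambda>N. ln (real N)) at_top sequentially"
    by (rule filterlim_compose[OF ln_at_top filterlim_real_sequentially])
  have zero: "(\<lambda>N. ln c / ln (real N)) \<longlonglongrightarrow> 0" for c :: real
    by (rule tendsto_divide_0[OF tendsto_const filterlim_at_top_imp_at_infinity[OF lnN]])
  have lower: "eventually (\<lambda>N. - \<eta>\<^sup>2 - e < r N) sequentially" if e: "e > 0" for e
  proof -
    have "((\<lambda>\<delta>. (\<eta> + \<delta>) * (\<eta> + 3 * \<delta>)) \<longlongrightarrow> (\<eta> + 0) * (\<eta> + 3 * 0)) (at_right 0)"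
      by (intro tendsto_intros)
    then have "eventually (\<lambda>\<delta>. (\<eta> + \<delta>) * (\<eta> + 3 * \<delta>) < \<eta>\<^sup>2 + e/2) (at_right 0)"
      using e by (intro order_tendstoD(2)) (auto simp: power2_eq_square)
    then have "eventually (\<lambda>\<delta>. 0 < \<delta> \<and> (\<eta> + \<delta>) * (\<eta> + 3 * \<delta>) < \<eta>\<^sup>2 + e/2) (at_right 0)"
      using eventually_at_right_less[of 0] by (rule eventually_conj[rotated])
    then obtain \<delta> where \<delta>: "0 < \<delta>" "(\<eta> + \<delta>) * (\<eta> + 3 * \<delta>) < \<eta>\<^sup>2 + e/2"
      using eventually_happens' trivial_limit_at_right_real by blast
    let ?x = "(\<eta> + \<delta>) * (\<eta> + 3 * \<delta>)"
    obtain c N0 where c: "c > 0" "\<And>N t. N \<ge> N0 \<Longrightarrow> c * real N powr (- ?x) \<le> deviation_prob \<alpha> \<eta> N N t"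
      using deviation_prob_lower[OF \<eta> \<delta>(1), of \<alpha>] by blast
    have pl: "c * real N powr (- ?x) \<le> p N" if "N \<ge> max N0 1" for N
    proof -
      have "ennreal (c * real N powr (- ?x)) \<le> ennreal (p N)"
        using peyriere_deviation_ge[OF \<alpha> c(2)[of N]] em[of N] that by simp
      then show ?thesis by (simp add: ennreal_le_iff p_def)
    qed
    have "eventually (\<lambda>N. - (e/2) < ln c / ln (real N)) sequentially"
      using zero[of c] e by (intro order_tendstoD(1)) auto
    then show ?thesis using eventually_ge_at_top[of "max N0 2"]
    proof eventually_elim
      case (elim N)
      have L: "0 < ln (real N)" using elim by simp
      have "ln c + (- ?x) * ln (real N) = ln (c * real N powr (- ?x))"
        using c elim by (simp add: ln_mult ln_powr)
      also have "\<dots> \<le> ln (p N)" using pl[of N] c elim by (intro ln_mono) auto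
      finally have "(ln c + (- ?x) * ln (real N)) / ln (real N) \<le> r N"
        using L by (simp add: r_def divide_right_mono)
      moreover have "(ln c + (- ?x) * ln (real N)) / ln (real N) = ln c / ln (real N) - ?x"
        unfolding add_divide_distrib using L by simp
      ultimately show ?case using elim \<delta>(2) by linarith
    qed
  qed
  have upper: "eventually (\<lambda>N. r N < - \<eta>\<^sup>2 + e) sequentially" if e: "e > 0" for e
  proof -
    obtain c N0 where c: "c > 0" "\<And>N t. N \<ge> N0 \<Longrightarrow> c * real N powr (- ((\<eta> + 1) * (\<eta> + 3 * 1))) \<le> deviation_prob \<alpha> \<eta> N N t"
      using deviation_prob_lower[OF \<eta>, of 1 \<alpha>] by auto
    have pp: "0 < p N" if "N \<ge> max N0 1" for N
    proof -
      have "ennreal (c * real N powr (- ((\<eta> + 1) * (\<eta> + 3 * 1)))) \<le> ennreal (p N)"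
        using peyriere_deviation_ge[OF \<alpha> c(2)[of N]] em[of N] that by simp
      then have "c * real N powr (- ((\<eta> + 1) * (\<eta> + 3 * 1))) \<le> p N" by (simp add: ennreal_le_iff p_def)
      moreover have "0 < c * real N powr (- ((\<eta> + 1) * (\<eta> + 3 * 1)))" using c that by simp
      ultimately show ?thesis by linarith
    qed
    have "eventually (\<lambda>N. ln C / ln (real N) < e) sequentially"
      using zero[of C] e by (intro order_tendstoD(2)) auto
    then show ?thesis using eventually_ge_at_top[of "max N0 2"]
    proof eventually_elim
      case (elim N)
      have L: "0 < ln (real N)" using elim by simp
      have "ln (p N) \<le> ln (C * real N powr (-\<eta>\<^sup>2))"
        using pu[of N] pp[of N] elim by (intro ln_mono) auto
      also have "\<dots> = ln C + (-\<eta>\<^sup>2) * ln (real N)"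
        using C elim by (simp add: ln_mult ln_powr)
      finally have "r N \<le> (ln C + (-\<eta>\<^sup>2) * ln (real N)) / ln (real N)"
        using L by (simp add: r_def divide_right_mono)
      moreover have "(ln C + (-\<eta>\<^sup>2) * ln (real N)) / ln (real N) = ln C / ln (real N) - \<eta>\<^sup>2"
        unfolding add_divide_distrib using L by simp
      ultimately show ?case using elim by linarith
    qed
  qed
  have "r \<longlonglongrightarrow> - (\<eta>\<^sup>2)"
  proof (rule order_tendstoI)
    fix a assume "a < - (\<eta>\<^sup>2)"
    then show "eventually (\<lambda>N. a < r N) sequentially" using lower[of "- (\<eta>\<^sup>2) - a"] by simp
  next
    fix a assume "- (\<eta>\<^sup>2) < a"
    then show "eventually (\<lambda>N. r N < a) sequentially" using upper[of "a + \<eta>\<^sup>2"] by simp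
  qed
  then show ?thesis
  proof (rule Lim_transform_eventually)
    show "eventually (\<lambda>N. r N = 1 / ln (real N) * ln (measure ?P
      {(t, \<omega>) \<in> space torus \<times> space M. log_average \<Phi> N \<omega> t \<notin> {\<alpha>/2 - \<eta>..\<alpha>/2 + \<eta>}})) sequentially"
      using eventually_ge_at_top[of 2] by eventually_elim (simp only: r_def p_def log_average_deviates)
  qed
qed

text \<open>
  The Peyriere measure of the set where deviations of size \<open>\<epsilon>\<close> occur after every time \<open>k\<close> is at most
  \<open>C exp (-\<epsilon>\<^sup>2 ln k)\<close> for every \<open>k\<close>, so it vanishes; a null set of the Peyriere measure has null sections almost
  surely.
\<close>

theorem log_average_converges:
  assumes \<alpha>: "\<bar>\<alpha>\<bar> < 2"
  shows "AE \<omega> in M. AE t in chaos_measure \<Phi> \<alpha> \<omega>. (\<lambda>N. log_average \<Phi> N \<omega> t) \<longlonglongrightarrow> \<alpha> / 2"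
proof -
  obtain K where kern: "chaos_kernel \<alpha> K" using chaos_kernel_exists[OF \<alpha>] by blast
  note K = chaos_kernelD[OF kern]
  let ?P = "peyriere_measure M \<Phi> \<alpha>"
  define bad where "bad \<epsilon> = (\<Inter>k\<in>{1..}. \<Union>N. deviation_set \<alpha> \<epsilon> k N)" for \<epsilon>
  have ds: "deviation_set \<alpha> \<epsilon> k N \<in> sets (torus \<Otimes>\<^sub>M M)" for \<epsilon> k N
    by (rule pair_history_sets[OF deviation_set_history])
  have bs: "bad \<epsilon> \<in> sets (torus \<Otimes>\<^sub>M M)" for \<epsilon>
    unfolding bad_def by (intro sets.countable_INT' sets.countable_UN) (use ds in auto)
  have null: "emeasure ?P (bad \<epsilon>) = 0" if \<epsilon>: "\<epsilon> > 0" for \<epsilon>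
  proof -
    obtain C where C: "C > 0" "\<And>K N t. K \<ge> 1 \<Longrightarrow> deviation_prob \<alpha> \<epsilon> K N t \<le> C * real K powr (-\<epsilon>\<^sup>2)"
      using expectation_deviation[OF \<epsilon>, of \<alpha>] unfolding deviation_prob_def by blast
    have le: "emeasure ?P (bad \<epsilon>) \<le> ennreal (C * real k powr (-\<epsilon>\<^sup>2))" if k: "k \<ge> 1" for k
    proof -
      have inc: "incseq (\<lambda>N. deviation_set \<alpha> \<epsilon> k N)"
        by (rule incseq_SucI) (auto simp: deviation_set_def deviates_def)
      have "emeasure ?P (bad \<epsilon>) \<le> emeasure ?P (\<Union>N. deviation_set \<alpha> \<epsilon> k N)"
        using ds sets_peyriere k by (intro emeasure_mono) (auto simp: bad_def)
      also have "\<dots> = (SUP N. emeasure ?P (deviation_set \<alpha> \<epsilon> k N))"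
        using ds sets_peyriere inc by (intro SUP_emeasure_incseq[symmetric]) auto
      also have "\<dots> \<le> ennreal (C * real k powr (-\<epsilon>\<^sup>2))"
        by (intro SUP_least peyriere_deviation_le[OF \<alpha> C(2)[OF k]])
      finally show ?thesis .
    qed
    have "(\<lambda>k. C * real k powr (-\<epsilon>\<^sup>2)) \<longlonglongrightarrow> C * 0"
      using \<epsilon> by (intro tendsto_mult_left tendsto_neg_powr filterlim_real_sequentially) simp
    then have "(\<lambda>k. ennreal (C * real k powr (-\<epsilon>\<^sup>2))) \<longlonglongrightarrow> ennreal 0"
      by (intro tendsto_ennrealI) simp
    then have "emeasure ?P (bad \<epsilon>) \<le> ennreal 0"
      by (rule LIMSEQ_le_const) (use le in blast)
    then show ?thesis by simp
  qed
  have "AE \<omega> in M. AE t in K \<omega>. (t, \<omega>) \<notin> bad \<epsilon>" if \<epsilon>: "\<epsilon> > 0" for \<epsilon>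
  proof -
    have "(\<integral>\<^sup>+\<omega>. emeasure (K \<omega>) ((\<lambda>t. (t, \<omega>)) -` bad \<epsilon>) \<partial>M) = 0"
      using null[OF \<epsilon>] unfolding emeasure_peyriere[OF kern bs] .
    then have "AE \<omega> in M. emeasure (K \<omega>) ((\<lambda>t. (t, \<omega>)) -` bad \<epsilon>) = 0"
      by (subst (asm) nn_integral_0_iff_AE) (auto intro: kernel_section_measurable[OF K(2-4) bs])
    then show ?thesis
    proof eventually_elim
      case (elim \<omega>)
      have "(\<lambda>t. (t, \<omega>)) -` bad \<epsilon> \<in> null_sets (K \<omega>)"
        using elim sets_Pair2[OF bs] K(3) by (auto intro: null_setsI)
      from AE_not_in[OF this] show ?case by eventually_elim simp
    qed
  qed
  then have "AE \<omega> in M. \<forall>j. AE t in K \<omega>. (t, \<omega>) \<notin> bad (1 / real (Suc j))"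
    unfolding AE_all_countable by simp
  then show ?thesis using K(1) AE_space
  proof eventually_elim
    case (elim \<omega>)
    have sp: "space (K \<omega>) = {0..<2*pi}" using sets_eq_imp_space_eq[OF K(3)] by simp
    have "AE t in K \<omega>. \<forall>j. (t, \<omega>) \<notin> bad (1 / real (Suc j))"
      using elim(1) unfolding AE_all_countable .
    then have "AE t in K \<omega>. (\<lambda>N. log_average \<Phi> N \<omega> t) \<longlonglongrightarrow> \<alpha> / 2"
      using AE_space
    proof eventually_elim
      case (elim t)
      show ?case
      proof (rule LIMSEQ_I)
        fix e :: real assume "e > 0"
        then obtain j where j: "1 / real (Suc j) < e" using nat_approx_posE by (metis of_nat_Suc)
        from elim(1) have "(t, \<omega>) \<notin> bad (1 / real (Suc j))" by blast
        then obtain k where k: "k \<ge> 1" "\<And>N. (t, \<omega>) \<notin> deviation_set \<alpha> (1 / real (Suc j)) k N"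
          by (auto simp: bad_def)
        show "\<exists>no. \<forall>n\<ge>no. norm (log_average \<Phi> n \<omega> t - \<alpha> / 2) < e"
        proof (intro exI allI impI)
          fix n assume n: "max k 2 \<le> n"
          have L: "0 < ln (real n)" using n by simp
          have "\<bar>field n t \<omega> - \<alpha>/2 * ln (real n)\<bar> \<le> 1 / real (Suc j) * ln (real n)"
            using k(2)[of n] n elim(2) sp \<open>\<omega> \<in> space M\<close> by (auto simp: deviation_set_def deviates_def not_less simp del: of_nat_Suc)
          also have "\<dots> < e * ln (real n)" using j L by (intro mult_strict_right_mono)
          finally have "\<bar>field n t \<omega> - \<alpha>/2 * ln (real n)\<bar> / ln (real n) < e" using L by (simp add: divide_less_eq)
          moreover have "log_average \<Phi> n \<omega> t - \<alpha> / 2 = (field n t \<omega> - \<alpha>/2 * ln (real n)) / ln (real n)"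
            using L by (simp add: log_average_field diff_divide_distrib)
          ultimately show "norm (log_average \<Phi> n \<omega> t - \<alpha> / 2) < e" using L by (simp add: abs_divide)
        qed
      qed
    qed
    then show ?case unfolding elim(2) .
  qed
qed

end

theorem theorem1p1:
  fixes M :: "'a measure" and \<Phi> :: "nat \<Rightarrow> 'a \<Rightarrow> real" and \<alpha> :: real
  assumes "prob_space M"
    and "prob_space.indep_vars M (\<lambda>_. torus) \<Phi> {1..}"
    and "\<And>n. n \<ge> 1 \<Longrightarrow> distr M torus (\<Phi> n) = torus"
    and "-2 < \<alpha>" and "\<alpha> < 2"
  shows "(AE \<omega> in M. AE t in chaos_measure \<Phi> \<alpha> \<omega>. (\<lambda>N. log_average \<Phi> N \<omega> t) \<longlonglongrightarrow> \<alpha> / 2) \<and>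
    (\<forall>\<eta>>0. (\<lambda>N. 1 / ln (real N) *
        ln (measure (peyriere_measure M \<Phi> \<alpha>)
          {(t, \<omega>) \<in> space torus \<times> space M. log_average \<Phi> N \<omega> t \<notin> {\<alpha> / 2 - \<eta>..\<alpha> / 2 + \<eta>}}))
      \<longlonglongrightarrow> - (\<eta>\<^sup>2))"
proof -
  interpret prob_space M by (rule assms(1))
  interpret random_phases M \<Phi>
    by unfold_locales (use assms(2,3) in auto)
  have "\<bar>\<alpha>\<bar> < 2" using assms(4,5) by simp
  then show ?thesis using log_average_converges peyriere_large_deviations by blast
qed

end
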